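(* There is an algorithm that, given an undirected simple graph $G=(V,E)$ with $n$ vertices and $m$ edges, a nonempty edge set $\mathit{In}\subseteq E$ such that $G[\mathit{In}]$ is connected, and a non-negative integer $k$, enumerates all edge $k$-graphlets of $G$ that contain $\mathit{In}$ in $O(n+m+k\cdot N)$ total time and $O(n+m)$ space, where $N$ is the number of such edge $k$-graphlets. Moreover, if the instance is trimmed, it runs in $O(k\cdot N)$ time.
   Context: For $F\subseteq E$, $G[F]=(U,F)$ with $U$ the set of endpoints of edges of $F$; $V_{\mathit{In}}$ denotes the vertex set of $G[\mathit{In}]$. An edge $k$-graphlet is a connected $G[F]$ with $|F|=k$; it contains $\mathit{In}$ if $\mathit{In}\subseteq F$. For a vertex set $X$ and edge $e=\{u,v\}$, $\mathrm{dist}(X,e)$ is the minimum over $w\in\{u,v\}$ of the graph distance from $w$ to the nearest vertex of $X$. An edge $e$ is unnecessary if $\mathrm{dist}(V_{\mathit{In}},e)\ge k-|\mathit{In}|$. The instance $(G,\mathit{In},k)$ is trimmed if $G$ has no unnecessary edges. The graph is stored in adjacency lists supporting neighbour iteration in $O(\deg(v))$, edge insertion/deletion in $O(1)$, and edge contraction in $O(\deg)$ of one endpoint.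
   Formalization: For trimmed instances the time bound is O(k·N + 1) rather than O(k·N), since a trimmed instance can have N = 0 (a single edge, In = E, k = 5), where O(k·N) would mean zero steps; for N ≥ 1 the two bounds coincide. *)

theory Defs
  imports Main "HOL-Library.Extended_Nat"
begin

section \<open>Graphs and edge graphlets\<close>

type_synonym 'a graph = "'a set \<times> 'a set set"

abbreviation verts :: "'a graph \<Rightarrow> 'a set" where "verts G \<equiv> fst G"
abbreviation edges :: "'a graph \<Rightarrow> 'a set set" where "edges G \<equiv> snd G"

definition simple_graph :: "'a graph \<Rightarrow> bool" where
  "simple_graph G \<longleftrightarrow> finite (verts G) \<and> (\<forall>e\<in>edges G. e \<subseteq> verts G \<and> card e = 2)"

definition walk :: "'a graph \<Rightarrow> 'a \<Rightarrow> 'a list \<Rightarrow> 'a \<Rightarrow> bool" where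
  "walk G u xs v \<longleftrightarrow> xs \<noteq> [] \<and> hd xs = u \<and> last xs = v \<and> set xs \<subseteq> verts G \<and>
     successively (\<lambda>x y. {x, y} \<in> edges G) xs"

definition connected_graph :: "'a graph \<Rightarrow> bool" where
  "connected_graph G \<longleftrightarrow> (\<forall>u\<in>verts G. \<forall>v\<in>verts G. \<exists>xs. walk G u xs v)"

text \<open>\<open>G[F]\<close>: it depends on \<open>F\<close> only, as long as \<open>F\<close> is a set of edges of \<open>G\<close>.\<close>

definition edge_subgraph :: "'a set set \<Rightarrow> 'a graph" where
  "edge_subgraph F = (\<Union>F, F)"

definition edge_graphlet :: "'a graph \<Rightarrow> nat \<Rightarrow> 'a graph \<Rightarrow> bool" where
  "edge_graphlet G k H \<longleftrightarrow>
     (\<exists>F. F \<subseteq> edges G \<and> card F = k \<and> H = edge_subgraph F \<and> connected_graph H)"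

definition graphlets_containing :: "'a graph \<Rightarrow> 'a set set \<Rightarrow> nat \<Rightarrow> 'a graph set" where
  "graphlets_containing G In k = {H. edge_graphlet G k H \<and> In \<subseteq> edges H}"

definition graph_dist :: "'a graph \<Rightarrow> 'a \<Rightarrow> 'a \<Rightarrow> enat" where
  "graph_dist G u v = (INF xs \<in> {xs. walk G u xs v}. enat (length xs - 1))"

definition edge_dist :: "'a graph \<Rightarrow> 'a set \<Rightarrow> 'a set \<Rightarrow> enat" where
  "edge_dist G X e = (INF w\<in>e. INF x\<in>X. graph_dist G w x)"

text \<open>If \<open>k < card In\<close>, the truncated difference is \<open>0\<close>; like a negative threshold, this
  makes every edge unnecessary.\<close>

definition unnecessary :: "'a graph \<Rightarrow> 'a set set \<Rightarrow> nat \<Rightarrow> 'a set \<Rightarrow> bool" where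
  "unnecessary G In k e \<longleftrightarrow> edge_dist G (verts (edge_subgraph In)) e \<ge> enat (k - card In)"

definition trimmed :: "'a graph \<Rightarrow> 'a set set \<Rightarrow> nat \<Rightarrow> bool" where
  "trimmed G In k \<longleftrightarrow> (\<forall>e\<in>edges G. \<not> unnecessary G In k e)"


section \<open>A word RAM with unit-cost operations\<close>

text \<open>Programs are structured programs over registers (finitely many per program) and a random
  access memory. They translate into jump code with constant overhead per executed instruction.\<close>

type_synonym reg = nat

datatype binop = Add | Sub | Mul | Div | Less | Eq

fun eval_binop :: "binop \<Rightarrow> nat \<Rightarrow> nat \<Rightarrow> nat" where
  "eval_binop Add x y = x + y"
| "eval_binop Sub x y = x - y"
| "eval_binop Mul x y = x * y"
| "eval_binop Div x y = x div y"
| "eval_binop Less x y = of_bool (x < y)"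
| "eval_binop Eq x y = of_bool (x = y)"

datatype com =
    Skip
  | Const reg nat
  | BinOp binop reg reg reg  \<comment> \<open>operation, target, operands\<close>
  | Load reg reg             \<comment> \<open>target, address\<close>
  | Store reg reg            \<comment> \<open>address, source\<close>
  | Output reg
  | Seq com com
  | IfNZ reg com com         \<comment> \<open>branch on the register being nonzero\<close>
  | WhileNZ reg com          \<comment> \<open>loop as long as the register is nonzero\<close>

record state =
  regs :: "reg \<Rightarrow> nat"
  mem :: "nat \<Rightarrow> nat"
  out :: "nat list"          \<comment> \<open>write-only output stream\<close>

text \<open>\<open>exec S W c s t s'\<close>: on a machine with \<open>S\<close> memory cells whose words hold the numbers up to
  \<open>W\<close>, program \<open>c\<close> started in \<open>s\<close> halts in \<open>s'\<close> after \<open>t\<close> steps. There is no such run if \<open>c\<close>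
  addresses a cell outside \<open>{..<S}\<close> or produces a number exceeding \<open>W\<close>, so \<open>S\<close> bounds the space.
  The output stream does not count as space.\<close>

inductive exec :: "nat \<Rightarrow> nat \<Rightarrow> com \<Rightarrow> state \<Rightarrow> nat \<Rightarrow> state \<Rightarrow> bool" for S W :: nat where
  Skip: "exec S W Skip s 1 s"
| Const: "v \<le> W \<Longrightarrow> exec S W (Const r v) s 1 (s\<lparr>regs := (regs s)(r := v)\<rparr>)"
| BinOp: "v = eval_binop f (regs s a) (regs s b) \<Longrightarrow> v \<le> W \<Longrightarrow>
    exec S W (BinOp f r a b) s 1 (s\<lparr>regs := (regs s)(r := v)\<rparr>)"
| Load: "regs s a < S \<Longrightarrow> mem s (regs s a) \<le> W \<Longrightarrow>
    exec S W (Load r a) s 1 (s\<lparr>regs := (regs s)(r := mem s (regs s a))\<rparr>)"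
| Store: "regs s a < S \<Longrightarrow>
    exec S W (Store a r) s 1 (s\<lparr>mem := (mem s)(regs s a := regs s r)\<rparr>)"
| Output: "exec S W (Output r) s 1 (s\<lparr>out := out s @ [regs s r]\<rparr>)"
| Seq: "exec S W c1 s t1 s1 \<Longrightarrow> exec S W c2 s1 t2 s2 \<Longrightarrow> exec S W (Seq c1 c2) s (t1 + t2) s2"
| IfTrue: "regs s r \<noteq> 0 \<Longrightarrow> exec S W c1 s t s1 \<Longrightarrow> exec S W (IfNZ r c1 c2) s (1 + t) s1"
| IfFalse: "regs s r = 0 \<Longrightarrow> exec S W c2 s t s1 \<Longrightarrow> exec S W (IfNZ r c1 c2) s (1 + t) s1"
| WhileFalse: "regs s r = 0 \<Longrightarrow> exec S W (WhileNZ r c) s 1 s"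
| WhileTrue: "regs s r \<noteq> 0 \<Longrightarrow> exec S W c s t1 s1 \<Longrightarrow> exec S W (WhileNZ r c) s1 t2 s2 \<Longrightarrow>
    exec S W (WhileNZ r c) s (1 + t1 + t2) s2"

lemma exec_deterministic:
  "exec S W c s t s1 \<Longrightarrow> exec S W c s t' s1' \<Longrightarrow> t' = t \<and> s1' = s1"
proof (induction arbitrary: t' s1' rule: exec.induct)
  case (Seq c1 s t1 s1 c2 t2 s2)
  from Seq.prems obtain u1 s' u2
    where *: "t' = u1 + u2" "exec S W c1 s u1 s'" "exec S W c2 s' u2 s1'"
    by cases auto
  with Seq.IH(1)[OF *(2)] Seq.IH(2)[of u2 s1'] show ?case by simp
next
  case (IfTrue s r c1 t s1 c2)
  from IfTrue.prems IfTrue.hyps obtain u where *: "t' = 1 + u" "exec S W c1 s u s1'"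
    by cases auto
  with IfTrue.IH[OF *(2)] show ?case by simp
next
  case (IfFalse s r c2 t s1 c1)
  from IfFalse.prems IfFalse.hyps obtain u where *: "t' = 1 + u" "exec S W c2 s u s1'"
    by cases auto
  with IfFalse.IH[OF *(2)] show ?case by simp
next
  case (WhileTrue s r c t1 s1 t2 s2)
  from WhileTrue.prems WhileTrue.hyps obtain u1 s' u2
    where *: "t' = 1 + u1 + u2" "exec S W c s u1 s'" "exec S W (WhileNZ r c) s' u2 s1'"
    by cases auto
  with WhileTrue.IH(1)[OF *(2)] WhileTrue.IH(2)[of u2 s1'] show ?case by simp
qed (erule exec.cases; simp; fail)+

definition initial_state :: "(nat \<Rightarrow> nat) \<Rightarrow> state" where
  "initial_state M = \<lparr>regs = (\<lambda>_. 0), mem = M, out = []\<rparr>"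


section \<open>Encoding of instances and of the enumerated graphlets\<close>

text \<open>The vertices are \<open>0, \<dots>, n - 1\<close>. The list \<open>es\<close> numbers the edges and orients each of them
  arbitrarily. Edge number \<open>i\<close> gives rise to two arcs: arc \<open>i\<close> in the direction of \<open>es ! i\<close>
  and its twin, arc \<open>i + m\<close>, in the opposite direction.\<close>

definition numbered_edge :: "(nat \<times> nat) list \<Rightarrow> nat \<Rightarrow> nat set" where
  "numbered_edge es i = {fst (es ! i), snd (es ! i)}"

definition edge_numbering :: "nat graph \<Rightarrow> (nat \<times> nat) list \<Rightarrow> bool" where
  "edge_numbering G es \<longleftrightarrow> inj_on (numbered_edge es) {..<length es} \<and>
     numbered_edge es ` {..<length es} = edges G"

definition arc_tail :: "(nat \<times> nat) list \<Rightarrow> nat \<Rightarrow> nat" where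
  "arc_tail es a = (if a < length es then fst (es ! a) else snd (es ! (a - length es)))"

definition arc_head :: "(nat \<times> nat) list \<Rightarrow> nat \<Rightarrow> nat" where
  "arc_head es a = (if a < length es then snd (es ! a) else fst (es ! (a - length es)))"

text \<open>Arc \<open>a\<close> is referred to by the pointer \<open>a + 1\<close>, and \<open>0\<close> is the null pointer. The arcs leaving
  a vertex form a doubly linked list, in arbitrary order. With the twin of an arc at hand, this
  supports neighbour iteration in \<open>O(deg)\<close>, insertion and deletion of an edge in \<open>O(1)\<close>
  and contraction in the degree of one endpoint.\<close>

definition linked_list ::
    "nat \<Rightarrow> (nat \<Rightarrow> nat) \<Rightarrow> (nat \<Rightarrow> nat) \<Rightarrow> nat list \<Rightarrow> bool" where
  "linked_list first succ pred as \<longleftrightarrow>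
     first = (if as = [] then 0 else as ! 0 + 1) \<and>
     (\<forall>i<length as.
        succ (as ! i) = (if i + 1 < length as then as ! (i + 1) + 1 else 0) \<and>
        pred (as ! i) = (if i = 0 then 0 else as ! (i - 1) + 1))"

text \<open>Memory layout: four cells for \<open>n\<close>, \<open>m\<close>, \<open>k\<close> and the size of \<open>In\<close>; list heads
  of the \<open>n\<close> vertices; heads, successors and predecessors of the \<open>2 * m\<close> arcs; the numbers of the
  edges in \<open>In\<close>. All other cells are \<open>0\<close>.\<close>

definition encodes_instance ::
    "nat graph \<Rightarrow> nat set set \<Rightarrow> nat \<Rightarrow> (nat \<times> nat) list \<Rightarrow> (nat \<Rightarrow> nat) \<Rightarrow> bool" where
  "encodes_instance G In k es M \<longleftrightarrow>
     (let n = card (verts G); m = card (edges G); l = card In in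
      verts G = {..<n} \<and> edge_numbering G es \<and>
      M 0 = n \<and> M 1 = m \<and> M 2 = k \<and> M 3 = l \<and>
      (\<forall>v<n. \<exists>as. distinct as \<and> set as = {a. a < 2 * m \<and> arc_tail es a = v} \<and>
         linked_list (M (4 + v)) (\<lambda>a. M (4 + n + 2 * m + a)) (\<lambda>a. M (4 + n + 4 * m + a)) as) \<and>
      (\<forall>a<2 * m. M (4 + n + a) = arc_head es a) \<and>
      (\<exists>is. length is = l \<and> set is \<subseteq> {..<m} \<and> numbered_edge es ` set is = In \<and>
         (\<forall>j<l. M (4 + n + 6 * m + j) = is ! j)) \<and>
      (\<forall>a\<ge>4 + n + 6 * m + l. M a = 0))"

text \<open>Each graphlet is written as a block of the numbers of its \<open>k\<close> edges, in any order, and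
  each graphlet of \<open>\<H>\<close> is written exactly once.\<close>

definition enumerates ::
    "(nat \<times> nat) list \<Rightarrow> nat \<Rightarrow> nat graph set \<Rightarrow> nat list \<Rightarrow> bool" where
  "enumerates es k \<H> xs \<longleftrightarrow>
     (\<exists>bs. xs = concat bs \<and>
        (\<forall>b\<in>set bs. length b = k \<and> distinct b \<and> set b \<subseteq> {..<length es}) \<and>
        distinct (map (\<lambda>b. edge_subgraph (numbered_edge es ` set b)) bs) \<and>
        set (map (\<lambda>b. edge_subgraph (numbered_edge es ` set b)) bs) = \<H>)"

end

theory Submission
  imports Defs
begin

text \<open>Binary partition: a subproblem consists of a connected set \<open>F \<supseteq> In\<close> of chosen edges and a set \<open>X\<close> of
  excluded edges, the latter deleted from the adjacency lists; it has a solution iff the component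
  of \<open>F\<close> in \<open>G - X\<close> has at least \<open>k \<ge> card F\<close> edges. A search from \<open>F\<close> holds back the first new edge \<open>h\<close> that it
  sees and explores without using \<open>h\<close>. If it sees \<open>k + 1\<close> edges, then both including and excluding \<open>h\<close>
  leave solutions, and we branch. If it gets stuck earlier, then \<open>h\<close> is forced: \<open>h\<close> is chosen and
  the same search goes on from its far end, holding back the next edge. Hence a whole run of forced
  edges costs one search of \<open>O(k)\<close> steps, every subproblem either branches into two solvable ones
  or yields a single solution, and there are at most \<open>2 * N\<close> of them. No trimming is needed: the only
  further work is \<open>O(k)\<close> when \<open>N = 0\<close>, which a trimmed instance avoids because its
  graph is connected, so that \<open>N = 0\<close> only if \<open>m < k\<close>.\<close>

section \<open>Structured programs on arrays\<close>

text \<open>The cost bound rests on never scanning an arc in vain: excluded edges are absent from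
  the lists, so each scanned arc belongs to a seen edge, and the at most \<open>k + 1\<close> seen
  edges bound arcs, vertices and forced edges together. The number \<open>k + 1\<close> makes both
  branches solvable: the \<open>k\<close> seen edges other than \<open>h\<close> solve the
  exclusion, and the connected set of all \<open>k + 1\<close> contains a solution that includes
  \<open>h\<close>. For the latter, \<open>h\<close> has to touch the chosen edges. Forcing
  preserves this because the queue is exhausted at that moment: only ends of the forced edge remain
  to be scanned, so the next new edge touches it. The bound for trimmed instances forbids any
  initialization linear in \<open>n + m\<close>. The zero memory serves as cleared marks, and each
  search erases its own marks with the help of its lists. That no graphlet is written twice is not
  traced through the recursion but read off from a count of solutions.\<close>

datatype arrid = First | Head | Succ | Pred | Chosen | VMark | EMark | Queue | Seen | Excl | ExclLen

text \<open>\<open>Held\<close> and \<open>Ptr\<close> store an edge or arc number plus one, so that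
  0 can stand for none. \<open>Go\<close> and \<open>Run\<close> are the flags of the scan and of
  the main loop.\<close>

datatype var = EdgeCnt | Size | ChosenCnt | Depth | Run | SeenCnt | QueueLen | QueuePos | Ptr | Held
  | Go | Arc | Edge | Vert | Idx | Tmp | Prv | Nxt

datatype opd = Var var | Zero | One

datatype acom =
    ASkip
  | AAsg var binop opd opd
  | ALoad var arrid opd
  | AStore arrid opd opd
  | AOut opd
  | ASeq acom acom  (infixr \<open>;;\<close> 60)
  | AIf binop opd opd acom acom
  | AWhile binop opd opd acom

text \<open>Registers 0 to 3 are scratch, 4 to 14 keep the base addresses of the arrays so that an
  access takes constant time, and the variables start at 15.\<close>

fun vreg :: "var \<Rightarrow> reg" where
  "vreg EdgeCnt = 15" | "vreg Size = 16" | "vreg ChosenCnt = 17" | "vreg Depth = 18"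
| "vreg Run = 19" | "vreg SeenCnt = 20" | "vreg QueueLen = 21" | "vreg QueuePos = 22"
| "vreg Ptr = 23" | "vreg Held = 24" | "vreg Go = 25" | "vreg Arc = 26" | "vreg Edge = 27"
| "vreg Vert = 28" | "vreg Idx = 29" | "vreg Tmp = 30" | "vreg Prv = 31" | "vreg Nxt = 32"

fun breg :: "arrid \<Rightarrow> reg" where
  "breg First = 4" | "breg Head = 5" | "breg Succ = 6" | "breg Pred = 7" | "breg Chosen = 8"
| "breg VMark = 9" | "breg EMark = 10" | "breg Queue = 11" | "breg Seen = 12" | "breg Excl = 13"
| "breg ExclLen = 14"

lemma vreg_eq_iff [simp]: "vreg x = vreg y \<longleftrightarrow> x = y"
  by (cases x; cases y; simp)

lemma vreg_ge: "15 \<le> vreg x"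
  by (cases x; simp)

lemma breg_bounds: "4 \<le> breg a" "breg a < 15"
  by (cases a; simp)+

lemma vreg_neq [simp]:
  "vreg x \<noteq> 0" "vreg x \<noteq> Suc 0" "vreg x \<noteq> 1" "vreg x \<noteq> 2" "vreg x \<noteq> breg a" "breg a \<noteq> vreg x"
  using vreg_ge[of x] breg_bounds[of a] by auto

lemma breg_neq [simp]: "breg a \<noteq> 0" "breg a \<noteq> Suc 0" "breg a \<noteq> 1" "breg a \<noteq> 2"
  using breg_bounds[of a] by auto

record ast =
  vars :: "var \<Rightarrow> nat"
  arrs :: "arrid \<Rightarrow> nat \<Rightarrow> nat"
  outs :: "nat list"

fun ev :: "ast \<Rightarrow> opd \<Rightarrow> nat" where
  "ev \<sigma> (Var x) = vars \<sigma> x"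
| "ev \<sigma> Zero = 0"
| "ev \<sigma> One = 1"

text \<open>The machine has no copy instruction: the target is cleared and the variable added to
  it.\<close>

fun move :: "reg \<Rightarrow> opd \<Rightarrow> com" where
  "move r (Var x) = Seq (Const r 0) (BinOp Add r (vreg x) r)"
| "move r Zero = Const r 0"
| "move r One = Const r 1"

definition compute :: "binop \<Rightarrow> opd \<Rightarrow> opd \<Rightarrow> reg \<Rightarrow> com" where
  "compute f a b r = Seq (move 1 a) (Seq (move 2 b) (BinOp f r 1 2))"

text \<open>\<open>WhileNZ\<close> only tests a register, so the guard of a loop is computed before
  the loop and again at the end of each round.\<close>

fun compile :: "acom \<Rightarrow> com" where
  "compile ASkip = Skip"
| "compile (AAsg x f a b) = compute f a b (vreg x)"
| "compile (ALoad x A i) = Seq (move 1 i) (Seq (BinOp Add 1 (breg A) 1) (Load (vreg x) 1))"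
| "compile (AStore A i b) =
     Seq (move 1 i) (Seq (BinOp Add 1 (breg A) 1) (Seq (move 2 b) (Store 1 2)))"
| "compile (AOut a) = Seq (move 1 a) (Output 1)"
| "compile (c ;; d) = Seq (compile c) (compile d)"
| "compile (AIf f a b c d) = Seq (compute f a b 1) (IfNZ 1 (compile c) (compile d))"
| "compile (AWhile f a b c) =
     Seq (compute f a b 1) (WhileNZ 1 (Seq (compile c) (compute f a b 1)))"

text \<open>Bounds the running time of programs without loops only.\<close>

fun cost :: "acom \<Rightarrow> nat" where
  "cost ASkip = 1"
| "cost (AAsg x f a b) = 5"
| "cost (ALoad x A i) = 4"
| "cost (AStore A i b) = 6"
| "cost (AOut a) = 3"
| "cost (c ;; d) = cost c + cost d"
| "cost (AIf f a b c d) = 6 + max (cost c) (cost d)"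
| "cost (AWhile f a b c) = 0"

text \<open>\<^const>\<open>Chosen\<close> overlays the list of the edges in \<open>In\<close>, which it extends.\<close>

fun base :: "nat \<Rightarrow> nat \<Rightarrow> arrid \<Rightarrow> nat" where
  "base n m First = 4"
| "base n m Head = 4 + n"
| "base n m Succ = 4 + n + 2 * m"
| "base n m Pred = 4 + n + 4 * m"
| "base n m Chosen = 4 + n + 6 * m"
| "base n m VMark = 4 + n + 7 * m"
| "base n m EMark = 4 + 2 * n + 7 * m"
| "base n m Queue = 4 + 2 * n + 8 * m"
| "base n m Seen = 4 + 3 * n + 8 * m"
| "base n m Excl = 4 + 3 * n + 9 * m"
| "base n m ExclLen = 4 + 3 * n + 10 * m"

fun len :: "nat \<Rightarrow> nat \<Rightarrow> arrid \<Rightarrow> nat" where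
  "len n m First = n"
| "len n m Head = 2 * m"
| "len n m Succ = 2 * m"
| "len n m Pred = 2 * m"
| "len n m Chosen = m"
| "len n m VMark = n"
| "len n m EMark = m"
| "len n m Queue = n"
| "len n m Seen = m"
| "len n m Excl = m"
| "len n m ExclLen = m"

lemma base_len_le: "base n m A + len n m A \<le> 4 + 3 * n + 11 * m"
  by (cases A) auto

lemma arrays_disjoint:
  "i < len n m A \<Longrightarrow> j < len n m B \<Longrightarrow> base n m A + i = base n m B + j \<longleftrightarrow> A = B \<and> i = j"
  by (cases A; cases B; simp)

text \<open>The default 0 outside the array makes \<open>view_upd\<close> an equation between
  functions and lets cleared marks be stated as equality with a constant function.\<close>

definition view :: "nat \<Rightarrow> nat \<Rightarrow> (nat \<Rightarrow> nat) \<Rightarrow> arrid \<Rightarrow> nat \<Rightarrow> nat" where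
  "view n m M A i = (if i < len n m A then M (base n m A + i) else 0)"

lemma view_upd:
  assumes "i < len n m A"
  shows "view n m (M(base n m A + i := x)) = (view n m M)(A := (view n m M A)(i := x))"
  using assms by (auto simp: view_def fun_eq_iff arrays_disjoint)

section \<open>A program logic with step bounds\<close>

locale machine =
  fixes n m S W :: nat
  assumes layout: "4 + 3 * n + 11 * m \<le> S" and words: "S \<le> W"
begin

definition abstract :: "state \<Rightarrow> ast" where
  "abstract s = \<lparr>vars = (\<lambda>x. regs s (vreg x)), arrs = view n m (mem s), outs = out s\<rparr>"

text \<open>Compiled code trusts the base registers to keep their values; the bounds on all words
  are what \<open>Load\<close> and the scratch computations need.\<close>

definition wf :: "state \<Rightarrow> bool" where
  "wf s \<longleftrightarrow> (\<forall>r. regs s r \<le> W) \<and> (\<forall>a. mem s a \<le> W) \<and> (\<forall>A. regs s (breg A) = base n m A)"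

text \<open>Only sums and products can overflow; every other result is bounded by its first operand
  or by 1.\<close>

fun fits :: "binop \<Rightarrow> nat \<Rightarrow> nat \<Rightarrow> bool" where
  "fits Add x y \<longleftrightarrow> x + y \<le> W"
| "fits Mul x y \<longleftrightarrow> x * y \<le> W"
| "fits _ x y \<longleftrightarrow> True"

text \<open>Symbolic execution of loop-free code. A loop gets \<open>False\<close>, which makes its
  nominal \<open>cost\<close> of 0 harmless; loops go through \<open>triple_While\<close>.\<close>

fun wp :: "acom \<Rightarrow> (ast \<Rightarrow> bool) \<Rightarrow> ast \<Rightarrow> bool" where
  "wp ASkip Q \<sigma> = Q \<sigma>"
| "wp (AAsg x f a b) Q \<sigma> = (fits f (ev \<sigma> a) (ev \<sigma> b) \<and>
     Q (\<sigma>\<lparr>vars := (vars \<sigma>)(x := eval_binop f (ev \<sigma> a) (ev \<sigma> b))\<rparr>))"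
| "wp (ALoad x A i) Q \<sigma> = (ev \<sigma> i < len n m A \<and>
     Q (\<sigma>\<lparr>vars := (vars \<sigma>)(x := arrs \<sigma> A (ev \<sigma> i))\<rparr>))"
| "wp (AStore A i b) Q \<sigma> = (ev \<sigma> i < len n m A \<and>
     Q (\<sigma>\<lparr>arrs := (arrs \<sigma>)(A := (arrs \<sigma> A)(ev \<sigma> i := ev \<sigma> b))\<rparr>))"
| "wp (AOut a) Q \<sigma> = Q (\<sigma>\<lparr>outs := outs \<sigma> @ [ev \<sigma> a]\<rparr>)"
| "wp (c ;; d) Q \<sigma> = wp c (wp d Q) \<sigma>"
| "wp (AIf f a b c d) Q \<sigma> = (fits f (ev \<sigma> a) (ev \<sigma> b) \<and>
     (if eval_binop f (ev \<sigma> a) (ev \<sigma> b) \<noteq> 0 then wp c Q \<sigma> else wp d Q \<sigma>))"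
| "wp (AWhile f a b c) Q \<sigma> = False"

text \<open>Total correctness within \<open>T\<close> steps. It speaks of a single start state
  instead of a precondition, so that a postcondition can itself be the \<open>triple\<close> of the
  remaining program.\<close>

definition triple :: "nat \<Rightarrow> acom \<Rightarrow> ast \<Rightarrow> (ast \<Rightarrow> bool) \<Rightarrow> bool" where
  "triple T c \<sigma> Q \<longleftrightarrow> (\<forall>s. wf s \<longrightarrow> abstract s = \<sigma> \<longrightarrow>
     (\<exists>t s'. exec S W (compile c) s t s' \<and> t \<le> T \<and> wf s' \<and> Q (abstract s')))"

lemma W_ge: "4 \<le> W"
  using layout words by simp

lemma exec_move:
  assumes "wf s" "r \<in> {1, 2}"
  shows "\<exists>t. exec S W (move r a) s t (s\<lparr>regs := (regs s)(r := ev (abstract s) a)\<rparr>) \<and> t \<le> 2"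
proof (cases a)
  case (Var x)
  define s1 where "s1 = s\<lparr>regs := (regs s)(r := 0)\<rparr>"
  have 1: "exec S W (Const r 0) s 1 s1"
    unfolding s1_def by (rule exec.Const) simp
  have "exec S W (BinOp Add r (vreg x) r) s1 1 (s1\<lparr>regs := (regs s1)(r := regs s (vreg x))\<rparr>)"
    using assms by (intro exec.BinOp) (auto simp: s1_def wf_def)
  from exec.Seq[OF 1 this] Var show ?thesis
    by (auto simp: s1_def abstract_def intro!: exI[of _ "1 + 1"])
next
  case Zero
  have "exec S W (Const r 0) s 1 (s\<lparr>regs := (regs s)(r := 0)\<rparr>)" by (rule exec.Const) simp
  with Zero show ?thesis by (auto intro!: exI[of _ 1])
next
  case One
  have "exec S W (Const r 1) s 1 (s\<lparr>regs := (regs s)(r := 1)\<rparr>)"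
    by (rule exec.Const) (use W_ge in simp)
  with One show ?thesis by (auto intro!: exI[of _ 1])
qed

lemma wf_regs_upd: "wf s \<Longrightarrow> r \<notin> range breg \<Longrightarrow> x \<le> W \<Longrightarrow> wf (s\<lparr>regs := (regs s)(r := x)\<rparr>)"
  by (auto simp: wf_def)

lemma scratch_notin_range [simp]:
  "Suc 0 \<notin> range breg" "2 \<notin> range breg" "vreg x \<notin> range breg"
  using breg_neq vreg_neq(6) by (metis imageE)+

lemma ev_le: "wf s \<Longrightarrow> ev (abstract s) a \<le> W"
  using W_ge by (cases a) (auto simp: wf_def abstract_def)

lemma fits_eval: "fits f x y \<Longrightarrow> x \<le> W \<Longrightarrow> eval_binop f x y \<le> W"
  using W_ge div_le_dividend[of x y] by (cases f) (auto simp: of_bool_def simp del: div_le_dividend)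

lemma exec_compute:
  assumes wf: "wf s" and fits: "fits f (ev (abstract s) a) (ev (abstract s) b)"
  shows "\<exists>t. exec S W (compute f a b r) s t
    (s\<lparr>regs := (regs s)(1 := ev (abstract s) a, 2 := ev (abstract s) b,
       r := eval_binop f (ev (abstract s) a) (ev (abstract s) b))\<rparr>) \<and> t \<le> 5"
proof -
  let ?a = "ev (abstract s) a" and ?b = "ev (abstract s) b"
  define s1 where "s1 = s\<lparr>regs := (regs s)(1 := ?a)\<rparr>"
  have wf1: "wf s1" unfolding s1_def using wf ev_le[OF wf] by (intro wf_regs_upd) auto
  have abs1: "abstract s1 = abstract s" by (simp add: abstract_def s1_def)
  define s2 where "s2 = s1\<lparr>regs := (regs s1)(2 := ?b)\<rparr>"
  obtain t1 where t1: "exec S W (move 1 a) s t1 s1" "t1 \<le> 2"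
    using exec_move[OF wf, of 1 a] by (auto simp: s1_def)
  obtain t2 where t2: "exec S W (move 2 b) s1 t2 s2" "t2 \<le> 2"
    using exec_move[OF wf1, of 2 b] by (auto simp: s2_def abs1)
  have "eval_binop f ?a ?b \<le> W" using fits_eval[OF fits ev_le[OF wf]] .
  then have "exec S W (BinOp f r 1 2) s2 1 (s2\<lparr>regs := (regs s2)(r := eval_binop f ?a ?b)\<rparr>)"
    by (intro exec.BinOp) (auto simp: s1_def s2_def)
  from exec.Seq[OF t1(1) exec.Seq[OF t2(1) this]] t1(2) t2(2) show ?thesis
    by (auto simp: compute_def s1_def s2_def intro!: exI[of _ "t1 + (t2 + 1)"])
qed

lemma exec_guard:
  assumes "wf s" "fits f (ev (abstract s) a) (ev (abstract s) b)"
  shows "\<exists>t s'. exec S W (compute f a b 1) s t s' \<and> t \<le> 5 \<and> wf s' \<and> abstract s' = abstract s \<and>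
    regs s' 1 = eval_binop f (ev (abstract s) a) (ev (abstract s) b)"
proof -
  let ?v = "eval_binop f (ev (abstract s) a) (ev (abstract s) b)"
  let ?s = "s\<lparr>regs := (regs s)(1 := ev (abstract s) a, 2 := ev (abstract s) b, 1 := ?v)\<rparr>"
  have "?v \<le> W" by (rule fits_eval[OF assms(2) ev_le[OF assms(1)]])
  then have "wf ?s" "abstract ?s = abstract s"
    using assms(1) ev_le[OF assms(1)] by (auto simp: wf_def abstract_def)
  with exec_compute[OF assms, of 1] show ?thesis by fastforce
qed

lemma tripleI:
  "(\<And>s. wf s \<Longrightarrow> abstract s = \<sigma> \<Longrightarrow>
     \<exists>t s'. exec S W (compile c) s t s' \<and> t \<le> T \<and> wf s' \<and> Q (abstract s')) \<Longrightarrow> triple T c \<sigma> Q"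
  by (auto simp: triple_def)

lemma triple_weaken:
  "triple T c \<sigma> Q \<Longrightarrow> T \<le> T' \<Longrightarrow> (\<And>\<sigma>'. Q \<sigma>' \<Longrightarrow> Q' \<sigma>') \<Longrightarrow> triple T' c \<sigma> Q'"
  unfolding triple_def by (metis le_trans)

lemma triple_Seq:
  assumes "triple T c \<sigma> (\<lambda>\<sigma>'. triple T' d \<sigma>' Q)"
  shows "triple (T + T') (c ;; d) \<sigma> Q"
proof (rule tripleI)
  fix s assume "wf s" "abstract s = \<sigma>"
  with assms obtain t1 s1 where 1: "exec S W (compile c) s t1 s1" "t1 \<le> T" "wf s1"
    "triple T' d (abstract s1) Q" unfolding triple_def by blast
  then obtain t2 s2 where "exec S W (compile d) s1 t2 s2" "t2 \<le> T'" "wf s2" "Q (abstract s2)"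
    unfolding triple_def by blast
  with 1 show "\<exists>t s'. exec S W (compile (c ;; d)) s t s' \<and> t \<le> T + T' \<and> wf s' \<and> Q (abstract s')"
    by (auto intro!: exI[of _ "t1 + t2"] exI[of _ s2] exec.Seq add_mono)
qed

lemma triple_If:
  assumes fits: "fits f (ev \<sigma> a) (ev \<sigma> b)"
    and "eval_binop f (ev \<sigma> a) (ev \<sigma> b) \<noteq> 0 \<Longrightarrow> triple T c \<sigma> Q"
    and "eval_binop f (ev \<sigma> a) (ev \<sigma> b) = 0 \<Longrightarrow> triple T d \<sigma> Q"
  shows "triple (6 + T) (AIf f a b c d) \<sigma> Q"
proof (rule tripleI)
  fix s assume wf: "wf s" and \<sigma>: "abstract s = \<sigma>"
  obtain t0 s0 where 0: "exec S W (compute f a b 1) s t0 s0" "t0 \<le> 5" "wf s0" "abstract s0 = \<sigma>"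
    "regs s0 1 = eval_binop f (ev \<sigma> a) (ev \<sigma> b)"
    using exec_guard[OF wf, of f a b] fits \<sigma> by auto
  have "\<exists>t s'. exec S W (IfNZ 1 (compile c) (compile d)) s0 (1 + t) s' \<and> t \<le> T \<and> wf s' \<and>
    Q (abstract s')"
  proof (cases "regs s0 1 = 0")
    case True
    with assms(3) 0 obtain t s' where "exec S W (compile d) s0 t s'" "t \<le> T" "wf s'"
      "Q (abstract s')" unfolding triple_def by force
    with True show ?thesis by (blast intro: exec.IfFalse)
  next
    case False
    with assms(2) 0 obtain t s' where "exec S W (compile c) s0 t s'" "t \<le> T" "wf s'"
      "Q (abstract s')" unfolding triple_def by force
    with False show ?thesis by (blast intro: exec.IfTrue)
  qed
  then obtain t s' where 1: "exec S W (IfNZ 1 (compile c) (compile d)) s0 (1 + t) s'" "t \<le> T"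
    "wf s'" "Q (abstract s')" by blast
  from exec.Seq[OF 0(1) 1(1)] 0(2) 1(2-4) show
    "\<exists>t s'. exec S W (compile (AIf f a b c d)) s t s' \<and> t \<le> 6 + T \<and> wf s' \<and> Q (abstract s')"
    by (intro exI[of _ "t0 + (1 + t)"] exI[of _ s']) simp
qed

lemma wp_imp_triple: "wp c Q \<sigma> \<Longrightarrow> triple (cost c) c \<sigma> Q"
proof (induction c arbitrary: Q \<sigma>)
  case ASkip
  then show ?case by (fastforce simp: triple_def intro: exec.Skip)
next
  case (AAsg x f a b)
  show ?case
  proof (rule tripleI)
    fix s assume wf: "wf s" and \<sigma>: "abstract s = \<sigma>"
    let ?v = "eval_binop f (ev \<sigma> a) (ev \<sigma> b)"
    let ?s = "s\<lparr>regs := (regs s)(1 := ev \<sigma> a, 2 := ev \<sigma> b, vreg x := ?v)\<rparr>"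
    have fits: "fits f (ev \<sigma> a) (ev \<sigma> b)" using AAsg by simp
    obtain t where t: "exec S W (compute f a b (vreg x)) s t ?s" "t \<le> 5"
      using exec_compute[OF wf, of f a b "vreg x"] fits \<sigma> by auto
    have "?v \<le> W" using fits_eval[OF fits] ev_le[OF wf] \<sigma> by simp
    then have "wf ?s" using wf ev_le[OF wf] \<sigma> by (auto simp: wf_def)
    moreover have "abstract ?s = \<sigma>\<lparr>vars := (vars \<sigma>)(x := ?v)\<rparr>"
      using \<sigma> by (auto simp: abstract_def fun_eq_iff)
    ultimately show "\<exists>t s'. exec S W (compile (AAsg x f a b)) s t s' \<and> t \<le> cost (AAsg x f a b) \<and>
      wf s' \<and> Q (abstract s')" using t AAsg by fastforce
  qed
next
  case (ALoad x A i)
  show ?case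
  proof (rule tripleI)
    fix s assume wf: "wf s" and \<sigma>: "abstract s = \<sigma>"
    let ?i = "ev \<sigma> i"
    have i: "?i < len n m A" using ALoad by simp
    have addr: "base n m A + ?i < S" using i base_len_le[of n m A] layout by simp
    define s1 where "s1 = s\<lparr>regs := (regs s)(1 := ?i)\<rparr>"
    define s2 where "s2 = s1\<lparr>regs := (regs s1)(1 := base n m A + ?i)\<rparr>"
    define s3 where "s3 = s2\<lparr>regs := (regs s2)(vreg x := mem s2 (regs s2 1))\<rparr>"
    obtain t where t: "exec S W (move 1 i) s t s1" "t \<le> 2"
      using exec_move[OF wf, of 1 i] \<sigma> by (auto simp: s1_def)
    have t2: "exec S W (BinOp Add 1 (breg A) 1) s1 1 s2"
      unfolding s2_def using addr words wf by (intro exec.BinOp) (auto simp: s1_def wf_def)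
    have t3: "exec S W (Load (vreg x) 1) s2 1 s3"
      unfolding s3_def using addr wf by (intro exec.Load) (auto simp: s1_def s2_def wf_def)
    have "wf s3" using wf addr words by (auto simp: wf_def s1_def s2_def s3_def)
    moreover have "abstract s3 = \<sigma>\<lparr>vars := (vars \<sigma>)(x := arrs \<sigma> A ?i)\<rparr>"
      using i \<sigma> by (auto simp: abstract_def s1_def s2_def s3_def view_def fun_eq_iff)
    ultimately show "\<exists>t s'. exec S W (compile (ALoad x A i)) s t s' \<and> t \<le> cost (ALoad x A i) \<and>
      wf s' \<and> Q (abstract s')"
      using exec.Seq[OF t(1) exec.Seq[OF t2 t3]] t(2) ALoad
      by (intro exI[of _ "t + (1 + 1)"] exI[of _ s3]) simp
  qed
next
  case (AStore A i b)
  show ?case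
  proof (rule tripleI)
    fix s assume wf: "wf s" and \<sigma>: "abstract s = \<sigma>"
    let ?i = "ev \<sigma> i" and ?b = "ev \<sigma> b"
    have i: "?i < len n m A" using AStore by simp
    have addr: "base n m A + ?i < S" using i base_len_le[of n m A] layout by simp
    define s1 where "s1 = s\<lparr>regs := (regs s)(1 := ?i)\<rparr>"
    define s2 where "s2 = s1\<lparr>regs := (regs s1)(1 := base n m A + ?i)\<rparr>"
    define s3 where "s3 = s2\<lparr>regs := (regs s2)(2 := ?b)\<rparr>"
    define s4 where "s4 = s3\<lparr>mem := (mem s3)(regs s3 1 := regs s3 2)\<rparr>"
    have b: "?b \<le> W" using ev_le[OF wf] \<sigma> by auto
    obtain t where t: "exec S W (move 1 i) s t s1" "t \<le> 2"
      using exec_move[OF wf, of 1 i] \<sigma> by (auto simp: s1_def)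
    have t2: "exec S W (BinOp Add 1 (breg A) 1) s1 1 s2"
      unfolding s2_def using addr words wf by (intro exec.BinOp) (auto simp: s1_def wf_def)
    have wf2: "wf s2" using wf addr words by (auto simp: wf_def s1_def s2_def)
    have abs2: "abstract s2 = \<sigma>" using \<sigma> by (auto simp: abstract_def s1_def s2_def)
    obtain t' where t3: "exec S W (move 2 b) s2 t' s3" "t' \<le> 2"
      using exec_move[OF wf2, of 2 b] abs2 by (auto simp: s3_def)
    have t4: "exec S W (Store 1 2) s3 1 s4"
      unfolding s4_def using addr by (intro exec.Store) (auto simp: s1_def s2_def s3_def)
    have "wf s4" using wf2 b by (auto simp: wf_def s3_def s4_def)
    moreover have "abstract s4 = \<sigma>\<lparr>arrs := (arrs \<sigma>)(A := (arrs \<sigma> A)(?i := ?b))\<rparr>"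
      using i \<sigma> by (auto simp: abstract_def s1_def s2_def s3_def s4_def view_upd)
    ultimately show "\<exists>t s'. exec S W (compile (AStore A i b)) s t s' \<and> t \<le> cost (AStore A i b) \<and>
      wf s' \<and> Q (abstract s')"
      using exec.Seq[OF t(1) exec.Seq[OF t2 exec.Seq[OF t3(1) t4]]] t(2) t3(2) AStore
      by (intro exI[of _ "t + (1 + (t' + 1))"] exI[of _ s4]) simp
  qed
next
  case (AOut a)
  show ?case
  proof (rule tripleI)
    fix s assume wf: "wf s" and \<sigma>: "abstract s = \<sigma>"
    define s1 where "s1 = s\<lparr>regs := (regs s)(1 := ev \<sigma> a)\<rparr>"
    obtain t where t: "exec S W (move 1 a) s t s1" "t \<le> 2"
      using exec_move[OF wf, of 1 a] \<sigma> by (auto simp: s1_def)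
    let ?s = "s1\<lparr>out := out s1 @ [regs s1 1]\<rparr>"
    have "wf ?s" using wf ev_le[OF wf, of a] \<sigma> by (auto simp: wf_def s1_def)
    moreover have "abstract ?s = \<sigma>\<lparr>outs := outs \<sigma> @ [ev \<sigma> a]\<rparr>"
      using \<sigma> by (auto simp: abstract_def s1_def)
    ultimately show "\<exists>t s'. exec S W (compile (AOut a)) s t s' \<and> t \<le> cost (AOut a) \<and>
      wf s' \<and> Q (abstract s')"
      using exec.Seq[OF t(1) exec.Output[of _ _ 1]] t(2) AOut
      by (intro exI[of _ "t + 1"] exI[of _ ?s]) simp
  qed
next
  case (ASeq c d)
  then have "triple (cost c) c \<sigma> (wp d Q)" by simp
  then have "triple (cost c) c \<sigma> (\<lambda>\<sigma>'. triple (cost d) d \<sigma>' Q)"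
    by (rule triple_weaken) (auto intro: ASeq)
  then show ?case by (simp add: triple_Seq)
next
  case (AIf f a b c d)
  show ?case unfolding cost.simps
  proof (rule triple_If)
    assume "eval_binop f (ev \<sigma> a) (ev \<sigma> b) \<noteq> 0"
    with AIf have "triple (cost c) c \<sigma> Q" by simp
    then show "triple (max (cost c) (cost d)) c \<sigma> Q" by (rule triple_weaken) simp_all
  next
    assume "eval_binop f (ev \<sigma> a) (ev \<sigma> b) = 0"
    with AIf have "triple (cost d) d \<sigma> Q" by simp
    then show "triple (max (cost c) (cost d)) d \<sigma> Q" by (rule triple_weaken) simp_all
  qed (use AIf in simp)
next
  case (AWhile f a b c)
  then show ?case by simp
qed

text \<open>The first argument of the invariant counts the completed iterations.\<close>

lemma triple_While:
  assumes init: "I 0 \<sigma>"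
    and bound: "\<And>i \<sigma>. I i \<sigma> \<Longrightarrow> i \<le> B"
    and fits: "\<And>i \<sigma>. I i \<sigma> \<Longrightarrow> fits f (ev \<sigma> a) (ev \<sigma> b)"
    and step: "\<And>i \<sigma>. I i \<sigma> \<Longrightarrow> eval_binop f (ev \<sigma> a) (ev \<sigma> b) \<noteq> 0 \<Longrightarrow> triple T c \<sigma> (I (Suc i))"
    and exit: "\<And>i \<sigma>. I i \<sigma> \<Longrightarrow> eval_binop f (ev \<sigma> a) (ev \<sigma> b) = 0 \<Longrightarrow> Q \<sigma>"
  shows "triple (6 + B * (6 + T)) (AWhile f a b c) \<sigma> Q"
proof -
  let ?loop = "WhileNZ 1 (Seq (compile c) (compute f a b 1))"
  have loop: "\<exists>t s'. exec S W ?loop s t s' \<and> t \<le> 1 + (B - i) * (6 + T) \<and> wf s' \<and> Q (abstract s')"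
    if "I i (abstract s)" "wf s" "regs s 1 = eval_binop f (ev (abstract s) a) (ev (abstract s) b)"
    for i s using that
  proof (induction "B - i" arbitrary: i s rule: less_induct)
    case less
    show ?case
    proof (cases "regs s 1 = 0")
      case True
      with less.prems exit exec.WhileFalse[OF True] show ?thesis by force
    next
      case False
      with step less.prems obtain t1 s1 where 1: "exec S W (compile c) s t1 s1" "t1 \<le> T" "wf s1"
        "I (Suc i) (abstract s1)" unfolding triple_def by (metis (no_types, lifting))
      obtain t2 s2 where 2: "exec S W (compute f a b 1) s1 t2 s2" "t2 \<le> 5" "wf s2"
        "abstract s2 = abstract s1"
        "regs s2 1 = eval_binop f (ev (abstract s1) a) (ev (abstract s1) b)"
        using exec_guard[OF 1(3) fits[OF 1(4)]] by auto
      have Suc: "Suc i \<le> B" using bound[OF 1(4)] .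
      then have dec: "B - Suc i < B - i" by simp
      have "\<exists>t s'. exec S W ?loop s2 t s' \<and> t \<le> 1 + (B - Suc i) * (6 + T) \<and> wf s' \<and> Q (abstract s')"
        using 1 2 by (intro less.hyps[OF dec]) simp_all
      then obtain t3 s3 where 3: "exec S W ?loop s2 t3 s3" "t3 \<le> 1 + (B - Suc i) * (6 + T)"
        "wf s3" "Q (abstract s3)" by auto
      have "B - i = Suc (B - Suc i)" using Suc by simp
      then have "1 + (t1 + t2) + t3 \<le> 1 + (B - i) * (6 + T)"
        using 1(2) 2(2) 3(2) by simp
      with 3 exec.WhileTrue[OF False exec.Seq[OF 1(1) 2(1)] 3(1)] show ?thesis by blast
    qed
  qed
  show ?thesis
  proof (rule tripleI)
    fix s assume wf: "wf s" and \<sigma>: "abstract s = \<sigma>"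
    obtain t0 s0 where 0: "exec S W (compute f a b 1) s t0 s0" "t0 \<le> 5" "wf s0" "abstract s0 = \<sigma>"
      "regs s0 1 = eval_binop f (ev \<sigma> a) (ev \<sigma> b)"
      using exec_guard[OF wf, of f a b] fits[OF init] \<sigma> by auto
    obtain t s' where "exec S W ?loop s0 t s'" "t \<le> 1 + B * (6 + T)" "wf s'" "Q (abstract s')"
      using loop[of 0 s0] 0 init by auto
    with 0 show "\<exists>t s'. exec S W (compile (AWhile f a b c)) s t s' \<and> t \<le> 6 + B * (6 + T) \<and> wf s' \<and>
      Q (abstract s')"
      by (intro exI[of _ "t0 + t"] exI[of _ s']) (auto intro: exec.Seq)
  qed
qed

end

section \<open>Connected edge sets\<close>

text \<open>Connectivity without walks: no nonempty proper part of \<open>S\<close> is closed under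
  sharing a vertex. The empty set counts as connected.\<close>

definition conn :: "('i \<Rightarrow> 'v set) \<Rightarrow> 'i set \<Rightarrow> bool" where
  "conn E S \<longleftrightarrow> (\<forall>A\<subseteq>S. A \<noteq> {} \<longrightarrow> (\<forall>e\<in>S. E e \<inter> \<Union>(E ` A) \<noteq> {} \<longrightarrow> e \<in> A) \<longrightarrow> A = S)"

text \<open>The form in which connectedness is used: \<open>B\<close> is typically what a search has
  reached and may exceed \<open>S\<close>, so the definition is applied to
  \<open>S \<inter> B\<close>.\<close>

lemma conn_subset_closed:
  assumes "conn E S" "S \<inter> B \<noteq> {}" "\<And>e. e \<in> S \<Longrightarrow> E e \<inter> \<Union>(E ` B) \<noteq> {} \<Longrightarrow> e \<in> B"
  shows "S \<subseteq> B"
proof -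
  have "\<forall>e\<in>S. E e \<inter> \<Union>(E ` (S \<inter> B)) \<noteq> {} \<longrightarrow> e \<in> S \<inter> B" using assms(3) by blast
  with assms(1,2) have "S \<inter> B = S" unfolding conn_def by blast
  then show ?thesis by blast
qed

lemma conn_insert:
  assumes "conn E S" "E e \<inter> \<Union>(E ` S) \<noteq> {}"
  shows "conn E (insert e S)"
  unfolding conn_def
proof (intro allI impI)
  fix A assume A: "A \<subseteq> insert e S" "A \<noteq> {}"
    and closed: "\<forall>x\<in>insert e S. E x \<inter> \<Union>(E ` A) \<noteq> {} \<longrightarrow> x \<in> A"
  have "S \<inter> A \<noteq> {}"
  proof
    assume "S \<inter> A = {}"
    with A have "e \<in> A" by blast
    with closed assms(2) have "S \<inter> A \<noteq> {}" by blast
    with \<open>S \<inter> A = {}\<close> show False by simp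
  qed
  then have "S \<subseteq> A" using conn_subset_closed[OF assms(1)] closed by blast
  with assms(2) closed A show "A = insert e S" by blast
qed

text \<open>Greedy growth: while \<open>F\<close> is smaller than \<open>L\<close>, connectedness of
  \<open>L\<close> supplies an edge of \<open>L\<close> outside \<open>F\<close> that touches
  \<open>F\<close>. This is the source of all existence claims for solutions through a given
  set.\<close>

lemma conn_extend:
  assumes "conn E F" "conn E L" "F \<subseteq> L" "F \<noteq> {}" "finite L" "card F \<le> k" "k \<le> card L"
  shows "\<exists>S. F \<subseteq> S \<and> S \<subseteq> L \<and> conn E S \<and> card S = k"
  using assms(1,3,4,6)
proof (induction "k - card F" arbitrary: F)
  case 0
  then show ?case by auto
next
  case (Suc d)
  have finF: "finite F" using Suc.prems(2) assms(5) by (rule finite_subset)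
  have "\<not> L \<subseteq> F" using Suc.hyps(2) assms(7) card_mono[OF finF, of L] by auto
  then obtain e where e: "e \<in> L" "e \<notin> F" "E e \<inter> \<Union>(E ` F) \<noteq> {}"
    using conn_subset_closed[OF assms(2), of F] Suc.prems by blast
  have "\<exists>S. insert e F \<subseteq> S \<and> S \<subseteq> L \<and> conn E S \<and> card S = k"
    using Suc e finF by (intro Suc.hyps(1) conn_insert) auto
  then show ?case by auto
qed

text \<open>Edges are unordered pairs, so a walk that cannot leave \<open>U\<close> cannot enter it
  either.\<close>

lemma walk_closed:
  assumes "walk G u xs v"
    and closed: "\<And>x y. {x, y} \<in> edges G \<Longrightarrow> x \<in> U \<Longrightarrow> y \<in> U"
  shows "u \<in> U \<longleftrightarrow> v \<in> U"
  using assms(1)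
proof (induction xs arbitrary: u)
  case (Cons x xs)
  show ?case
  proof (cases xs)
    case (Cons y ys)
    then have "walk G y xs v" "{u, y} \<in> edges G"
      using Cons.prems by (auto simp: walk_def)
    then show ?thesis using Cons.IH closed by (metis insert_commute)
  qed (use Cons.prems in \<open>auto simp: walk_def\<close>)
qed (simp add: walk_def)

lemma walk_snoc:
  "walk G u xs x \<Longrightarrow> {x, y} \<in> edges G \<Longrightarrow> y \<in> verts G \<Longrightarrow> walk G u (xs @ [y]) y"
  by (auto simp: walk_def successively_append_iff)

text \<open>In one direction, walks stay within the vertices of a closed part. In the other, the
  edges with both ends reachable from \<open>u\<close> form a closed part, since a walk to one end
  of an edge continues to its other end.\<close>

lemma connected_graph_iff_conn:
  assumes "\<And>e. e \<in> S \<Longrightarrow> card (E e) = 2"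
  shows "connected_graph (edge_subgraph (E ` S)) \<longleftrightarrow> conn E S"
proof
  let ?G = "edge_subgraph (E ` S)"
  assume con: "connected_graph ?G"
  show "conn E S" unfolding conn_def
  proof (intro allI impI)
    fix A assume A: "A \<subseteq> S" "A \<noteq> {}" "\<forall>e\<in>S. E e \<inter> \<Union>(E ` A) \<noteq> {} \<longrightarrow> e \<in> A"
    have "e \<in> A" if e: "e \<in> S" for e
    proof -
      obtain a where a: "a \<in> A" using A(2) by auto
      then obtain u v where uv: "u \<in> E a" "v \<in> E e"
        using assms e A(1) by (metis card.empty ex_in_conv subsetD zero_neq_numeral)
      then obtain xs where "walk ?G u xs v"
        using con a e A(1) unfolding connected_graph_def edge_subgraph_def fst_conv by blast
      moreover have "y \<in> \<Union>(E ` A)" if xy: "{x, y} \<in> edges ?G" "x \<in> \<Union>(E ` A)" for x y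
      proof -
        obtain f where f: "f \<in> S" "E f = {x, y}" using xy(1) by (auto simp: edge_subgraph_def)
        with xy(2) A(3) have "f \<in> A" by blast
        with f show ?thesis by blast
      qed
      ultimately have "u \<in> \<Union>(E ` A) \<longleftrightarrow> v \<in> \<Union>(E ` A)" by (rule walk_closed)
      with uv a e A(3) show ?thesis by blast
    qed
    with A(1) show "A = S" by blast
  qed
next
  let ?G = "edge_subgraph (E ` S)"
  assume con: "conn E S"
  show "connected_graph ?G" unfolding connected_graph_def
  proof (intro ballI)
    fix u v assume u: "u \<in> verts ?G" and v: "v \<in> verts ?G"
    let ?A = "{e \<in> S. \<forall>w\<in>E e. \<exists>xs. walk ?G u xs w}"
    have step: "e \<in> ?A" if "e \<in> S" "x \<in> E e" "walk ?G u xs x" for e x xs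
    proof -
      from that assms obtain y where y: "E e = {x, y}"
        by (metis card_2_iff insertE insert_commute singletonD)
      then have "walk ?G u (xs @ [y]) y"
        using that by (intro walk_snoc[of _ _ _ x]) (auto simp: edge_subgraph_def)
      with y that show ?thesis by auto
    qed
    have "walk ?G u [u] u" using u by (simp add: walk_def)
    moreover obtain a where "a \<in> S" "u \<in> E a" using u by (auto simp: edge_subgraph_def)
    ultimately have "a \<in> ?A" using step by blast
    then have "S \<subseteq> ?A" using \<open>a \<in> S\<close> step by (intro conn_subset_closed[OF con]) blast+
    with v show "\<exists>xs. walk ?G u xs v" by (auto simp: edge_subgraph_def)
  qed
qed

text \<open>The solutions of the subproblem with chosen edges \<open>F\<close> and excluded edges
  \<open>X\<close>, as sets of edge numbers; \<open>sols E m k I {}\<close> represents the graphlets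
  to be enumerated.\<close>

definition sols :: "(nat \<Rightarrow> 'v set) \<Rightarrow> nat \<Rightarrow> nat \<Rightarrow> nat set \<Rightarrow> nat set \<Rightarrow> nat set set" where
  "sols E m k F X = {S. S \<subseteq> {..<m} \<and> card S = k \<and> F \<subseteq> S \<and> S \<inter> X = {} \<and> conn E S}"

lemma finite_sols [simp]: "finite (sols E m k F X)"
  by (rule finite_subset[of _ "Pow {..<m}"]) (auto simp: sols_def)

lemma sols_split: "sols E m k F X = sols E m k F (insert e X) \<union> sols E m k (insert e F) X"
  if "e \<notin> X"
  using that by (auto simp: sols_def)

lemma card_sols_split:
  assumes "e \<notin> X"
  shows "card (sols E m k F X) = card (sols E m k F (insert e X)) + card (sols E m k (insert e F) X)"
  by (subst sols_split[OF assms], rule card_Un_disjoint) (auto simp: sols_def)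

text \<open>A solution is connected and meets the closed set \<open>B\<close> in \<open>F\<close>,
  so it is trapped in \<open>B\<close>, which is too small for it.\<close>

lemma sols_exclude_empty:
  assumes F: "F \<noteq> {}" "F \<subseteq> B" and B: "finite B" "card B < k"
    and closed: "\<And>e. e < m \<Longrightarrow> e \<notin> X \<Longrightarrow> E e \<inter> \<Union>(E ` B) \<noteq> {} \<Longrightarrow> e \<in> B"
  shows "sols E m k F X = {}"
proof (rule ccontr)
  assume "sols E m k F X \<noteq> {}"
  then obtain S where S: "S \<subseteq> {..<m}" "card S = k" "F \<subseteq> S" "S \<inter> X = {}" "conn E S"
    by (auto simp: sols_def)
  have "S \<subseteq> B" by (rule conn_subset_closed[OF S(5)]) (use S F closed in blast)+
  then have "card S \<le> card B" using B by (intro card_mono)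
  with S B show False by simp
qed

text \<open>The same trap as before, now with room for exactly one solution.\<close>

lemma sols_unique:
  assumes F: "F \<noteq> {}" "F \<subseteq> B" and B: "B \<subseteq> {..<m}" "card B = k" "B \<inter> X = {}" "conn E B"
    and closed: "\<And>e. e < m \<Longrightarrow> e \<notin> X \<Longrightarrow> E e \<inter> \<Union>(E ` B) \<noteq> {} \<Longrightarrow> e \<in> B"
  shows "sols E m k F X = {B}"
proof -
  have fin: "finite B" using B(1) finite_subset by blast
  have "S = B" if "S \<in> sols E m k F X" for S
  proof -
    from that have S: "S \<subseteq> {..<m}" "card S = k" "F \<subseteq> S" "S \<inter> X = {}" "conn E S"
      by (auto simp: sols_def)
    have "S \<subseteq> B" by (rule conn_subset_closed[OF S(5)]) (use S F closed in blast)+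
    with S B fin show ?thesis by (metis card_subset_eq)
  qed
  moreover have "B \<in> sols E m k F X" using assms by (auto simp: sols_def)
  ultimately show ?thesis by blast
qed

text \<open>An edge subgraph carries its edge set as second component and the numbering is
  injective, so graphlets and sets of edge numbers correspond one to one.\<close>

lemma graphlets_containing_eq:
  assumes inj: "inj_on E {..<m}" and img: "E ` {..<m} = edges G" and I: "I \<subseteq> {..<m}"
    and two: "\<And>e. e < m \<Longrightarrow> card (E e) = 2"
  shows "graphlets_containing G (E ` I) k = (\<lambda>S. edge_subgraph (E ` S)) ` sols E m k I {}"
    and "inj_on (\<lambda>S. edge_subgraph (E ` S)) (sols E m k I {})"
proof -
  have *: "connected_graph (edge_subgraph (E ` S)) \<longleftrightarrow> conn E S" "card (E ` S) = card S"
    "E ` I \<subseteq> E ` S \<longleftrightarrow> I \<subseteq> S" if "S \<subseteq> {..<m}" for S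
  proof -
    show "connected_graph (edge_subgraph (E ` S)) \<longleftrightarrow> conn E S"
      by (rule connected_graph_iff_conn) (use that two in auto)
    show "card (E ` S) = card S" by (rule card_image) (use that inj inj_on_subset in blast)
    show "E ` I \<subseteq> E ` S \<longleftrightarrow> I \<subseteq> S" using inj_on_image_mem_iff[OF inj _ that] I by blast
  qed
  show "graphlets_containing G (E ` I) k = (\<lambda>S. edge_subgraph (E ` S)) ` sols E m k I {}"
  proof (intro equalityI subsetI)
    fix H assume "H \<in> graphlets_containing G (E ` I) k"
    then obtain F where F: "F \<subseteq> E ` {..<m}" "card F = k" "H = edge_subgraph F"
      "connected_graph H" "E ` I \<subseteq> edges H"
      by (auto simp: graphlets_containing_def edge_graphlet_def img)
    then obtain S where S: "S \<subseteq> {..<m}" "F = E ` S" by (meson subset_imageE)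
    with F(2-4) *[OF S(1)] F(5) have "S \<in> sols E m k I {}"
      by (simp add: sols_def) (simp add: edge_subgraph_def)
    with F S show "H \<in> (\<lambda>S. edge_subgraph (E ` S)) ` sols E m k I {}" by blast
  next
    fix H assume "H \<in> (\<lambda>S. edge_subgraph (E ` S)) ` sols E m k I {}"
    then obtain S where S: "S \<subseteq> {..<m}" "card S = k" "I \<subseteq> S" "conn E S" "H = edge_subgraph (E ` S)"
      by (auto simp: sols_def)
    moreover have "E ` S \<subseteq> edges G" using S(1) img by blast
    ultimately show "H \<in> graphlets_containing G (E ` I) k"
      unfolding graphlets_containing_def edge_graphlet_def
      using *[OF S(1)] by (auto intro!: exI[of _ "E ` S"] simp: edge_subgraph_def)
  qed
  show "inj_on (\<lambda>S. edge_subgraph (E ` S)) (sols E m k I {})"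
  proof (rule inj_onI)
    fix S T assume "S \<in> sols E m k I {}" "T \<in> sols E m k I {}"
      "edge_subgraph (E ` S) = edge_subgraph (E ` T)"
    then have "S \<subseteq> {..<m}" "T \<subseteq> {..<m}" "E ` S = E ` T"
      by (auto simp: sols_def edge_subgraph_def)
    then show "S = T" using inj_on_image_eq_iff[OF inj] by blast
  qed
qed

section \<open>Trimmed instances are connected\<close>

lemma trimmed_walk:
  assumes "trimmed G In k" "e \<in> edges G"
  shows "\<exists>w\<in>e. \<exists>x\<in>\<Union>In. \<exists>xs. walk G w xs x"
proof (rule ccontr)
  assume *: "\<not> ?thesis"
  \<comment> \<open>The infimum over an empty set of walks is \<infinity>, which reaches every
    threshold.\<close>
  then have "edge_dist G (\<Union>In) e = \<infinity>"
    by (auto simp: edge_dist_def graph_dist_def top_enat_def[symmetric] intro!: INF_eq_const)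
  with assms show False by (auto simp: trimmed_def unnecessary_def edge_subgraph_def)
qed

text \<open>A walk from an edge to \<open>I\<close> neither leaves nor enters the vertices of a
  closed part \<open>A\<close>. Starting in \<open>A\<close> it shows that \<open>A\<close> meets
  \<open>I\<close>, hence contains \<open>I\<close> by connectedness; after that, the walk of any
  other edge ends inside \<open>A\<close>, so that edge belongs to \<open>A\<close> too.\<close>

lemma trimmed_imp_conn:
  assumes trim: "trimmed G (E ` I) k" and con: "conn E I" and I: "I \<subseteq> {..<m}"
    and img: "E ` {..<m} = edges G"
  shows "conn E {..<m}"
  unfolding conn_def
proof (intro allI impI)
  fix A assume A: "A \<subseteq> {..<m}" "A \<noteq> {}" "\<forall>e\<in>{..<m}. E e \<inter> \<Union>(E ` A) \<noteq> {} \<longrightarrow> e \<in> A"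
  let ?U = "\<Union>(E ` A)"
  have closed: "y \<in> ?U" if xy: "{x, y} \<in> edges G" "x \<in> ?U" for x y
  proof -
    obtain f where f: "f < m" "E f = {x, y}" using xy(1) unfolding img[symmetric] by force
    with xy(2) A(3) have "f \<in> A" by blast
    with f show ?thesis by blast
  qed
  have walk: "\<exists>w\<in>E e. \<exists>i\<in>I. \<exists>x\<in>E i. w \<in> ?U \<longleftrightarrow> x \<in> ?U" if e: "e < m" for e
  proof -
    have "E e \<in> edges G" using e img by blast
    from trimmed_walk[OF trim this] obtain w x xs where
      w: "w \<in> E e" "x \<in> \<Union>(E ` I)" "walk G w xs x" by blast
    have "w \<in> ?U \<longleftrightarrow> x \<in> ?U" using w(3) closed by (rule walk_closed)
    with w(1,2) show ?thesis by blast
  qed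
  obtain a where a: "a \<in> A" using A(2) by blast
  then obtain w i x where wix: "w \<in> E a" "i \<in> I" "x \<in> E i" "w \<in> ?U \<longleftrightarrow> x \<in> ?U"
    using walk[of a] A(1) by blast
  with a have "x \<in> ?U" by blast
  with wix A(3) I have "i \<in> A" by blast
  with wix(2) A(3) I have "I \<subseteq> A"
    by (intro conn_subset_closed[OF con]) blast+
  have "e \<in> A" if e: "e < m" for e
    using walk[OF e] \<open>I \<subseteq> A\<close> A(3) e by blast
  with A(1) show "A = {..<m}" by auto
qed

section \<open>Doubly linked lists\<close>

text \<open>Recursive form of \<open>linked_list\<close> with the expected predecessor pointer
  \<open>pv\<close> as a parameter, so that it also describes a suffix, such as the arcs still to be
  scanned.\<close>

fun ll :: "(nat \<Rightarrow> nat) \<Rightarrow> (nat \<Rightarrow> nat) \<Rightarrow> nat \<Rightarrow> nat \<Rightarrow> nat list \<Rightarrow> bool" where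
  "ll sc pr pv pt [] \<longleftrightarrow> pt = 0"
| "ll sc pr pv pt (a # as) \<longleftrightarrow> pt = Suc a \<and> pr a = pv \<and> ll sc pr (Suc a) (sc a) as"

lemma ll_cong:
  "(\<And>a. a \<in> set as \<Longrightarrow> sc a = sc' a \<and> pr a = pr' a) \<Longrightarrow> ll sc pr pv pt as = ll sc' pr' pv pt as"
  by (induction as arbitrary: pv pt) auto

text \<open>The indexed specification is consumed from the end: the claim for the suffix at
  \<open>i\<close> follows from the one at \<open>i + 1\<close>.\<close>

lemma linked_list_imp_ll:
  assumes "linked_list pt sc pr as"
  shows "ll sc pr 0 pt as"
proof -
  have "ll sc pr (if i = 0 then 0 else as ! (i - 1) + 1)
    (if i < length as then as ! i + 1 else 0) (drop i as)" if "i \<le> length as" for i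
    using that
  proof (induction "length as - i" arbitrary: i)
    case (Suc d)
    then have i: "i < length as" by simp
    have "drop i as = as ! i # drop (Suc i) as" using i by (simp add: Cons_nth_drop_Suc)
    with Suc.hyps(1)[of "Suc i"] Suc.hyps(2) i assms show ?case
      by (auto simp: linked_list_def)
  qed simp
  from this[of 0] assms show ?thesis by (auto simp: linked_list_def split: if_splits)
qed

lemma ll_neighbours:
  assumes "ll sc pr pv pt (xs @ a # ys)"
  shows "pr a = (if xs = [] then pv else Suc (last xs))"
    and "sc a = (if ys = [] then 0 else Suc (hd ys))"
  using assms by (induction xs arbitrary: pv pt) (auto, cases ys, auto)

text \<open>Distinctness keeps the two redirected links apart from all other links of the
  list.\<close>

lemma ll_delete:
  assumes "ll sc pr pv pt (xs @ a # ys)" "distinct (xs @ a # ys)"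
  shows "ll (if xs = [] then sc else sc(last xs := sc a))
    (if ys = [] then pr else pr(hd ys := pr a)) pv (if xs = [] then sc a else pt) (xs @ ys)"
  using assms
proof (induction xs arbitrary: pv pt)
  case Nil
  show ?case
  proof (cases ys)
    case (Cons y zs)
    then have "ll sc (pr(y := pr a)) (Suc y) (sc y) zs = ll sc pr (Suc y) (sc y) zs"
      using Nil.prems by (intro ll_cong) auto
    with Nil Cons show ?thesis by (auto simp: fun_upd_def)
  qed (use Nil in auto)
next
  case (Cons x xs)
  let ?pr = "if ys = [] then pr else pr(hd ys := pr a)"
  have x: "x \<notin> set xs" "x \<notin> set ys" "ys \<noteq> [] \<Longrightarrow> hd ys \<noteq> x" using Cons.prems by auto
  have IH: "ll (if xs = [] then sc else sc(last xs := sc a)) ?pr (Suc x)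
     (if xs = [] then sc a else sc x) (xs @ ys)"
    using Cons by auto
  show ?case
  proof (cases "xs = []")
    case True
    have "ll (sc(x := sc a)) ?pr (Suc x) (sc a) ys = ll sc ?pr (Suc x) (sc a) ys"
      using x by (intro ll_cong) auto
    with True IH Cons.prems x show ?thesis by (auto simp: fun_upd_def)
  next
    case False
    then have "last xs \<noteq> x" using x(1) last_in_set by blast
    with False IH Cons.prems x show ?thesis by (auto simp: fun_upd_def)
  qed
qed

lemma ll_insert:
  assumes "ll sc pr 0 pt as" "a \<notin> set as" "distinct as"
  shows "ll (sc(a := pt)) (if pt = 0 then pr(a := 0) else (pr(a := 0))(pt - 1 := Suc a)) 0 (Suc a) (a # as)"
proof (cases as)
  case (Cons b bs)
  have "ll (sc(a := Suc b)) ((pr(a := 0))(b := Suc a)) (Suc b) (sc b) bs = ll sc pr (Suc b) (sc b) bs"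
    using assms Cons by (intro ll_cong) auto
  with assms Cons show ?thesis by auto
qed (use assms in auto)

text \<open>The order within a list is left open. Hence undoing a deletion may put the arc at the
  head of its list instead of restoring its former place.\<close>

definition adj :: "(nat \<Rightarrow> nat) \<Rightarrow> nat \<Rightarrow> nat set \<Rightarrow> (nat \<Rightarrow> nat) \<Rightarrow> (nat \<Rightarrow> nat) \<Rightarrow> (nat \<Rightarrow> nat) \<Rightarrow> bool"
  where "adj tail n A fi sc pr \<longleftrightarrow>
    (\<forall>v<n. \<exists>as. distinct as \<and> set as = {a \<in> A. tail a = v} \<and> ll sc pr 0 (fi v) as)"

text \<open>Lists of different vertices share no arcs, so redirecting the links around
  \<open>a\<close> leaves them intact. The additional conclusions show that the cells written to
  belong to arcs and are valid addresses.\<close>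

lemma adj_delete:
  assumes adj: "adj tail n A fi sc pr" and a: "a \<in> A" "tail a < n"
  shows "adj tail n (A - {a}) (if pr a = 0 then fi(tail a := sc a) else fi)
     (if pr a = 0 then sc else sc(pr a - 1 := sc a)) (if sc a = 0 then pr else pr(sc a - 1 := pr a))"
    (is "adj tail n _ ?fi ?sc ?pr")
    and "pr a \<noteq> 0 \<Longrightarrow> pr a - 1 \<in> A" and "sc a \<noteq> 0 \<Longrightarrow> sc a - 1 \<in> A"
proof -
  from adj a obtain as where as: "distinct as" "set as = {b \<in> A. tail b = tail a}" "ll sc pr 0 (fi (tail a)) as"
    unfolding adj_def by blast
  then obtain xs ys where split: "as = xs @ a # ys" using a by (metis (mono_tags, lifting) mem_Collect_eq split_list)
  note nb = ll_neighbours[OF as(3)[unfolded split]]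
  have mem: "x \<in> A \<and> tail x = tail a" if "x \<in> set xs \<union> set ys" for x using as(2) that split by auto
  show pA: "pr a \<noteq> 0 \<Longrightarrow> pr a - 1 \<in> A" using nb(1) mem[of "last xs"] by (auto split: if_splits)
  show sA: "sc a \<noteq> 0 \<Longrightarrow> sc a - 1 \<in> A" using nb(2) mem[of "hd ys"] by (auto split: if_splits)
  have pt: "pr a \<noteq> 0 \<Longrightarrow> tail (pr a - 1) = tail a" "sc a \<noteq> 0 \<Longrightarrow> tail (sc a - 1) = tail a"
    using nb mem[of "last xs"] mem[of "hd ys"] by (auto split: if_splits)
  have main: "ll ?sc ?pr 0 (?fi (tail a)) (xs @ ys)"
    using ll_delete[OF as(3)[unfolded split]] as(1) nb split by (auto split: if_splits)
  show "adj tail n (A - {a}) ?fi ?sc ?pr" unfolding adj_def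
  proof (intro allI impI)
    fix v assume v: "v < n"
    show "\<exists>as. distinct as \<and> set as = {b \<in> A - {a}. tail b = v} \<and> ll ?sc ?pr 0 (?fi v) as"
    proof (cases "v = tail a")
      case True
      with as split main show ?thesis by (intro exI[of _ "xs @ ys"]) auto
    next
      case False
      from adj v obtain bs where bs: "distinct bs" "set bs = {b \<in> A. tail b = v}" "ll sc pr 0 (fi v) bs"
        unfolding adj_def by blast
      have "ll ?sc ?pr 0 (fi v) bs = ll sc pr 0 (fi v) bs"
        using bs(2) pt False by (intro ll_cong) auto
      with bs False show ?thesis by (intro exI[of _ bs]) auto
    qed
  qed
qed

lemma adj_insert:
  assumes adj: "adj tail n A fi sc pr" and a: "a \<notin> A" "tail a < n"
  shows "adj tail n (insert a A) (fi(tail a := Suc a)) (sc(a := fi (tail a)))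
      (if fi (tail a) = 0 then pr(a := 0) else (pr(a := 0))(fi (tail a) - 1 := Suc a))"
    (is "adj tail n _ ?fi ?sc ?pr")
    and "fi (tail a) \<noteq> 0 \<Longrightarrow> fi (tail a) - 1 \<in> A"
proof -
  from adj a obtain as where as: "distinct as" "set as = {b \<in> A. tail b = tail a}" "ll sc pr 0 (fi (tail a)) as"
    unfolding adj_def by blast
  have fA: "fi (tail a) - 1 \<in> A \<and> tail (fi (tail a) - 1) = tail a" if "fi (tail a) \<noteq> 0"
    using as that by (cases as) auto
  then show "fi (tail a) \<noteq> 0 \<Longrightarrow> fi (tail a) - 1 \<in> A" by simp
  show "adj tail n (insert a A) ?fi ?sc ?pr" unfolding adj_def
  proof (intro allI impI)
    fix v assume v: "v < n"
    show "\<exists>as. distinct as \<and> set as = {b \<in> insert a A. tail b = v} \<and> ll ?sc ?pr 0 (?fi v) as"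
    proof (cases "v = tail a")
      case True
      with as a ll_insert[OF as(3) _ as(1), of a] show ?thesis by (intro exI[of _ "a # as"]) auto
    next
      case False
      from adj v obtain bs where bs: "distinct bs" "set bs = {b \<in> A. tail b = v}" "ll sc pr 0 (fi v) bs"
        unfolding adj_def by blast
      have "b \<noteq> a" "fi (tail a) \<noteq> 0 \<Longrightarrow> b \<noteq> fi (tail a) - 1" if "b \<in> set bs" for b
      proof -
        have b: "b \<in> A" "tail b = v" using bs(2) that by auto
        with a(1) show "b \<noteq> a" by auto
        assume "fi (tail a) \<noteq> 0"
        then have "tail (fi (tail a) - 1) = tail a" using fA by simp
        with b(2) False show "b \<noteq> fi (tail a) - 1" by (metis (no_types))
      qed
      then have "ll ?sc ?pr 0 (fi v) bs = ll sc pr 0 (fi v) bs"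
        by (intro ll_cong) (simp split: if_split)
      with bs False show ?thesis by (intro exI[of _ bs]) auto
    qed
  qed
qed

section \<open>The search\<close>

text \<open>The situation after the guards of the program. \<open>k_le_m\<close> keeps lists of
  \<open>k\<close> edges within arrays of length \<open>m\<close>.\<close>

locale instance_data =
  fixes n m k :: nat and es :: "(nat \<times> nat) list" and I :: "nat set"
  assumes length_es: "length es = m"
    and ends_less: "i < m \<Longrightarrow> fst (es ! i) < n \<and> snd (es ! i) < n"
    and ends_neq: "i < m \<Longrightarrow> fst (es ! i) \<noteq> snd (es ! i)"
    and I_subset: "I \<subseteq> {..<m}" and I_nonempty: "I \<noteq> {}"
    and conn_I: "conn (numbered_edge es) I"
    and k_le_m: "k \<le> m"
begin

abbreviation E :: "nat \<Rightarrow> nat set" where "E \<equiv> numbered_edge es"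
abbreviation V :: "nat set \<Rightarrow> nat set" where "V F \<equiv> \<Union>(E ` F)"
abbreviation sol :: "nat set \<Rightarrow> nat set \<Rightarrow> nat set set" where "sol \<equiv> sols E m k"
abbreviation tail :: "nat \<Rightarrow> nat" where "tail \<equiv> arc_tail es"
abbreviation head :: "nat \<Rightarrow> nat" where "head \<equiv> arc_head es"

definition arc_edge :: "nat \<Rightarrow> nat" where
  "arc_edge a = (if a < m then a else a - m)"

text \<open>\<open>arcs X UNIV\<close> is the content of the adjacency lists after the deletion of
  \<open>X\<close>; with the dequeued vertices for \<open>U\<close> it gives the arcs that a scan is
  responsible for so far.\<close>

definition arcs :: "nat set \<Rightarrow> nat set \<Rightarrow> nat set" where
  "arcs X U = {a. a < 2 * m \<and> arc_edge a \<notin> X \<and> tail a \<in> U}"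

lemma card_E: "e < m \<Longrightarrow> card (E e) = 2"
  using ends_neq by (simp add: numbered_edge_def)

lemma E_subset: "e < m \<Longrightarrow> E e \<subseteq> {..<n}"
  using ends_less by (auto simp: numbered_edge_def)

lemma arc_edge_less: "a < 2 * m \<Longrightarrow> arc_edge a < m"
  by (auto simp: arc_edge_def)

lemma E_arc_edge: "a < 2 * m \<Longrightarrow> E (arc_edge a) = {tail a, head a}"
  by (auto simp: arc_edge_def numbered_edge_def arc_tail_def arc_head_def length_es)

lemma arc_ends_less: "a < 2 * m \<Longrightarrow> tail a < n" "a < 2 * m \<Longrightarrow> head a < n"
  using E_arc_edge[of a] E_subset[OF arc_edge_less, of a] by auto

lemma twin:
  assumes "e < m"
  shows "tail e = head (e + m)" "tail (e + m) = head e" "arc_edge e = e" "arc_edge (e + m) = e"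
    "E e = {head e, head (e + m)}"
  using assms by (auto simp: arc_tail_def arc_head_def length_es arc_edge_def numbered_edge_def)

lemma finite_arcs [simp]: "finite (arcs X U)"
  by (rule finite_subset[of _ "{..<2 * m}"]) (auto simp: arcs_def)

lemma arcs_cover:
  assumes "e < m" "e \<notin> X" "E e \<inter> U \<noteq> {}"
  shows "\<exists>a\<in>arcs X U. arc_edge a = e"
proof -
  have "e \<in> arcs X U \<or> e + m \<in> arcs X U"
    using assms twin[OF assms(1)] by (auto simp: arcs_def)
  with twin[OF assms(1)] show ?thesis by auto
qed

text \<open>Each listed edge \<open>e\<close> pays for its two arcs, \<open>e\<close> and
  \<open>e + m\<close>.\<close>

lemma card_arcs_le:
  assumes "A \<subseteq> {..<2 * m}" "arc_edge ` A \<subseteq> set ls"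
  shows "card A \<le> 2 * length ls"
proof -
  have "A \<subseteq> set ls \<union> (\<lambda>e. e + m) ` set ls"
  proof
    fix a assume a: "a \<in> A"
    then have "arc_edge a \<in> set ls" using assms by blast
    then show "a \<in> set ls \<union> (\<lambda>e. e + m) ` set ls"
      by (cases "a < m") (auto simp: arc_edge_def intro!: image_eqI[of _ _ "a - m"])
  qed
  then have "card A \<le> card (set ls \<union> (\<lambda>e. e + m) ` set ls)" by (intro card_mono) auto
  also have "\<dots> \<le> card (set ls) + card (set ls)"
    by (rule order.trans[OF card_Un_le]) (simp add: card_image_le)
  also have "\<dots> \<le> 2 * length ls" using card_length[of ls] by simp
  finally show ?thesis .
qed

lemma card_V_le: "finite F \<Longrightarrow> F \<subseteq> {..<m} \<Longrightarrow> card (V F) \<le> 2 * card F"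
proof -
  assume F: "finite F" "F \<subseteq> {..<m}"
  have "card (V F) \<le> (\<Sum>e\<in>F. card (E e))" using F(1) by (rule card_UN_le)
  also have "\<dots> = (\<Sum>e\<in>F. 2)" using F card_E by (intro sum.cong) auto
  finally show ?thesis by simp
qed

text \<open>\<open>X\<close> is the set of excluded edges, \<open>fs\<^sub>0\<close> the list of chosen edges at the start and \<open>fs\<close> its
  current extension by forced edges, \<open>ls\<close> lists the edges seen and \<open>qs\<close> the vertices visited, of
  which the first \<open>qi\<close> have been or are being scanned; \<open>rest\<close> are the arcs still to be scanned at
  the current vertex. The held edge \<open>h\<close> is the only edge seen but not followed.\<close>

definition search ::
    "nat set \<Rightarrow> nat list \<Rightarrow> nat list \<Rightarrow> nat list \<Rightarrow> nat list \<Rightarrow> nat option \<Rightarrow> nat \<Rightarrow> nat list \<Rightarrow> bool"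
  where "search X fs\<^sub>0 fs ls qs h qi rest \<longleftrightarrow>
    distinct ls \<and> set ls \<subseteq> {..<m} \<and> set ls \<inter> X = {} \<and> length ls \<le> Suc k \<and> set_option h \<subseteq> set ls \<and>
    distinct qs \<and> set qs = V (set ls - set_option h) \<and> conn E (set ls - set_option h) \<and>
    (\<exists>gs. fs = fs\<^sub>0 @ gs) \<and> distinct fs \<and> set fs \<subseteq> set ls - set_option h \<and> conn E (set fs) \<and>
    (\<forall>e\<in>set_option h. E e \<inter> V (set fs) \<noteq> {}) \<and>
    qi \<le> length qs \<and> distinct rest \<and> set rest \<subseteq> arcs X (set (take qi qs)) \<and>
    arc_edge ` (arcs X (set (take qi qs)) - set rest) \<subseteq> set ls \<and>
    (h = None \<longrightarrow> tail ` set rest \<union> set (drop qi qs) \<subseteq> V (set fs)) \<and>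
    I \<subseteq> set fs\<^sub>0 \<and> sol (set fs) X = sol (set fs\<^sub>0) X"

lemma searchD:
  assumes "search X fs\<^sub>0 fs ls qs h qi rest"
  shows "distinct ls"
    and "set ls \<subseteq> {..<m}"
    and "set ls \<inter> X = {}"
    and "length ls \<le> Suc k"
    and "set_option h \<subseteq> set ls"
    and "distinct qs"
    and "set qs = V (set ls - set_option h)"
    and "conn E (set ls - set_option h)"
    and "\<exists>gs. fs = fs\<^sub>0 @ gs"
    and "distinct fs"
    and "set fs \<subseteq> set ls - set_option h"
    and "conn E (set fs)"
    and "\<forall>e\<in>set_option h. E e \<inter> V (set fs) \<noteq> {}"
    and "qi \<le> length qs"
    and "distinct rest"
    and "set rest \<subseteq> arcs X (set (take qi qs))"
    and "arc_edge ` (arcs X (set (take qi qs)) - set rest) \<subseteq> set ls"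
    and "h = None \<longrightarrow> tail ` set rest \<union> set (drop qi qs) \<subseteq> V (set fs)"
    and "I \<subseteq> set fs\<^sub>0"
    and "sol (set fs) X = sol (set fs\<^sub>0) X"
  using assms by (simp_all only: search_def) (elim conjE, assumption)+

text \<open>Progress of the scan: finished arcs, dequeued vertices and chosen edges. Each round
  raises it by one, except a last round that only finds nothing left to do.\<close>

definition work :: "nat set \<Rightarrow> nat list \<Rightarrow> nat list \<Rightarrow> nat \<Rightarrow> nat list \<Rightarrow> nat" where
  "work X fs qs qi rest = card (arcs X (set (take qi qs)) - set rest) + qi + length fs"

text \<open>The 5 arises because a seen edge accounts for two arcs, at most two visited vertices and
  at most one chosen edge.\<close>

lemma work_le:
  assumes "search X fs\<^sub>0 fs ls qs h qi rest"
  shows "work X fs qs qi rest \<le> 5 * length ls" "length qs \<le> 2 * length ls" "length fs \<le> length ls"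
proof -
  note s = searchD[OF assms]
  have "card (arcs X (set (take qi qs)) - set rest) \<le> 2 * length ls"
    using s(17) by (intro card_arcs_le) (auto simp: arcs_def)
  moreover have "length qs \<le> 2 * card (set ls - set_option h)"
  proof -
    have "length qs = card (V (set ls - set_option h))" using distinct_card[OF s(6)] s(7) by simp
    also have "\<dots> \<le> 2 * card (set ls - set_option h)" using s(2) by (intro card_V_le) auto
    finally show ?thesis .
  qed
  moreover have "card (set ls - set_option h) \<le> card (set ls)" by (rule card_mono) auto
  moreover have "card (set ls) \<le> length ls" by (rule card_length)
  moreover have "length fs = card (set fs)" using distinct_card[OF s(10)] by simp
  moreover have "card (set fs) \<le> card (set ls - set_option h)" using s(11) by (intro card_mono) auto
  ultimately show "work X fs qs qi rest \<le> 5 * length ls" "length qs \<le> 2 * length ls"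
    "length fs \<le> length ls" using s(14) by (auto simp: work_def)
qed

lemma search_init:
  assumes "distinct fs" "set fs \<subseteq> {..<m}" "set fs \<inter> X = {}" "length fs \<le> k" "I \<subseteq> set fs"
    "conn E (set fs)" "distinct qs" "set qs = V (set fs)"
  shows "search X fs fs fs qs None 0 []" "work X fs qs 0 [] = length fs"
  using assms by (auto simp: search_def work_def arcs_def)

text \<open>The arcs of the new vertex all go into \<open>as\<close>, so the set of finished arcs is
  unchanged and only the dequeued vertex counts as progress.\<close>

lemma search_load:
  assumes s: "search X fs\<^sub>0 fs ls qs h qi []" and qi: "qi < length qs"
    and as: "distinct as" "set as = arcs X {qs ! qi}"
  shows "search X fs\<^sub>0 fs ls qs h (Suc qi) as"
    and "work X fs qs (Suc qi) as = Suc (work X fs qs qi [])"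
proof -
  note s' = s[unfolded search_def list.set Diff_empty]
  have take: "set (take (Suc qi) qs) = insert (qs ! qi) (set (take qi qs))"
    using qi by (simp add: take_Suc_conv_app_nth)
  have "qs ! qi \<notin> set (take qi qs)"
    using s' qi by (auto simp: in_set_conv_nth nth_eq_iff_index_eq)
  then have diff: "arcs X (set (take (Suc qi) qs)) - set as = arcs X (set (take qi qs))"
    by (auto simp: take as arcs_def)
  have drop: "drop qi qs = qs ! qi # drop (Suc qi) qs" using qi by (simp add: Cons_nth_drop_Suc)
  have "tail ` set as \<union> set (drop (Suc qi) qs) \<subseteq> set (drop qi qs)"
    by (auto simp: drop as(2) arcs_def)
  moreover have "h = None \<longrightarrow> set (drop qi qs) \<subseteq> V (set fs)" using s' by simp
  ultimately have "h = None \<longrightarrow> tail ` set as \<union> set (drop (Suc qi) qs) \<subseteq> V (set fs)"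
    using subset_trans by metis
  moreover have "set as \<subseteq> arcs X (set (take (Suc qi) qs))" by (auto simp: as(2) take arcs_def)
  ultimately show "search X fs\<^sub>0 fs ls qs h (Suc qi) as"
    using s' qi as(1) unfolding search_def diff
    by simp
  show "work X fs qs (Suc qi) as = Suc (work X fs qs qi [])"
    unfolding work_def diff by simp
qed

lemma work_arc:
  assumes "search X fs\<^sub>0 fs ls qs h qi (a # rest)"
  shows "work X fs qs qi rest = Suc (work X fs qs qi (a # rest))"
proof -
  have "arcs X (set (take qi qs)) - set rest = insert a (arcs X (set (take qi qs)) - set (a # rest))"
    using searchD(15,16)[OF assms] by auto
  then have "card (arcs X (set (take qi qs)) - set rest) =
      Suc (card (arcs X (set (take qi qs)) - set (a # rest)))"
    by (metis Diff_iff card_insert_disjoint finite_Diff finite_arcs list.set_intros(1))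
  then show ?thesis unfolding work_def by simp
qed

lemma search_seen:
  assumes "search X fs\<^sub>0 fs ls qs h qi (a # rest)" "arc_edge a \<in> set ls"
  shows "search X fs\<^sub>0 fs ls qs h qi rest"
proof -
  note s = searchD[OF assms(1)]
  have "arc_edge ` (arcs X (set (take qi qs)) - set rest) \<subseteq> set ls" using s(17) assms(2) by auto
  with s show ?thesis unfolding search_def by simp
qed

lemma search_new_edge:
  assumes "search X fs\<^sub>0 fs ls qs h qi (a # rest)"
  shows "a < 2 * m" "arc_edge a < m" "arc_edge a \<notin> X" "tail a \<in> set qs"
proof -
  have a: "a \<in> arcs X (set (take qi qs))" using searchD(16)[OF assms] by auto
  then show "a < 2 * m" "arc_edge a \<notin> X" by (auto simp: arcs_def)
  then show "arc_edge a < m" by (simp add: arc_edge_less)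
  show "tail a \<in> set qs" using a set_take_subset by (fastforce simp: arcs_def)
qed

text \<open>As long as no edge is held, all arcs to be scanned leave vertices of chosen edges. This
  is why the new edge touches \<open>fs\<close> and can serve for branching.\<close>

lemma search_hold:
  assumes s: "search X fs\<^sub>0 fs ls qs None qi (a # rest)" and new: "arc_edge a \<notin> set ls"
    and le: "length ls \<le> k"
  shows "search X fs\<^sub>0 fs (ls @ [arc_edge a]) qs (Some (arc_edge a)) qi rest"
proof -
  note d = searchD[OF s]
  note a = search_new_edge[OF s]
  have eq: "set (ls @ [arc_edge a]) - set_option (Some (arc_edge a)) = set ls - set_option None"
    using new by auto
  have "tail a \<in> V (set fs)" using d(18) by simp
  then have "E (arc_edge a) \<inter> V (set fs) \<noteq> {}" using E_arc_edge[OF a(1)] by blast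
  moreover have "arc_edge ` (arcs X (set (take qi qs)) - set rest) \<subseteq> set (ls @ [arc_edge a])"
    using d(17) by auto
  moreover have "distinct (ls @ [arc_edge a])" "set (ls @ [arc_edge a]) \<inter> X = {}"
    "set (ls @ [arc_edge a]) \<subseteq> {..<m}" using d(1-3) new a by auto
  moreover have "length (ls @ [arc_edge a]) \<le> Suc k" using le by simp
  ultimately show ?thesis unfolding search_def eq using d(6-12,14-16,19,20) by simp
qed

text \<open>The tail of the arc is visited already, so the explored part stays connected;
  \<open>vs\<close> is empty if the head was visited as well.\<close>

lemma search_follow:
  assumes s: "search X fs\<^sub>0 fs ls qs (Some h) qi (a # rest)" and new: "arc_edge a \<notin> set ls"
    and le: "length ls \<le> k"
    and qs': "distinct (qs @ vs)" "set (qs @ vs) = insert (head a) (set qs)"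
  shows "search X fs\<^sub>0 fs (ls @ [arc_edge a]) (qs @ vs) (Some h) qi rest"
    and "work X fs (qs @ vs) qi rest = work X fs qs qi rest"
proof -
  note d = searchD[OF s]
  note a = search_new_edge[OF s]
  let ?B = "set ls - set_option (Some h)"
  have eq: "set (ls @ [arc_edge a]) - set_option (Some h) = insert (arc_edge a) ?B"
    using d(5) new by auto
  have "V (insert (arc_edge a) ?B) = insert (tail a) (insert (head a) (set qs))"
    using d(7) E_arc_edge[OF a(1)] by simp
  then have "set (qs @ vs) = V (insert (arc_edge a) ?B)"
    using a(4) qs'(2) by (metis insert_absorb insert_commute)
  moreover have "conn E (insert (arc_edge a) ?B)"
    using d(7,8) a(4) E_arc_edge[OF a(1)] by (intro conn_insert) auto
  moreover have "arc_edge ` (arcs X (set (take qi qs)) - set rest) \<subseteq> set (ls @ [arc_edge a])"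
    using d(17) by auto
  moreover have "distinct (ls @ [arc_edge a])" "set (ls @ [arc_edge a]) \<inter> X = {}"
    "set (ls @ [arc_edge a]) \<subseteq> {..<m}" using d(1-3) new a by auto
  moreover have "length (ls @ [arc_edge a]) \<le> Suc k" using le by simp
  moreover have take: "take qi (qs @ vs) = take qi qs" using d(14) by simp
  moreover have "set_option (Some h) \<subseteq> set (ls @ [arc_edge a])" using d(5) by auto
  moreover have "set fs \<subseteq> insert (arc_edge a) ?B" using d(11) by auto
  moreover have "qi \<le> length (qs @ vs)" using d(14) by simp
  moreover have "distinct rest" "set rest \<subseteq> arcs X (set (take qi qs))" using d(15,16) by simp_all
  ultimately show "search X fs\<^sub>0 fs (ls @ [arc_edge a]) (qs @ vs) (Some h) qi rest"
    unfolding search_def eq take using d(9,10,12,13,19,20) qs'(1)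
    by (intro conjI) (assumption | simp)+
  show "work X fs (qs @ vs) qi rest = work X fs qs qi rest" by (simp only: work_def take)
qed

text \<open>With an exhausted queue, every arc that leaves a visited vertex belongs to a seen edge.
  The part explored is then closed in the graph without \<open>X\<close> and the held edge.\<close>

lemma search_closed:
  assumes "search X fs\<^sub>0 fs ls qs h (length qs) []" "e < m" "e \<notin> X \<union> set_option h"
    "E e \<inter> V (set ls - set_option h) \<noteq> {}"
  shows "e \<in> set ls - set_option h"
proof -
  note s = searchD[OF assms(1)]
  obtain a where "a \<in> arcs X (set qs)" "arc_edge a = e"
    using arcs_cover[of e X "set qs"] assms(2-4) s(7) by auto
  with s(17) assms(3) show ?thesis by auto
qed

text \<open>The seen edges without \<open>h\<close> are closed if \<open>h\<close> is removed and
  number fewer than \<open>k\<close>, so no solution avoids \<open>h\<close>. The exploration is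
  kept: \<open>h\<close> turns from held into chosen and its unvisited ends join the queue.\<close>

lemma search_force:
  assumes s: "search X fs\<^sub>0 fs ls qs (Some h) (length qs) []" and le: "length ls \<le> k"
    and qs': "distinct (qs @ vs)" "set (qs @ vs) = set qs \<union> E h" "set vs \<subseteq> E h"
  shows "search X fs\<^sub>0 (fs @ [h]) ls (qs @ vs) None (length qs) []"
    and "work X (fs @ [h]) (qs @ vs) (length qs) [] = Suc (work X fs qs (length qs) [])"
proof -
  note d = searchD[OF s]
  let ?B = "set ls - set_option (Some h)"
  have h: "h \<in> set ls" "h \<notin> X" "h \<notin> set fs" using d(3,5,11) by auto
  \<comment> \<open>\<open>h\<close> itself is one of the at most \<open>k\<close> seen
    edges.\<close>
  have B: "card ?B < k"
    using h(1) le d(1) distinct_card[of ls] card_Diff_singleton[OF h(1)] length_pos_if_in_set[OF h(1)]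
    by (simp del: length_greater_0_conv)
  have ne: "set fs \<noteq> {}" using d(9,19) I_nonempty by auto
  have "sol (set fs) (insert h X) = {}"
    by (rule sols_exclude_empty[OF ne d(11) _ B]) (use search_closed[OF s] in auto)
  then have "sol (set fs) X = sol (insert h (set fs)) X"
    using sols_split[OF h(2), of E m k "set fs"] by simp
  then have sol: "sol (set (fs @ [h])) X = sol (set fs\<^sub>0) X" using d(20) by simp
  have ins: "insert h ?B = set ls" using h(1) by auto
  have touch: "E h \<inter> V (set fs) \<noteq> {}" using d(13) by simp
  have "V (set fs) \<subseteq> V ?B" using d(11) by blast
  then have "conn E (insert h ?B)" using touch d(8) by (intro conn_insert) blast+
  then have conn: "conn E (set ls - set_option None)" by (simp only: ins) simp
  have conn': "conn E (set (fs @ [h]))" using d(12) touch conn_insert[of E "set fs" h] by simp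
  have "V (insert h ?B) = V ?B \<union> E h" by auto
  then have "V (set ls) = V ?B \<union> E h" unfolding ins .
  then have V: "set (qs @ vs) = V (set ls - set_option None)"
    using qs'(2) unfolding d(7) by simp
  have fs: "set (fs @ [h]) \<subseteq> set ls - set_option None" "distinct (fs @ [h])" "\<exists>gs. fs @ [h] = fs\<^sub>0 @ gs"
    using d(9,10,11) h by auto
  have tk: "take (length qs) (qs @ vs) = qs" "take (length qs) qs = qs" by simp_all
  \<comment> \<open>Everything in \<open>qs\<close> has been scanned, so only the vertices of
    \<open>vs\<close> remain, and these are ends of the newly chosen \<open>h\<close>. This restores
    the clause of the invariant for the case without a held edge.\<close>
  have dr: "tail ` set [] \<union> set (drop (length qs) (qs @ vs)) \<subseteq> V (set (fs @ [h]))"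
    using qs'(3) by auto
  show "search X fs\<^sub>0 (fs @ [h]) ls (qs @ vs) None (length qs) []"
    unfolding search_def tk
    using d(1-4,17)[unfolded tk] d(19) fs conn conn' V sol qs'(1) dr
    by (intro conjI) (assumption | simp)+
  show "work X (fs @ [h]) (qs @ vs) (length qs) [] = Suc (work X fs qs (length qs) [])"
    by (simp add: work_def)
qed

text \<open>Nothing is held back and nothing is left to scan, so \<open>set ls\<close> is connected,
  closed outside \<open>X\<close> and contains the chosen edges; its size alone decides.\<close>

lemma search_exhausted:
  assumes s: "search X fs\<^sub>0 fs ls qs None (length qs) []" and le: "length ls \<le> k"
  shows "sol (set fs\<^sub>0) X = (if length ls = k then {set ls} else {})"
proof -
  note d = searchD[OF s]
  have closed: "e \<in> set ls" if "e < m" "e \<notin> X" "E e \<inter> V (set ls) \<noteq> {}" for e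
    using search_closed[OF s, of e] that by simp
  have ne: "set fs \<noteq> {}" using d(9,19) I_nonempty by auto
  have sub: "set fs \<subseteq> set ls" using d(11) by simp
  have conn: "conn E (set ls)" using d(8) by simp
  have card: "card (set ls) = length ls" using d(1) by (simp add: distinct_card)
  show ?thesis
  proof (cases "length ls = k")
    case True
    then have "sol (set fs) X = {set ls}"
      using card closed by (intro sols_unique[OF ne sub d(2) _ d(3) conn]) auto
    with True d(20) show ?thesis by simp
  next
    case False
    then have "sol (set fs) X = {}"
      using card le closed by (intro sols_exclude_empty[OF ne sub]) auto
    with False d(20) show ?thesis by simp
  qed
qed

text \<open>With \<open>k\<close> chosen edges the scan has to stop at once: one more seen edge
  would look like a branching edge although it can no longer be included.\<close>

lemma search_full:
  assumes s: "search X fs\<^sub>0 fs ls qs h qi rest" and le: "length ls \<le> k" and k: "length fs = k"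
  shows "length ls = k" "sol (set fs\<^sub>0) X = {set ls}"
proof -
  note d = searchD[OF s]
  have card: "card (set fs) = k" using d(10) k by (simp add: distinct_card)
  moreover have "card (set ls) \<le> k" using card_length[of ls] le by simp
  moreover have "set fs \<subseteq> set ls" using d(11) by blast
  ultimately have eq: "set fs = set ls" by (intro card_seteq) auto
  with card show "length ls = k" using distinct_card[OF d(1)] by simp
  have "S = set ls" if "S \<in> sol (set fs) X" for S
  proof -
    from that have "set fs \<subseteq> S" "card S = k" "S \<subseteq> {..<m}" by (auto simp: sols_def)
    with eq card show ?thesis by (metis card_subset_eq finite_lessThan finite_subset)
  qed
  moreover have "set ls \<in> sol (set fs) X"
    using eq card d(2,3,12) by (simp add: sols_def)
  ultimately have "sol (set fs) X = {set ls}" by blast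
  then show "sol (set fs\<^sub>0) X = {set ls}" using d(20) by simp
qed

text \<open>The \<open>k\<close> seen edges other than \<open>h\<close> are connected and solve the
  exclusion. Adding \<open>h\<close>, which touches \<open>fs\<close>, gives a connected set of
  \<open>k + 1\<close> edges in which \<open>fs\<close> with \<open>h\<close> can grow to size
  \<open>k\<close>.\<close>

lemma search_branch:
  assumes s: "search X fs\<^sub>0 fs ls qs (Some h) qi rest" and len: "length ls = Suc k"
    and less: "length fs < k"
  shows "sol (set fs) (insert h X) \<noteq> {}" "sol (insert h (set fs)) X \<noteq> {}"
    "h < m" "h \<notin> X" "h \<notin> set fs" "conn E (insert h (set fs))"
proof -
  note d = searchD[OF s]
  show h: "h < m" "h \<notin> X" "h \<notin> set fs" using d(2,3,5,11) by auto
  have card: "card (set ls) = Suc k" using d(1) len by (simp add: distinct_card)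
  have hl: "h \<in> set ls" using d(5) by simp
  let ?B = "set ls - set_option (Some h)"
  have "card ?B = k" using card hl by simp
  moreover have "?B \<subseteq> {..<m}" "?B \<inter> insert h X = {}" using d(2,3) by auto
  ultimately have "?B \<in> sol (set fs) (insert h X)"
    using d(8,11) unfolding sols_def by blast
  then show "sol (set fs) (insert h X) \<noteq> {}" by blast
  have touch: "E h \<inter> V (set fs) \<noteq> {}" using d(13) by simp
  then show conn: "conn E (insert h (set fs))" using d(12) by (intro conn_insert)
  have ins: "insert h ?B = set ls" using hl by auto
  have "V (set fs) \<subseteq> V ?B" using d(11) by blast
  then have "conn E (insert h ?B)" using touch d(8) by (intro conn_insert) blast+
  then have "conn E (set ls)" by (simp only: ins)
  moreover have "card (insert h (set fs)) \<le> k" using less card_length[of fs]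
    by (simp add: card_insert_if)
  moreover have "insert h (set fs) \<subseteq> set ls" using d(11) hl by blast
  ultimately obtain S where "insert h (set fs) \<subseteq> S" "S \<subseteq> set ls" "conn E S" "card S = k"
    using conn_extend[OF conn, of "set ls" k] card by auto
  then have "S \<in> sol (insert h (set fs)) X" using d(2,3) unfolding sols_def by blast
  then show "sol (insert h (set fs)) X \<noteq> {}" by blast
qed

end

section \<open>The program\<close>

definition visit :: acom where
  "visit = ALoad Tmp VMark (Var Vert) ;;
     AIf Eq (Var Tmp) Zero
       (AStore VMark (Var Vert) One ;; AStore Queue (Var QueueLen) (Var Vert) ;;
        AAsg QueueLen Add (Var QueueLen) One)
       ASkip"

text \<open>An arc and its twin point in opposite directions, so their heads are the two ends of the
  edge.\<close>

definition visit_ends :: acom where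
  "visit_ends = ALoad Vert Head (Var Edge) ;; visit ;;
     AAsg Arc Add (Var Edge) (Var EdgeCnt) ;; ALoad Vert Head (Var Arc) ;; visit"

definition start_body :: acom where
  "start_body = ALoad Edge Chosen (Var Idx) ;; AStore EMark (Var Edge) One ;;
     AStore Seen (Var Idx) (Var Edge) ;; AAsg Idx Add (Var Idx) One ;; visit_ends"

definition next_vertex :: acom where
  "next_vertex = ALoad Vert Queue (Var QueuePos) ;; ALoad Ptr First (Var Vert) ;;
     AAsg QueuePos Add (Var QueuePos) One"

definition force_held :: acom where
  "force_held = AAsg Edge Sub (Var Held) One ;; AStore Chosen (Var ChosenCnt) (Var Edge) ;;
     AAsg ChosenCnt Add (Var ChosenCnt) One ;; AAsg Held Add Zero Zero ;;
     AAsg Go Less (Var ChosenCnt) (Var Size) ;; visit_ends"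

text \<open>Subtracting \<open>Zero\<close> copies a variable without raising an overflow condition.
  \<open>Go\<close> drops to 0 exactly when the number of seen edges exceeds
  \<open>k\<close>.\<close>

definition next_arc :: acom where
  "next_arc = AAsg Arc Sub (Var Ptr) One ;; ALoad Ptr Succ (Var Arc) ;;
     AIf Less (Var Arc) (Var EdgeCnt) (AAsg Edge Sub (Var Arc) Zero)
       (AAsg Edge Sub (Var Arc) (Var EdgeCnt)) ;;
     ALoad Tmp EMark (Var Edge) ;;
     AIf Eq (Var Tmp) Zero
       (AStore EMark (Var Edge) One ;; AStore Seen (Var SeenCnt) (Var Edge) ;;
        AAsg SeenCnt Add (Var SeenCnt) One ;; AAsg Tmp Less (Var Size) (Var SeenCnt) ;;
        AAsg Go Eq (Var Tmp) Zero ;;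
        AIf Eq (Var Held) Zero (AAsg Held Add (Var Edge) One)
          (ALoad Vert Head (Var Arc) ;; visit))
       ASkip"

definition scan_body :: acom where
  "scan_body =
     AIf Eq (Var Ptr) Zero
       (AIf Less (Var QueuePos) (Var QueueLen) next_vertex
         (AIf Eq (Var Held) Zero (AAsg Go Add Zero Zero) force_held))
       next_arc"

text \<open>Marks are erased along the lists of seen edges and visited vertices, because clearing
  whole arrays would cost \<open>n + m\<close> per subproblem.\<close>

definition clear_edge :: acom where
  "clear_edge = ALoad Edge Seen (Var Idx) ;; AStore EMark (Var Edge) Zero ;;
     AAsg Idx Add (Var Idx) One"

definition clear_vertex :: acom where
  "clear_vertex = ALoad Vert Queue (Var Idx) ;; AStore VMark (Var Vert) Zero ;;
     AAsg Idx Add (Var Idx) One"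

definition explore :: acom where
  "explore =
     (AAsg Idx Add Zero Zero ;; AAsg QueueLen Add Zero Zero) ;;
     AWhile Less (Var Idx) (Var ChosenCnt) start_body ;;
     (AAsg SeenCnt Sub (Var ChosenCnt) Zero ;; AAsg QueuePos Add Zero Zero ;; AAsg Ptr Add Zero Zero ;;
      AAsg Held Add Zero Zero ;; AAsg Go Less (Var ChosenCnt) (Var Size)) ;;
     AWhile Less Zero (Var Go) scan_body ;;
     AAsg Idx Add Zero Zero ;;
     AWhile Less (Var Idx) (Var SeenCnt) clear_edge ;;
     AAsg Idx Add Zero Zero ;;
     AWhile Less (Var Idx) (Var QueueLen) clear_vertex"

text \<open>A normal form for the states that \<open>wp\<close> computes, so that they match the
  explicitly given ones.\<close>

lemma arrs_vars_update [simp]: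
  "\<sigma>\<lparr>arrs := A, vars := U\<rparr> = \<sigma>\<lparr>vars := U, arrs := A\<rparr>" for \<sigma> :: ast
  by simp

definition same :: "var set \<Rightarrow> arrid set \<Rightarrow> ast \<Rightarrow> ast \<Rightarrow> bool" where
  "same Vs As \<sigma> \<sigma>' \<longleftrightarrow> (\<forall>x. x \<notin> Vs \<longrightarrow> vars \<sigma>' x = vars \<sigma> x) \<and>
     (\<forall>A. A \<notin> As \<longrightarrow> arrs \<sigma>' A = arrs \<sigma> A) \<and> outs \<sigma>' = outs \<sigma>"

lemma same_refl: "same Vs As \<sigma> \<sigma>"
  by (simp add: same_def)

lemma same_vars: "same Vs As \<sigma> \<sigma>' \<Longrightarrow> x \<notin> Vs \<Longrightarrow> vars \<sigma>' x = vars \<sigma> x"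
  and same_arrs: "same Vs As \<sigma> \<sigma>' \<Longrightarrow> A \<notin> As \<Longrightarrow> arrs \<sigma>' A = arrs \<sigma> A"
  by (simp_all add: same_def)

definition holds :: "(nat \<Rightarrow> nat) \<Rightarrow> nat list \<Rightarrow> bool" where
  "holds f xs \<longleftrightarrow> (\<forall>i<length xs. f i = xs ! i)"

lemma holds_snoc: "holds f xs \<Longrightarrow> i = length xs \<Longrightarrow> holds (f(i := x)) (xs @ [x])"
  by (auto simp: holds_def nth_append)

lemma holds_append: "holds f (xs @ ys) \<Longrightarrow> holds f xs"
  by (auto simp: holds_def nth_append)

lemma distinct_length_less:
  assumes "distinct xs" "set xs \<subseteq> {..<b}" "x < b" "x \<notin> set xs"
  shows "length xs < b"
proof -
  have "length xs = card (set xs)" using assms(1) by (simp add: distinct_card)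
  also have "\<dots> < card {..<b}" using assms(2-4) by (intro psubset_card_mono) auto
  finally show ?thesis by simp
qed

section \<open>Correctness of the loops of a search\<close>

locale enumeration = machine n m S W + instance_data n m k es I
  for n m S W k es I
begin

lemma W_big: "4 + 3 * n + 11 * m \<le> W"
  using layout words by simp

definition queued :: "ast \<Rightarrow> nat list \<Rightarrow> bool" where
  "queued \<sigma> qs \<longleftrightarrow> arrs \<sigma> VMark = (\<lambda>v. of_bool (v \<in> set qs)) \<and> vars \<sigma> QueueLen = length qs \<and>
     holds (arrs \<sigma> Queue) qs \<and> distinct qs \<and> set qs \<subseteq> {..<n}"

text \<open>Stated in continuation style, with the effect as a premise about an arbitrary
  \<open>Q\<close>, so that it composes with \<open>wp\<close> of the code that follows.\<close>

lemma wp_visit: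
  assumes q: "queued \<sigma> qs" and u: "vars \<sigma> Vert < n"
    and post: "\<And>\<sigma>' vs. same {Tmp, QueueLen} {VMark, Queue} \<sigma> \<sigma>' \<Longrightarrow> queued \<sigma>' (qs @ vs) \<Longrightarrow>
      set (qs @ vs) = insert (vars \<sigma> Vert) (set qs) \<Longrightarrow> set vs \<subseteq> {vars \<sigma> Vert} \<Longrightarrow> Q \<sigma>'"
  shows "wp visit Q \<sigma>"
proof (cases "vars \<sigma> Vert \<in> set qs")
  case True
  let ?\<sigma> = "\<sigma>\<lparr>vars := (vars \<sigma>)(Tmp := 1)\<rparr>"
  have "queued ?\<sigma> (qs @ [])" using q by (simp add: queued_def)
  moreover have "same {Tmp, QueueLen} {VMark, Queue} \<sigma> ?\<sigma>" by (simp add: same_def)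
  ultimately have "Q ?\<sigma>" using True by (intro post[of _ "[]"]) auto
  with True q u show ?thesis by (simp add: visit_def queued_def)
next
  case False
  have len: "length qs < n" using q u False by (intro distinct_length_less) (auto simp: queued_def)
  let ?\<sigma> = "\<sigma>\<lparr>vars := (vars \<sigma>)(Tmp := 0, QueueLen := Suc (length qs)),
    arrs := (arrs \<sigma>)(VMark := (arrs \<sigma> VMark)(vars \<sigma> Vert := 1),
      Queue := (arrs \<sigma> Queue)(length qs := vars \<sigma> Vert))\<rparr>"
  have "queued ?\<sigma> (qs @ [vars \<sigma> Vert])"
    using q False u by (auto simp: queued_def fun_eq_iff intro: holds_snoc)
  moreover have "same {Tmp, QueueLen} {VMark, Queue} \<sigma> ?\<sigma>" by (simp add: same_def)
  ultimately have "Q ?\<sigma>" by (intro post) auto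
  with False q u len W_big show ?thesis by (simp add: visit_def queued_def)
qed

definition static :: "ast \<Rightarrow> bool" where
  "static \<sigma> \<longleftrightarrow> vars \<sigma> EdgeCnt = m \<and> vars \<sigma> Size = k \<and> (\<forall>a<2 * m. arrs \<sigma> Head a = head a)"

lemma static_same:
  "static \<sigma> \<Longrightarrow> same Vs As \<sigma> \<sigma>' \<Longrightarrow> EdgeCnt \<notin> Vs \<Longrightarrow> Size \<notin> Vs \<Longrightarrow> Head \<notin> As \<Longrightarrow> static \<sigma>'"
  by (simp add: static_def same_def)

lemma wp_visit_ends:
  assumes st: "static \<sigma>" and q: "queued \<sigma> qs" and e: "vars \<sigma> Edge = e" "e < m"
    and post: "\<And>\<sigma>' vs. same {Vert, Arc, Tmp, QueueLen} {VMark, Queue} \<sigma> \<sigma>' \<Longrightarrow> queued \<sigma>' (qs @ vs) \<Longrightarrow>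
      set (qs @ vs) = set qs \<union> E e \<Longrightarrow> set vs \<subseteq> E e \<Longrightarrow> Q \<sigma>'"
  shows "wp visit_ends Q \<sigma>"
proof -
  note ends = twin(5)[OF e(2)]
  have hd: "head e < n" "head (e + m) < n" using E_subset[OF e(2)] ends by auto
  let ?\<sigma>1 = "\<sigma>\<lparr>vars := (vars \<sigma>)(Vert := head e)\<rparr>"
  have "wp visit (wp (AAsg Arc Add (Var Edge) (Var EdgeCnt) ;; ALoad Vert Head (Var Arc) ;; visit) Q) ?\<sigma>1"
  proof (rule wp_visit)
    show "queued ?\<sigma>1 qs" using q by (simp add: queued_def)
    show "vars ?\<sigma>1 Vert < n" using hd by simp
    fix \<sigma>2 us
    assume 2: "same {Tmp, QueueLen} {VMark, Queue} ?\<sigma>1 \<sigma>2" "queued \<sigma>2 (qs @ us)"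
      "set (qs @ us) = insert (vars ?\<sigma>1 Vert) (set qs)" "set us \<subseteq> {vars ?\<sigma>1 Vert}"
    have c2: "vars \<sigma>2 Edge = e" "vars \<sigma>2 EdgeCnt = m" "\<forall>a<2 * m. arrs \<sigma>2 Head a = head a"
      using 2(1) st e by (auto simp: same_def static_def)
    let ?\<sigma>3 = "\<sigma>2\<lparr>vars := (vars \<sigma>2)(Arc := e + m, Vert := head (e + m))\<rparr>"
    have "wp visit Q ?\<sigma>3"
    proof (rule wp_visit)
      show "queued ?\<sigma>3 (qs @ us)" using 2(2) by (simp add: queued_def)
      show "vars ?\<sigma>3 Vert < n" using hd by simp
      fix \<sigma>4 vs
      assume 4: "same {Tmp, QueueLen} {VMark, Queue} ?\<sigma>3 \<sigma>4" "queued \<sigma>4 ((qs @ us) @ vs)"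
        "set ((qs @ us) @ vs) = insert (vars ?\<sigma>3 Vert) (set (qs @ us))" "set vs \<subseteq> {vars ?\<sigma>3 Vert}"
      show "Q \<sigma>4"
      proof (rule post)
        show "same {Vert, Arc, Tmp, QueueLen} {VMark, Queue} \<sigma> \<sigma>4"
          using 2(1) 4(1) by (simp add: same_def)
        show "queued \<sigma>4 (qs @ us @ vs)" using 4(2) by simp
        show "set (qs @ us @ vs) = set qs \<union> E e" using 2(3) 4(3) ends by auto
        show "set (us @ vs) \<subseteq> E e" using 2(4) 4(4) ends by auto
      qed
    qed
    then show "wp (AAsg Arc Add (Var Edge) (Var EdgeCnt) ;; ALoad Vert Head (Var Arc) ;; visit) Q \<sigma>2"
      using c2 e W_big by simp
  qed
  with st e show ?thesis by (simp add: visit_ends_def static_def)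
qed

abbreviation linked :: "ast \<Rightarrow> nat set \<Rightarrow> bool" where
  "linked \<sigma> X \<equiv> adj tail n (arcs X UNIV) (arrs \<sigma> First) (arrs \<sigma> Succ) (arrs \<sigma> Pred)"

definition candidate :: "nat set \<Rightarrow> nat list \<Rightarrow> bool" where
  "candidate X fs \<longleftrightarrow> distinct fs \<and> set fs \<subseteq> {..<m} \<and> set fs \<inter> X = {} \<and> length fs \<le> k \<and>
     I \<subseteq> set fs \<and> conn E (set fs)"

definition ready :: "nat set \<Rightarrow> nat list \<Rightarrow> ast \<Rightarrow> bool" where
  "ready X fs \<sigma> \<longleftrightarrow> static \<sigma> \<and> linked \<sigma> X \<and> arrs \<sigma> EMark = (\<lambda>_. 0) \<and> arrs \<sigma> VMark = (\<lambda>_. 0) \<and>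
     vars \<sigma> ChosenCnt = length fs \<and> holds (arrs \<sigma> Chosen) fs \<and> candidate X fs"

definition start_inv :: "nat list \<Rightarrow> ast \<Rightarrow> nat \<Rightarrow> ast \<Rightarrow> bool" where
  "start_inv fs \<sigma>\<^sub>0 i \<sigma> \<longleftrightarrow> (\<exists>qs. vars \<sigma> Idx = i \<and> i \<le> length fs \<and> queued \<sigma> qs \<and> set qs = V (set (take i fs)) \<and>
     arrs \<sigma> EMark = (\<lambda>e. of_bool (e \<in> set (take i fs))) \<and> holds (arrs \<sigma> Seen) (take i fs) \<and>
     same {Idx, Edge, Vert, Arc, Tmp, QueueLen} {VMark, EMark, Queue, Seen} \<sigma>\<^sub>0 \<sigma>)"

lemma wp_start_body:
  assumes r: "ready X fs \<sigma>\<^sub>0" and inv: "start_inv fs \<sigma>\<^sub>0 i \<sigma>" and less: "i < length fs"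
  shows "wp start_body (start_inv fs \<sigma>\<^sub>0 (Suc i)) \<sigma>"
proof -
  from inv obtain qs where q: "vars \<sigma> Idx = i" "queued \<sigma> qs" "set qs = V (set (take i fs))"
    "arrs \<sigma> EMark = (\<lambda>e. of_bool (e \<in> set (take i fs)))" "holds (arrs \<sigma> Seen) (take i fs)"
    "same {Idx, Edge, Vert, Arc, Tmp, QueueLen} {VMark, EMark, Queue, Seen} \<sigma>\<^sub>0 \<sigma>"
    unfolding start_inv_def by blast
  let ?e = "fs ! i"
  have e: "?e < m" using r less unfolding ready_def candidate_def by (meson lessThan_iff nth_mem subsetD)
  have im: "i < m" using less r k_le_m unfolding ready_def candidate_def by linarith
  have ch: "arrs \<sigma> Chosen i = ?e"
    using same_arrs[OF q(6), of Chosen] r less by (simp add: ready_def holds_def)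
  have tk: "take (Suc i) fs = take i fs @ [?e]" using less by (simp add: take_Suc_conv_app_nth)
  have st: "static \<sigma>" using r by (intro static_same[OF _ q(6)]) (auto simp: ready_def)
  let ?\<sigma> = "\<sigma>\<lparr>vars := (vars \<sigma>)(Edge := ?e, Idx := Suc i),
     arrs := (arrs \<sigma>)(EMark := (arrs \<sigma> EMark)(?e := 1), Seen := (arrs \<sigma> Seen)(i := ?e))\<rparr>"
  have "wp visit_ends (start_inv fs \<sigma>\<^sub>0 (Suc i)) ?\<sigma>"
  proof (rule wp_visit_ends)
    show "static ?\<sigma>" using st by (simp add: static_def)
    show "queued ?\<sigma> qs" using q(2) by (simp add: queued_def)
    show "vars ?\<sigma> Edge = ?e" "?e < m" using e by simp_all
    fix \<sigma>' vs
    assume s': "same {Vert, Arc, Tmp, QueueLen} {VMark, Queue} ?\<sigma> \<sigma>'" "queued \<sigma>' (qs @ vs)"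
      "set (qs @ vs) = set qs \<union> E ?e"
    have "holds ((arrs \<sigma> Seen)(i := ?e)) (take (Suc i) fs)"
      unfolding tk using q(5) less by (intro holds_snoc) auto
    moreover have "set (qs @ vs) = V (set (take (Suc i) fs))" unfolding tk s'(3) q(3) by auto
    moreover have "arrs \<sigma>' EMark = (\<lambda>e. of_bool (e \<in> set (take (Suc i) fs)))"
      using same_arrs[OF s'(1), of EMark] q(4) unfolding tk by (auto simp: fun_eq_iff)
    moreover have "same {Idx, Edge, Vert, Arc, Tmp, QueueLen} {VMark, EMark, Queue, Seen} \<sigma>\<^sub>0 \<sigma>'"
      using s'(1) q(6) by (simp add: same_def)
    ultimately show "start_inv fs \<sigma>\<^sub>0 (Suc i) \<sigma>'"
      unfolding start_inv_def using s'(2) less same_vars[OF s'(1), of Idx] same_arrs[OF s'(1), of Seen]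
      by (intro exI[of _ "qs @ vs"]) simp
  qed
  then show ?thesis using e im ch q(1) W_big by (simp add: start_body_def)
qed

text \<open>The three disjuncts are the situations of \<open>search_branch\<close>,
  \<open>search_full\<close> and \<open>search_exhausted\<close>.\<close>

definition finished :: "nat list \<Rightarrow> nat list \<Rightarrow> nat list \<Rightarrow> nat option \<Rightarrow> nat \<Rightarrow> nat list \<Rightarrow> bool" where
  "finished fs ls qs h qi rest \<longleftrightarrow> (length ls = Suc k \<and> h \<noteq> None \<and> length fs < k) \<or>
     (length fs = k \<and> length ls \<le> k) \<or> (h = None \<and> qi = length qs \<and> rest = [] \<and> length ls \<le> k)"

definition scan_state ::
    "nat set \<Rightarrow> nat list \<Rightarrow> ast \<Rightarrow> nat list \<Rightarrow> nat list \<Rightarrow> nat list \<Rightarrow> nat option \<Rightarrow> nat \<Rightarrow> nat list \<Rightarrow> ast \<Rightarrow> bool"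
  where "scan_state X fs\<^sub>0 \<sigma>\<^sub>0 fs ls qs h qi rest \<sigma> \<longleftrightarrow> search X fs\<^sub>0 fs ls qs h qi rest \<and>
    same {Ptr, QueuePos, QueueLen, ChosenCnt, SeenCnt, Held, Go, Arc, Edge, Vert, Tmp, Idx}
      {VMark, EMark, Queue, Seen, Chosen} \<sigma>\<^sub>0 \<sigma> \<and> queued \<sigma> qs \<and>
    vars \<sigma> ChosenCnt = length fs \<and> holds (arrs \<sigma> Chosen) fs \<and>
    vars \<sigma> SeenCnt = length ls \<and> holds (arrs \<sigma> Seen) ls \<and> arrs \<sigma> EMark = (\<lambda>e. of_bool (e \<in> set ls)) \<and>
    vars \<sigma> QueuePos = qi \<and> vars \<sigma> Held = (case h of None \<Rightarrow> 0 | Some e \<Rightarrow> Suc e) \<and>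
    (\<exists>pv. ll (arrs \<sigma> Succ) (arrs \<sigma> Pred) pv (vars \<sigma> Ptr) rest)"

text \<open>\<open>work\<close> starts at \<open>length fs\<^sub>0\<close>, hence this offset to the
  round counter. The extra unit at \<open>Go = 0\<close> pays for a round that only discovers that
  the component is exhausted.\<close>

definition scan_inv :: "nat set \<Rightarrow> nat list \<Rightarrow> ast \<Rightarrow> nat \<Rightarrow> ast \<Rightarrow> bool" where
  "scan_inv X fs\<^sub>0 \<sigma>\<^sub>0 i \<sigma> \<longleftrightarrow> (\<exists>fs ls qs h qi rest. scan_state X fs\<^sub>0 \<sigma>\<^sub>0 fs ls qs h qi rest \<sigma> \<and>
     i + length fs\<^sub>0 \<le> work X fs qs qi rest + of_bool (vars \<sigma> Go = 0) \<and>
     (if vars \<sigma> Go = 0 then finished fs ls qs h qi rest else length ls \<le> k \<and> length fs < k))"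

lemma scan_invI:
  assumes "scan_state X fs\<^sub>0 \<sigma>\<^sub>0 fs ls qs h qi rest \<sigma>"
    "i + length fs\<^sub>0 \<le> work X fs qs qi rest + of_bool (vars \<sigma> Go = 0)"
    "vars \<sigma> Go = 0 \<Longrightarrow> finished fs ls qs h qi rest" "vars \<sigma> Go \<noteq> 0 \<Longrightarrow> length ls \<le> k \<and> length fs < k"
  shows "scan_inv X fs\<^sub>0 \<sigma>\<^sub>0 i \<sigma>"
  unfolding scan_inv_def using assms by (intro exI[of _ fs] exI[of _ ls] exI[of _ qs] exI[of _ h]
      exI[of _ qi] exI[of _ rest]) auto

lemma scan_stateD:
  assumes "scan_state X fs\<^sub>0 \<sigma>\<^sub>0 fs ls qs h qi rest \<sigma>"
  shows "search X fs\<^sub>0 fs ls qs h qi rest"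
    and "same {Ptr, QueuePos, QueueLen, ChosenCnt, SeenCnt, Held, Go, Arc, Edge, Vert, Tmp, Idx}
      {VMark, EMark, Queue, Seen, Chosen} \<sigma>\<^sub>0 \<sigma>"
    and "queued \<sigma> qs" and "vars \<sigma> ChosenCnt = length fs" and "holds (arrs \<sigma> Chosen) fs"
    and "vars \<sigma> SeenCnt = length ls" and "holds (arrs \<sigma> Seen) ls"
    and "arrs \<sigma> EMark = (\<lambda>e. of_bool (e \<in> set ls))"
    and "vars \<sigma> QueuePos = qi" and "vars \<sigma> Held = (case h of None \<Rightarrow> 0 | Some e \<Rightarrow> Suc e)"
    and "\<exists>pv. ll (arrs \<sigma> Succ) (arrs \<sigma> Pred) pv (vars \<sigma> Ptr) rest"
  using assms by (simp_all add: scan_state_def)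

text \<open>Each branch of the code is one transition of the abstract search:
  \<open>search_load\<close>, \<open>search_force\<close>, \<open>search_seen\<close>,
  \<open>search_hold\<close> or \<open>search_follow\<close>; with an empty queue and no held edge
  only the flag changes.\<close>

lemma wp_scan_body:
  assumes r: "ready X fs\<^sub>0 \<sigma>\<^sub>0" and inv: "scan_inv X fs\<^sub>0 \<sigma>\<^sub>0 i \<sigma>" and go: "vars \<sigma> Go \<noteq> 0"
  shows "wp scan_body (scan_inv X fs\<^sub>0 \<sigma>\<^sub>0 (Suc i)) \<sigma>"
proof -
  from inv go obtain fs ls qs h qi rest where s: "scan_state X fs\<^sub>0 \<sigma>\<^sub>0 fs ls qs h qi rest \<sigma>"
    and i: "i + length fs\<^sub>0 \<le> work X fs qs qi rest" and ls: "length ls \<le> k" and fs: "length fs < k"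
    unfolding scan_inv_def by auto
  note d = scan_stateD[OF s]
  obtain pv where pv: "ll (arrs \<sigma> Succ) (arrs \<sigma> Pred) pv (vars \<sigma> Ptr) rest" using d(11) by blast
  note q = d(3)[unfolded queued_def]
  note qi = searchD(14)[OF d(1)]
  have st: "static \<sigma>" using r by (intro static_same[OF _ d(2)]) (auto simp: ready_def)
  have same: "arrs \<sigma> First = arrs \<sigma>\<^sub>0 First" "arrs \<sigma> Succ = arrs \<sigma>\<^sub>0 Succ" "arrs \<sigma> Pred = arrs \<sigma>\<^sub>0 Pred"
    using d(2) by (simp_all add: same_def)
  show ?thesis
  proof (cases rest)
    case Nil
    then have ptr: "vars \<sigma> Ptr = 0" using pv by simp
    show ?thesis
    proof (cases "qi < length qs")
      case True
      let ?u = "qs ! qi"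
      have u: "?u < n" using q True by (meson lessThan_iff nth_mem subsetD)
      have Qu: "arrs \<sigma> Queue qi = ?u" using q True by (simp add: holds_def)
      have qn: "length qs \<le> n" using q distinct_card[of qs] card_mono[of "{..<n}" "set qs"] by simp
      obtain as where as: "distinct as" "set as = {a \<in> arcs X UNIV. tail a = ?u}"
        "ll (arrs \<sigma>\<^sub>0 Succ) (arrs \<sigma>\<^sub>0 Pred) 0 (arrs \<sigma>\<^sub>0 First ?u) as"
        using r u unfolding ready_def adj_def by blast
      have as': "set as = arcs X {?u}" using as(2) by (auto simp: arcs_def)
      note load = search_load[OF d(1)[unfolded Nil] True as(1) as']
      let ?\<sigma> = "\<sigma>\<lparr>vars := (vars \<sigma>)(Vert := ?u, Ptr := arrs \<sigma>\<^sub>0 First ?u, QueuePos := Suc qi)\<rparr>"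
      have "scan_state X fs\<^sub>0 \<sigma>\<^sub>0 fs ls qs h (Suc qi) as ?\<sigma>"
        unfolding scan_state_def using load(1) d as(3) same
        by (intro conjI) (auto simp: same_def queued_def)
      then have "scan_inv X fs\<^sub>0 \<sigma>\<^sub>0 (Suc i) ?\<sigma>"
        by (rule scan_invI) (use i load(2) Nil ls fs go in auto)
      with True ptr Qu u qn same d(9) q W_big show ?thesis by (simp add: scan_body_def next_vertex_def)
    next
      case False
      then have qi_eq: "qi = length qs" using qi by simp
      show ?thesis
      proof (cases h)
        case None
        let ?\<sigma> = "\<sigma>\<lparr>vars := (vars \<sigma>)(Go := 0)\<rparr>"
        have "scan_state X fs\<^sub>0 \<sigma>\<^sub>0 fs ls qs h qi rest ?\<sigma>"
          unfolding scan_state_def using d by (intro conjI) (auto simp: same_def queued_def)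
        then have "scan_inv X fs\<^sub>0 \<sigma>\<^sub>0 (Suc i) ?\<sigma>"
          by (rule scan_invI) (use i ls None Nil qi_eq in \<open>auto simp: finished_def\<close>)
        with None ptr qi_eq d(9,10) q show ?thesis by (simp add: scan_body_def)
      next
        case (Some e)
        have s1: "search X fs\<^sub>0 fs ls qs (Some e) (length qs) []" using d(1) Nil Some qi_eq by simp
        have e: "e < m" using searchD(2,5)[OF s1] by auto
        have fm: "length fs < m" using fs k_le_m by simp
        let ?\<sigma> = "\<sigma>\<lparr>vars := (vars \<sigma>)(Edge := e, ChosenCnt := Suc (length fs), Held := 0,
            Go := of_bool (Suc (length fs) < k)),
          arrs := (arrs \<sigma>)(Chosen := (arrs \<sigma> Chosen)(length fs := e))\<rparr>"
        have "wp visit_ends (scan_inv X fs\<^sub>0 \<sigma>\<^sub>0 (Suc i)) ?\<sigma>"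
        proof (rule wp_visit_ends)
          show "static ?\<sigma>" using st by (simp add: static_def)
          show "queued ?\<sigma> qs" using d(3) by (simp add: queued_def)
          show "vars ?\<sigma> Edge = e" "e < m" using e by simp_all
          fix \<sigma>' vs
          assume s': "same {Vert, Arc, Tmp, QueueLen} {VMark, Queue} ?\<sigma> \<sigma>'" "queued \<sigma>' (qs @ vs)"
            "set (qs @ vs) = set qs \<union> E e" "set vs \<subseteq> E e"
          have dist: "distinct (qs @ vs)" using s'(2) by (simp add: queued_def)
          note force = search_force[OF s1 ls dist s'(3,4)]
          have "holds ((arrs \<sigma> Chosen)(length fs := e)) (fs @ [e])" using d(5) by (intro holds_snoc) auto
          then have "scan_state X fs\<^sub>0 \<sigma>\<^sub>0 (fs @ [e]) ls (qs @ vs) None (length qs) [] \<sigma>'"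
            unfolding scan_state_def using force(1) d s'(1,2) ptr qi_eq
            by (intro conjI) (simp_all add: same_def)
          then show "scan_inv X fs\<^sub>0 \<sigma>\<^sub>0 (Suc i) \<sigma>'"
            by (rule scan_invI)
              (use i force(2) Nil qi_eq ls fs same_vars[OF s'(1), of Go] in \<open>auto simp: finished_def split: if_splits\<close>)
        qed
        with Some ptr qi_eq d(4,9,10) q st fm W_big show ?thesis
          by (simp add: scan_body_def force_held_def static_def)
      qed
    qed
  next
    case (Cons a rest')
    have s1: "search X fs\<^sub>0 fs ls qs h qi (a # rest')" using d(1) Cons by simp
    note new = search_new_edge[OF s1]
    let ?e = "arc_edge a"
    have ptr: "vars \<sigma> Ptr = Suc a" and ll': "ll (arrs \<sigma> Succ) (arrs \<sigma> Pred) (Suc a) (arrs \<sigma> Succ a) rest'"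
      using pv Cons by auto
    note work = work_arc[OF s1]
    let ?\<sigma>1 = "\<sigma>\<lparr>vars := (vars \<sigma>)(Arc := a, Ptr := arrs \<sigma> Succ a, Edge := ?e, Tmp := of_bool (?e \<in> set ls))\<rparr>"
    show ?thesis
    proof (cases "?e \<in> set ls")
      case True
      have "scan_state X fs\<^sub>0 \<sigma>\<^sub>0 fs ls qs h qi rest' ?\<sigma>1"
        unfolding scan_state_def using search_seen[OF s1 True] d ll'
        by (intro conjI) (auto simp: same_def queued_def)
      then have "scan_inv X fs\<^sub>0 \<sigma>\<^sub>0 (Suc i) ?\<sigma>1"
        by (rule scan_invI) (use i work Cons ls fs go in auto)
      with True ptr new st d(8) show ?thesis
        by (cases "a < m") (simp_all add: scan_body_def next_arc_def static_def arc_edge_def)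
    next
      case False
      have lm: "length ls < m"
        using searchD(1,2)[OF s1] new(2) False by (intro distinct_length_less) auto
      let ?\<sigma>2 = "\<sigma>\<lparr>vars := (vars \<sigma>)(Arc := a, Ptr := arrs \<sigma> Succ a, Edge := ?e,
          SeenCnt := Suc (length ls), Tmp := of_bool (k < Suc (length ls)),
          Go := of_bool (\<not> k < Suc (length ls))),
        arrs := (arrs \<sigma>)(EMark := (arrs \<sigma> EMark)(?e := 1), Seen := (arrs \<sigma> Seen)(length ls := ?e))\<rparr>"
      have seen: "holds ((arrs \<sigma> Seen)(length ls := ?e)) (ls @ [?e])"
        using d(7) by (intro holds_snoc) auto
      have mark: "(arrs \<sigma> EMark)(?e := 1) = (\<lambda>e. of_bool (e \<in> set (ls @ [?e])))"
        using d(8) by (auto simp: fun_eq_iff)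
      show ?thesis
      proof (cases h)
        case None
        let ?\<sigma>3 = "?\<sigma>2\<lparr>vars := (vars ?\<sigma>2)(Held := Suc ?e)\<rparr>"
        have "search X fs\<^sub>0 fs (ls @ [?e]) qs (Some ?e) qi rest'"
          using s1 None False ls by (intro search_hold) auto
        then have "scan_state X fs\<^sub>0 \<sigma>\<^sub>0 fs (ls @ [?e]) qs (Some ?e) qi rest' ?\<sigma>3"
          unfolding scan_state_def using d ll' seen mark
          by (intro conjI) (auto simp: same_def queued_def)
        then have "scan_inv X fs\<^sub>0 \<sigma>\<^sub>0 (Suc i) ?\<sigma>3"
          by (rule scan_invI) (use i work Cons ls fs in \<open>auto simp: finished_def split: if_splits\<close>)
        with False None ptr new st d(6,8,10) lm W_big show ?thesis
          by (cases "a < m") (simp_all add: scan_body_def next_arc_def static_def arc_edge_def)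
      next
        case (Some e)
        let ?\<sigma>3 = "?\<sigma>2\<lparr>vars := (vars ?\<sigma>2)(Vert := head a)\<rparr>"
        have "wp visit (scan_inv X fs\<^sub>0 \<sigma>\<^sub>0 (Suc i)) ?\<sigma>3"
        proof (rule wp_visit)
          show "queued ?\<sigma>3 qs" using d(3) by (simp add: queued_def)
          show "vars ?\<sigma>3 Vert < n" using arc_ends_less(2)[OF new(1)] by simp
          fix \<sigma>' vs
          assume s': "same {Tmp, QueueLen} {VMark, Queue} ?\<sigma>3 \<sigma>'" "queued \<sigma>' (qs @ vs)"
            "set (qs @ vs) = insert (vars ?\<sigma>3 Vert) (set qs)"
          have dist: "distinct (qs @ vs)" using s'(2) by (simp add: queued_def)
          have set: "set (qs @ vs) = insert (head a) (set qs)" using s'(3) by simp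
          note follow = search_follow[OF s1[unfolded Some] False ls dist set]
          have "scan_state X fs\<^sub>0 \<sigma>\<^sub>0 fs (ls @ [?e]) (qs @ vs) (Some e) qi rest' \<sigma>'"
            unfolding scan_state_def using follow(1) d s'(1,2) ll' seen mark Some
            by (intro conjI) (auto simp: same_def)
          then show "scan_inv X fs\<^sub>0 \<sigma>\<^sub>0 (Suc i) \<sigma>'"
            by (rule scan_invI)
              (use i follow(2) work Cons ls fs same_vars[OF s'(1), of Go] in
                \<open>auto simp: finished_def split: if_splits\<close>)
        qed
        with False Some ptr new st d(6,8,10) lm W_big show ?thesis
          by (cases "a < m") (simp_all add: scan_body_def next_arc_def static_def arc_edge_def)
      qed
    qed
  qed
qed

end

section \<open>Updating the graph and moving between subproblems\<close>

definition delete_arc :: acom where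
  "delete_arc = ALoad Prv Pred (Var Arc) ;; ALoad Nxt Succ (Var Arc) ;;
     AIf Eq (Var Prv) Zero (AStore First (Var Vert) (Var Nxt))
       (AAsg Tmp Sub (Var Prv) One ;; AStore Succ (Var Tmp) (Var Nxt)) ;;
     AIf Eq (Var Nxt) Zero ASkip (AAsg Tmp Sub (Var Nxt) One ;; AStore Pred (Var Tmp) (Var Prv))"

definition insert_arc :: acom where
  "insert_arc = ALoad Nxt First (Var Vert) ;; AStore Succ (Var Arc) (Var Nxt) ;;
     AStore Pred (Var Arc) Zero ;; AAsg Tmp Add (Var Arc) One ;; AStore First (Var Vert) (Var Tmp) ;;
     AIf Eq (Var Nxt) Zero ASkip (AAsg Prv Sub (Var Nxt) One ;; AStore Pred (Var Prv) (Var Tmp))"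

text \<open>No array stores tails. The tail of an arc is the head of its twin, which explains the
  crossed accesses to \<open>Head\<close>.\<close>

definition both_arcs :: "acom \<Rightarrow> acom" where
  "both_arcs c = AAsg Tmp Add (Var Edge) (Var EdgeCnt) ;; ALoad Vert Head (Var Tmp) ;;
     AAsg Arc Sub (Var Edge) Zero ;; c ;;
     AAsg Arc Add (Var Edge) (Var EdgeCnt) ;; ALoad Vert Head (Var Edge) ;; c"

text \<open>The exclusion is explored first. For the postponed inclusion the stack records only the
  edge and the number of chosen edges, since the chosen list of that moment remains a prefix of the
  later ones.\<close>

definition branch :: acom where
  "branch = AAsg Edge Sub (Var Held) One ;; AStore Excl (Var Depth) (Var Edge) ;;
     AStore ExclLen (Var Depth) (Var ChosenCnt) ;; AAsg Depth Add (Var Depth) One ;;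
     both_arcs delete_arc"

text \<open>The seen edges are written, not the chosen ones: in an exhausted component the solution
  may contain edges that were followed without ever being chosen.\<close>

definition emit :: acom where
  "emit = AAsg Idx Add Zero Zero ;;
     AWhile Less (Var Idx) (Var SeenCnt)
       (ALoad Tmp Seen (Var Idx) ;; AOut (Var Tmp) ;; AAsg Idx Add (Var Idx) One)"

text \<open>Popping an edge turns its exclusion into its inclusion: it returns to the lists and
  becomes the last chosen edge.\<close>

definition backtrack :: acom where
  "backtrack = AIf Eq (Var Depth) Zero (AAsg Run Add Zero Zero)
     (AAsg Depth Sub (Var Depth) One ;; ALoad Edge Excl (Var Depth) ;;
      ALoad ChosenCnt ExclLen (Var Depth) ;; AStore Chosen (Var ChosenCnt) (Var Edge) ;;
      AAsg ChosenCnt Add (Var ChosenCnt) One ;; both_arcs insert_arc)"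

definition main_body :: acom where
  "main_body = explore ;;
     AIf Less (Var Size) (Var SeenCnt) branch
       (AIf Eq (Var SeenCnt) (Var Size) emit ASkip ;; backtrack)"

definition main :: acom where
  "main = AWhile Less Zero (Var Run) main_body"

text \<open>The loops take at most \<open>k\<close> rounds for the chosen edges,
  \<open>5 * Suc k + 1\<close> for the scan, \<open>Suc k\<close> for the edge marks and
  \<open>2 * Suc k\<close> for the vertex marks. An assignment costs 5, a loop and each of its
  rounds 6 extra.\<close>

definition explore_time :: "nat \<Rightarrow> nat" where
  "explore_time k = 10 + ((6 + k * (6 + cost start_body)) + (25 +
     ((6 + (5 * Suc k + 1) * (6 + cost scan_body)) + (5 + ((6 + Suc k * (6 + cost clear_edge)) +
     (5 + (6 + 2 * Suc k * (6 + cost clear_vertex))))))))"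

text \<open>The 18 is a round of \<open>emit\<close>: 6 for the loop and 12 for its load, output and
  assignment.\<close>

definition body_time :: "nat \<Rightarrow> nat" where
  "body_time k = explore_time k + (6 + (cost branch + (6 + (5 + (6 + k * 18)) + cost backtrack)))"

context enumeration
begin

definition explored :: "nat set \<Rightarrow> nat list \<Rightarrow> ast \<Rightarrow> ast \<Rightarrow> bool" where
  "explored X fs\<^sub>0 \<sigma>\<^sub>0 \<sigma> \<longleftrightarrow> (\<exists>fs ls qs h qi rest. search X fs\<^sub>0 fs ls qs h qi rest \<and>
     finished fs ls qs h qi rest \<and>
     same {Ptr, QueuePos, QueueLen, ChosenCnt, SeenCnt, Held, Go, Arc, Edge, Vert, Tmp, Idx}
      {VMark, EMark, Queue, Seen, Chosen} \<sigma>\<^sub>0 \<sigma> \<and>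
     arrs \<sigma> VMark = (\<lambda>_. 0) \<and> arrs \<sigma> EMark = (\<lambda>_. 0) \<and>
     vars \<sigma> ChosenCnt = length fs \<and> holds (arrs \<sigma> Chosen) fs \<and>
     vars \<sigma> SeenCnt = length ls \<and> holds (arrs \<sigma> Seen) ls \<and>
     vars \<sigma> Held = (case h of None \<Rightarrow> 0 | Some e \<Rightarrow> Suc e))"

lemma triple_wp_Seq:
  "wp c (\<lambda>\<sigma>'. triple T d \<sigma>' Q) \<sigma> \<Longrightarrow> triple (cost c + T) (c ;; d) \<sigma> Q"
  by (rule triple_Seq) (rule wp_imp_triple)

text \<open>One proof for edge and vertex marks. As the list is distinct, the marks after
  \<open>i\<close> rounds are exactly those of the suffix \<open>drop i ls\<close>.\<close>

lemma triple_clear: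
  assumes c: "c = ALoad x B (Var Idx) ;; AStore A (Var x) Zero ;; AAsg Idx Add (Var Idx) One"
    and x: "x \<noteq> Idx" "x \<noteq> cnt" "cnt \<noteq> Idx" "A \<noteq> B"
    and ls: "distinct ls" "set ls \<subseteq> {..<len n m A}" "length ls \<le> len n m B" "len n m B \<le> n + m"
    and \<sigma>: "vars \<sigma> Idx = 0" "vars \<sigma> cnt = length ls" "holds (arrs \<sigma> B) ls"
      "arrs \<sigma> A = (\<lambda>e. of_bool (e \<in> set ls))" "length ls \<le> T"
    and post: "\<And>\<sigma>'. same {Idx, x} {A} \<sigma> \<sigma>' \<Longrightarrow> arrs \<sigma>' A = (\<lambda>_. 0) \<Longrightarrow> Q \<sigma>'"
  shows "triple (6 + T * (6 + cost c)) (AWhile Less (Var Idx) (Var cnt) c) \<sigma> Q"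
proof (rule triple_While[where I = "\<lambda>i \<sigma>'. vars \<sigma>' Idx = i \<and> i \<le> length ls \<and> same {Idx, x} {A} \<sigma> \<sigma>' \<and>
    arrs \<sigma>' A = (\<lambda>e. of_bool (e \<in> set (drop i ls)))"])
  show "vars \<sigma> Idx = 0 \<and> 0 \<le> length ls \<and> same {Idx, x} {A} \<sigma> \<sigma> \<and>
    arrs \<sigma> A = (\<lambda>e. of_bool (e \<in> set (drop 0 ls)))" using \<sigma> by (simp add: same_refl)
next
  fix i \<sigma>'
  assume inv: "vars \<sigma>' Idx = i \<and> i \<le> length ls \<and> same {Idx, x} {A} \<sigma> \<sigma>' \<and>
    arrs \<sigma>' A = (\<lambda>e. of_bool (e \<in> set (drop i ls)))"
  then show "i \<le> T" using \<sigma> by simp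
  show "fits Less (ev \<sigma>' (Var Idx)) (ev \<sigma>' (Var cnt))" by simp
  have cnt: "vars \<sigma>' cnt = length ls" using inv \<sigma> x by (auto simp: same_def)
  { assume "eval_binop Less (ev \<sigma>' (Var Idx)) (ev \<sigma>' (Var cnt)) \<noteq> 0"
    then have i: "i < length ls" using inv cnt by simp
    have B: "arrs \<sigma>' B i = ls ! i" using inv \<sigma> x i by (auto simp: same_def holds_def)
    have lsi: "ls ! i < len n m A" using ls(2) i nth_mem by blast
    have drop: "drop i ls = ls ! i # drop (Suc i) ls" using i by (simp add: Cons_nth_drop_Suc)
    have "ls ! i \<notin> set (drop (Suc i) ls)" using distinct_drop[OF ls(1), of i] unfolding drop by simp
    then have A: "(arrs \<sigma>' A)(ls ! i := 0) = (\<lambda>e. of_bool (e \<in> set (drop (Suc i) ls)))"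
      using inv unfolding drop by (auto simp: fun_eq_iff)
    have "wp c (\<lambda>\<sigma>'. vars \<sigma>' Idx = Suc i \<and> Suc i \<le> length ls \<and> same {Idx, x} {A} \<sigma> \<sigma>' \<and>
      arrs \<sigma>' A = (\<lambda>e. of_bool (e \<in> set (drop (Suc i) ls)))) \<sigma>'"
      unfolding c using inv i B lsi A x ls(3,4) W_big by (simp add: same_def)
    then show "triple (cost c) c \<sigma>' (\<lambda>\<sigma>'. vars \<sigma>' Idx = Suc i \<and> Suc i \<le> length ls \<and> same {Idx, x} {A} \<sigma> \<sigma>' \<and>
      arrs \<sigma>' A = (\<lambda>e. of_bool (e \<in> set (drop (Suc i) ls))))" by (rule wp_imp_triple) }
  { assume "eval_binop Less (ev \<sigma>' (Var Idx)) (ev \<sigma>' (Var cnt)) = 0"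
    then have "i = length ls" using inv cnt by simp
    with inv show "Q \<sigma>'" by (intro post) auto }
qed

lemma triple_explore:
  assumes r: "ready X fs\<^sub>0 \<sigma>\<^sub>0"
  shows "triple (explore_time k) explore \<sigma>\<^sub>0 (explored X fs\<^sub>0 \<sigma>\<^sub>0)"
proof -
  note r' = r[unfolded ready_def candidate_def]
  let ?V = "{Ptr, QueuePos, QueueLen, ChosenCnt, SeenCnt, Held, Go, Arc, Edge, Vert, Tmp, Idx}"
  let ?A = "{VMark, EMark, Queue, Seen, Chosen}"
  \<comment> \<open>Programs and bounds are named from the end, because \<open>triple_Seq\<close>
    peels off the front and the remaining program reappears in each postcondition.\<close>
  let ?T5 = "6 + 2 * Suc k * (6 + cost clear_vertex)"
  let ?c5 = "AWhile Less (Var Idx) (Var QueueLen) clear_vertex"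
  let ?T4 = "(6 + Suc k * (6 + cost clear_edge)) + (5 + ?T5)"
  let ?c4 = "AWhile Less (Var Idx) (Var SeenCnt) clear_edge ;; AAsg Idx Add Zero Zero ;; ?c5"
  let ?T3 = "(6 + (5 * Suc k + 1) * (6 + cost scan_body)) + (5 + ?T4)"
  let ?c3 = "AWhile Less Zero (Var Go) scan_body ;; AAsg Idx Add Zero Zero ;; ?c4"
  let ?a2 = "AAsg SeenCnt Sub (Var ChosenCnt) Zero ;; AAsg QueuePos Add Zero Zero ;; AAsg Ptr Add Zero Zero ;;
      AAsg Held Add Zero Zero ;; AAsg Go Less (Var ChosenCnt) (Var Size)"
  have clear: "triple (5 + ?T4) (AAsg Idx Add Zero Zero ;; ?c4) \<sigma> (explored X fs\<^sub>0 \<sigma>\<^sub>0)"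
    if inv: "scan_inv X fs\<^sub>0 \<sigma>\<^sub>0 i \<sigma>" and go: "vars \<sigma> Go = 0" for i \<sigma>
  proof -
    from inv go obtain fs ls qs h qi rest where s: "scan_state X fs\<^sub>0 \<sigma>\<^sub>0 fs ls qs h qi rest \<sigma>"
      and fin: "finished fs ls qs h qi rest"
      unfolding scan_inv_def by auto
    note d = scan_stateD[OF s]
    note q = d(3)[unfolded queued_def]
    have lsk: "length ls \<le> Suc k" using searchD(4)[OF d(1)] .
    have lsm: "length ls \<le> m"
      using searchD(1,2)[OF d(1)] distinct_card[of ls] card_mono[of "{..<m}" "set ls"] by simp
    have qn: "length qs \<le> n" using q distinct_card[of qs] card_mono[of "{..<n}" "set qs"] by simp
    have qk: "length qs \<le> 2 * Suc k" using work_le(2)[OF d(1)] lsk by simp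
    let ?\<sigma>1 = "\<sigma>\<lparr>vars := (vars \<sigma>)(Idx := 0)\<rparr>"
    have fin_v: "explored X fs\<^sub>0 \<sigma>\<^sub>0 \<sigma>3"
      if 2: "same {Idx, Edge} {EMark} ?\<sigma>1 \<sigma>2" "arrs \<sigma>2 EMark = (\<lambda>_. 0)"
        and 3: "same {Idx, Vert} {VMark} (\<sigma>2\<lparr>vars := (vars \<sigma>2)(Idx := 0)\<rparr>) \<sigma>3" "arrs \<sigma>3 VMark = (\<lambda>_. 0)"
      for \<sigma>2 \<sigma>3
      unfolding explored_def
      using d 2 3 fin
      by (intro exI[of _ fs] exI[of _ ls] exI[of _ qs] exI[of _ h] exI[of _ qi] exI[of _ rest])
        (simp add: same_def)
    have c5: "triple ?T5 ?c5 (\<sigma>2\<lparr>vars := (vars \<sigma>2)(Idx := 0)\<rparr>) (explored X fs\<^sub>0 \<sigma>\<^sub>0)"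
      if 2: "same {Idx, Edge} {EMark} ?\<sigma>1 \<sigma>2" "arrs \<sigma>2 EMark = (\<lambda>_. 0)" for \<sigma>2
      by (rule triple_clear[OF clear_vertex_def, where ls = qs])
        (use q qn qk 2 fin_v in \<open>auto simp: same_def\<close>)
    have "triple ?T4 ?c4 ?\<sigma>1 (explored X fs\<^sub>0 \<sigma>\<^sub>0)"
    proof (rule triple_Seq, rule triple_clear[OF clear_edge_def, where ls = ls])
      fix \<sigma>2 assume "same {Idx, Edge} {EMark} ?\<sigma>1 \<sigma>2" "arrs \<sigma>2 EMark = (\<lambda>_. 0)"
      from c5[OF this] show "triple (5 + ?T5) (AAsg Idx Add Zero Zero ;; ?c5) \<sigma>2 (explored X fs\<^sub>0 \<sigma>\<^sub>0)"
        using triple_wp_Seq[of "AAsg Idx Add Zero Zero" ?T5 ?c5 "explored X fs\<^sub>0 \<sigma>\<^sub>0" \<sigma>2] by simp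
    qed (use d searchD(1,2)[OF d(1)] lsk lsm in \<open>auto simp: same_def\<close>)
    then show ?thesis
      using triple_wp_Seq[of "AAsg Idx Add Zero Zero" ?T4 ?c4 "explored X fs\<^sub>0 \<sigma>\<^sub>0" \<sigma>] by simp
  qed
  have scan: "triple (25 + ?T3) (?a2 ;; ?c3) \<sigma> (explored X fs\<^sub>0 \<sigma>\<^sub>0)"
    if inv: "start_inv fs\<^sub>0 \<sigma>\<^sub>0 (length fs\<^sub>0) \<sigma>" for \<sigma>
  proof -
    from inv obtain qs where q: "queued \<sigma> qs" "set qs = V (set fs\<^sub>0)"
      "arrs \<sigma> EMark = (\<lambda>e. of_bool (e \<in> set fs\<^sub>0))" "holds (arrs \<sigma> Seen) fs\<^sub>0"
      "same {Idx, Edge, Vert, Arc, Tmp, QueueLen} {VMark, EMark, Queue, Seen} \<sigma>\<^sub>0 \<sigma>"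
      unfolding start_inv_def by auto
    have dist: "distinct qs" using q(1) by (simp add: queued_def)
    have init: "search X fs\<^sub>0 fs\<^sub>0 fs\<^sub>0 qs None 0 []" "work X fs\<^sub>0 qs 0 [] = length fs\<^sub>0"
      using search_init[OF _ _ _ _ _ _ dist q(2)] r' by auto
    let ?\<sigma>1 = "\<sigma>\<lparr>vars := (vars \<sigma>)(SeenCnt := length fs\<^sub>0, QueuePos := 0, Ptr := 0, Held := 0,
      Go := of_bool (length fs\<^sub>0 < k))\<rparr>"
    have "scan_state X fs\<^sub>0 \<sigma>\<^sub>0 fs\<^sub>0 fs\<^sub>0 qs None 0 [] ?\<sigma>1"
      unfolding scan_state_def using init(1) q r' by (intro conjI) (auto simp: same_def queued_def)
    then have inv0: "scan_inv X fs\<^sub>0 \<sigma>\<^sub>0 0 ?\<sigma>1"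
      by (rule scan_invI) (use init(2) r' in \<open>auto simp: finished_def split: if_splits\<close>)
    have "triple ?T3 ?c3 ?\<sigma>1 (explored X fs\<^sub>0 \<sigma>\<^sub>0)"
    proof (rule triple_Seq, rule triple_While[where I = "scan_inv X fs\<^sub>0 \<sigma>\<^sub>0"])
      show "scan_inv X fs\<^sub>0 \<sigma>\<^sub>0 0 ?\<sigma>1" by (rule inv0)
    next
      fix i \<sigma>' assume i: "scan_inv X fs\<^sub>0 \<sigma>\<^sub>0 i \<sigma>'"
      then obtain fs ls qs h qi rest where s: "search X fs\<^sub>0 fs ls qs h qi rest"
        and w: "i + length fs\<^sub>0 \<le> work X fs qs qi rest + of_bool (vars \<sigma>' Go = 0)"
        unfolding scan_inv_def scan_state_def by blast
      have "of_bool (vars \<sigma>' Go = 0) \<le> (1::nat)" by simp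
      with w work_le(1)[OF s] searchD(4)[OF s] show "i \<le> 5 * Suc k + 1" by simp
      show "fits Less (ev \<sigma>' Zero) (ev \<sigma>' (Var Go))" by simp
      show "triple (cost scan_body) scan_body \<sigma>' (scan_inv X fs\<^sub>0 \<sigma>\<^sub>0 (Suc i))"
        if "eval_binop Less (ev \<sigma>' Zero) (ev \<sigma>' (Var Go)) \<noteq> 0"
        using that by (intro wp_imp_triple wp_scan_body[OF r i]) simp
      show "triple (5 + ?T4) (AAsg Idx Add Zero Zero ;; ?c4) \<sigma>' (explored X fs\<^sub>0 \<sigma>\<^sub>0)"
        if "eval_binop Less (ev \<sigma>' Zero) (ev \<sigma>' (Var Go)) = 0"
        using that by (intro clear[OF i]) simp
    qed
    moreover have "vars \<sigma> ChosenCnt = length fs\<^sub>0" "vars \<sigma> Size = k"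
      using q(5) r' by (auto simp: same_def static_def)
    ultimately have "wp ?a2 (\<lambda>\<sigma>. triple ?T3 ?c3 \<sigma> (explored X fs\<^sub>0 \<sigma>\<^sub>0)) \<sigma>" by simp
    from triple_wp_Seq[OF this] show ?thesis by simp
  qed
  let ?\<sigma>1 = "\<sigma>\<^sub>0\<lparr>vars := (vars \<sigma>\<^sub>0)(Idx := 0, QueueLen := 0)\<rparr>"
  have start: "start_inv fs\<^sub>0 \<sigma>\<^sub>0 0 ?\<sigma>1"
    unfolding start_inv_def using r' by (intro exI[of _ "[]"]) (simp add: queued_def same_def holds_def)
  have "triple ((6 + k * (6 + cost start_body)) + (25 + ?T3))
      (AWhile Less (Var Idx) (Var ChosenCnt) start_body ;; ?a2 ;; ?c3) ?\<sigma>1 (explored X fs\<^sub>0 \<sigma>\<^sub>0)"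
  proof (rule triple_Seq, rule triple_While[where I = "start_inv fs\<^sub>0 \<sigma>\<^sub>0", OF start])
    fix i \<sigma>' assume i: "start_inv fs\<^sub>0 \<sigma>\<^sub>0 i \<sigma>'"
    have len: "i \<le> length fs\<^sub>0" "vars \<sigma>' Idx = i" "vars \<sigma>' ChosenCnt = length fs\<^sub>0"
      using i r' by (auto simp: start_inv_def same_def)
    then show "i \<le> k" using r' by simp
    show "fits Less (ev \<sigma>' (Var Idx)) (ev \<sigma>' (Var ChosenCnt))" by simp
    show "triple (cost start_body) start_body \<sigma>' (start_inv fs\<^sub>0 \<sigma>\<^sub>0 (Suc i))"
      if "eval_binop Less (ev \<sigma>' (Var Idx)) (ev \<sigma>' (Var ChosenCnt)) \<noteq> 0"
      using that len by (intro wp_imp_triple wp_start_body[OF r i]) simp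
    show "triple (25 + ?T3) (?a2 ;; ?c3) \<sigma>' (explored X fs\<^sub>0 \<sigma>\<^sub>0)"
      if "eval_binop Less (ev \<sigma>' (Var Idx)) (ev \<sigma>' (Var ChosenCnt)) = 0"
      using that len i by (intro scan) auto
  qed
  then have "wp (AAsg Idx Add Zero Zero ;; AAsg QueueLen Add Zero Zero)
    (\<lambda>\<sigma>. triple ((6 + k * (6 + cost start_body)) + (25 + ?T3))
      (AWhile Less (Var Idx) (Var ChosenCnt) start_body ;; ?a2 ;; ?c3) \<sigma> (explored X fs\<^sub>0 \<sigma>\<^sub>0)) \<sigma>\<^sub>0"
    by simp
  from triple_wp_Seq[OF this] show ?thesis by (simp add: explore_def explore_time_def)
qed

section \<open>Correctness of edge deletion and insertion\<close>

lemma wp_delete_arc: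
  assumes adj: "adj tail n A (arrs \<sigma> First) (arrs \<sigma> Succ) (arrs \<sigma> Pred)"
    and a: "vars \<sigma> Arc = a" "vars \<sigma> Vert = tail a" "a \<in> A" "A \<subseteq> {..<2 * m}"
    and post: "\<And>\<sigma>'. same {Prv, Nxt, Tmp} {First, Succ, Pred} \<sigma> \<sigma>' \<Longrightarrow>
      adj tail n (A - {a}) (arrs \<sigma>' First) (arrs \<sigma>' Succ) (arrs \<sigma>' Pred) \<Longrightarrow> Q \<sigma>'"
  shows "wp delete_arc Q \<sigma>"
proof -
  have am: "a < 2 * m" using a by auto
  note t = arc_ends_less(1)[OF am]
  note del = adj_delete[OF adj a(3) t]
  have p: "arrs \<sigma> Pred a \<noteq> 0 \<Longrightarrow> arrs \<sigma> Pred a - 1 < 2 * m"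
    "arrs \<sigma> Succ a \<noteq> 0 \<Longrightarrow> arrs \<sigma> Succ a - 1 < 2 * m" using del(2,3) a(4) by auto
  show ?thesis
    using del(1) a(1,2) am t p
    by (cases "arrs \<sigma> Pred a = 0"; cases "arrs \<sigma> Succ a = 0")
      (auto simp: delete_arc_def same_def intro!: post)
qed

lemma wp_insert_arc:
  assumes adj: "adj tail n A (arrs \<sigma> First) (arrs \<sigma> Succ) (arrs \<sigma> Pred)"
    and a: "vars \<sigma> Arc = a" "vars \<sigma> Vert = tail a" "a \<notin> A" "a < 2 * m" "A \<subseteq> {..<2 * m}"
    and post: "\<And>\<sigma>'. same {Prv, Nxt, Tmp} {First, Succ, Pred} \<sigma> \<sigma>' \<Longrightarrow>
      adj tail n (insert a A) (arrs \<sigma>' First) (arrs \<sigma>' Succ) (arrs \<sigma>' Pred) \<Longrightarrow> Q \<sigma>'"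
  shows "wp insert_arc Q \<sigma>"
proof -
  note t = arc_ends_less(1)[OF a(4)]
  note ins = adj_insert[OF adj a(3) t]
  have p: "arrs \<sigma> First (tail a) \<noteq> 0 \<Longrightarrow> arrs \<sigma> First (tail a) - 1 < 2 * m" using ins(2) a(5) by auto
  show ?thesis
    using ins(1) a(1,2,4) t p W_big
    by (cases "arrs \<sigma> First (tail a) = 0") (auto simp: insert_arc_def same_def intro!: post)
qed

text \<open>\<open>R\<close> abstracts the list invariant for a varying set of arcs, so that the
  treatment of an edge as two arcs is verified once for deletion and insertion.\<close>

lemma wp_both_arcs:
  assumes st: "static \<sigma>" and e: "vars \<sigma> Edge = e" "e < m"
    and R0: "R A\<^sub>0 \<sigma>"
    and R_vars: "\<And>A \<sigma> U. R A (\<sigma>\<lparr>vars := U\<rparr>) \<longleftrightarrow> R A \<sigma>"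
    and c1: "\<And>\<sigma> Q. R A\<^sub>0 \<sigma> \<Longrightarrow> vars \<sigma> Arc = e \<Longrightarrow> vars \<sigma> Vert = tail e \<Longrightarrow>
      (\<And>\<sigma>'. same {Prv, Nxt, Tmp} {First, Succ, Pred} \<sigma> \<sigma>' \<Longrightarrow> R A\<^sub>1 \<sigma>' \<Longrightarrow> Q \<sigma>') \<Longrightarrow> wp c Q \<sigma>"
    and c2: "\<And>\<sigma> Q. R A\<^sub>1 \<sigma> \<Longrightarrow> vars \<sigma> Arc = e + m \<Longrightarrow> vars \<sigma> Vert = tail (e + m) \<Longrightarrow>
      (\<And>\<sigma>'. same {Prv, Nxt, Tmp} {First, Succ, Pred} \<sigma> \<sigma>' \<Longrightarrow> R A\<^sub>2 \<sigma>' \<Longrightarrow> Q \<sigma>') \<Longrightarrow> wp c Q \<sigma>"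
    and post: "\<And>\<sigma>'. same {Arc, Vert, Prv, Nxt, Tmp} {First, Succ, Pred} \<sigma> \<sigma>' \<Longrightarrow> R A\<^sub>2 \<sigma>' \<Longrightarrow> Q \<sigma>'"
  shows "wp (both_arcs c) Q \<sigma>"
proof -
  note tw = twin(1,2)[OF e(2)]
  let ?\<sigma>1 = "\<sigma>\<lparr>vars := (vars \<sigma>)(Tmp := e + m, Vert := head (e + m), Arc := e)\<rparr>"
  have "wp c (wp (AAsg Arc Add (Var Edge) (Var EdgeCnt) ;; ALoad Vert Head (Var Edge) ;; c) Q) ?\<sigma>1"
  proof (rule c1)
    fix \<sigma>2 assume 2: "same {Prv, Nxt, Tmp} {First, Succ, Pred} ?\<sigma>1 \<sigma>2" "R A\<^sub>1 \<sigma>2"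
    have f: "vars \<sigma>2 Edge = e" "vars \<sigma>2 EdgeCnt = m" "arrs \<sigma>2 Head e = head e"
      using 2(1) st e by (auto simp: same_def static_def)
    let ?\<sigma>3 = "\<sigma>2\<lparr>vars := (vars \<sigma>2)(Arc := e + m, Vert := head e)\<rparr>"
    have "wp c Q ?\<sigma>3"
    proof (rule c2)
      fix \<sigma>4 assume 4: "same {Prv, Nxt, Tmp} {First, Succ, Pred} ?\<sigma>3 \<sigma>4" "R A\<^sub>2 \<sigma>4"
      show "Q \<sigma>4" using 2(1) 4 by (intro post) (auto simp: same_def)
    qed (use 2 R_vars tw in auto)
    then show "wp (AAsg Arc Add (Var Edge) (Var EdgeCnt) ;; ALoad Vert Head (Var Edge) ;; c) Q \<sigma>2"
      using f e W_big by simp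
  qed (use R0 R_vars tw in auto)
  with st e W_big show ?thesis by (simp add: both_arcs_def static_def)
qed

lemma arcs_subset: "arcs X U \<subseteq> {..<2 * m}"
  by (auto simp: arcs_def)

lemma arcs_insert: "e < m \<Longrightarrow> arcs (insert e X) UNIV = arcs X UNIV - {e} - {e + m}"
  by (auto simp: arcs_def arc_edge_def split: if_splits)

lemma wp_delete_edge:
  assumes st: "static \<sigma>" and e: "vars \<sigma> Edge = e" "e < m" "e \<notin> X" and l: "linked \<sigma> X"
    and post: "\<And>\<sigma>'. same {Arc, Vert, Prv, Nxt, Tmp} {First, Succ, Pred} \<sigma> \<sigma>' \<Longrightarrow>
      linked \<sigma>' (insert e X) \<Longrightarrow> Q \<sigma>'"
  shows "wp (both_arcs delete_arc) Q \<sigma>"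
proof (rule wp_both_arcs[OF st e(1,2), where
    R = "\<lambda>A \<sigma>. adj tail n A (arrs \<sigma> First) (arrs \<sigma> Succ) (arrs \<sigma> Pred)" and
    A\<^sub>0 = "arcs X UNIV" and A\<^sub>1 = "arcs X UNIV - {e}" and A\<^sub>2 = "arcs X UNIV - {e} - {e + m}"])
  have "e \<in> arcs X UNIV" "e + m \<in> arcs X UNIV - {e}"
    using e twin[OF e(2)] by (auto simp: arcs_def)
  then show "wp delete_arc Q \<sigma>"
    if "adj tail n (arcs X UNIV) (arrs \<sigma> First) (arrs \<sigma> Succ) (arrs \<sigma> Pred)" "vars \<sigma> Arc = e"
      "vars \<sigma> Vert = tail e" "\<And>\<sigma>'. same {Prv, Nxt, Tmp} {First, Succ, Pred} \<sigma> \<sigma>' \<Longrightarrow>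
        adj tail n (arcs X UNIV - {e}) (arrs \<sigma>' First) (arrs \<sigma>' Succ) (arrs \<sigma>' Pred) \<Longrightarrow> Q \<sigma>'"
    for \<sigma> Q using that arcs_subset by (intro wp_delete_arc) auto
  show "wp delete_arc Q \<sigma>"
    if "adj tail n (arcs X UNIV - {e}) (arrs \<sigma> First) (arrs \<sigma> Succ) (arrs \<sigma> Pred)" "vars \<sigma> Arc = e + m"
      "vars \<sigma> Vert = tail (e + m)" "\<And>\<sigma>'. same {Prv, Nxt, Tmp} {First, Succ, Pred} \<sigma> \<sigma>' \<Longrightarrow>
        adj tail n (arcs X UNIV - {e} - {e + m}) (arrs \<sigma>' First) (arrs \<sigma>' Succ) (arrs \<sigma>' Pred) \<Longrightarrow> Q \<sigma>'"
    for \<sigma> Q using that \<open>e + m \<in> arcs X UNIV - {e}\<close> arcs_subset[of X UNIV]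
    by (intro wp_delete_arc[of "arcs X UNIV - {e}" \<sigma> "e + m"]) auto
qed (use l post arcs_insert[OF e(2)] in auto)

lemma wp_insert_edge:
  assumes st: "static \<sigma>" and e: "vars \<sigma> Edge = e" "e < m" "e \<notin> X" and l: "linked \<sigma> (insert e X)"
    and post: "\<And>\<sigma>'. same {Arc, Vert, Prv, Nxt, Tmp} {First, Succ, Pred} \<sigma> \<sigma>' \<Longrightarrow>
      linked \<sigma>' X \<Longrightarrow> Q \<sigma>'"
  shows "wp (both_arcs insert_arc) Q \<sigma>"
proof -
  let ?A = "arcs (insert e X) UNIV"
  have A: "e \<notin> ?A" "e + m \<notin> insert e ?A" "?A \<subseteq> {..<2 * m}" "insert (e + m) (insert e ?A) = arcs X UNIV"
    using e twin[OF e(2)] by (auto simp: arcs_def arc_edge_def split: if_splits)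
  show ?thesis
  proof (rule wp_both_arcs[OF st e(1,2), where
      R = "\<lambda>A \<sigma>. adj tail n A (arrs \<sigma> First) (arrs \<sigma> Succ) (arrs \<sigma> Pred)" and
      A\<^sub>0 = ?A and A\<^sub>1 = "insert e ?A" and A\<^sub>2 = "insert (e + m) (insert e ?A)"])
    show "wp insert_arc Q \<sigma>"
      if "adj tail n ?A (arrs \<sigma> First) (arrs \<sigma> Succ) (arrs \<sigma> Pred)" "vars \<sigma> Arc = e"
        "vars \<sigma> Vert = tail e" "\<And>\<sigma>'. same {Prv, Nxt, Tmp} {First, Succ, Pred} \<sigma> \<sigma>' \<Longrightarrow>
          adj tail n (insert e ?A) (arrs \<sigma>' First) (arrs \<sigma>' Succ) (arrs \<sigma>' Pred) \<Longrightarrow> Q \<sigma>'"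
      for \<sigma> Q using that A e by (intro wp_insert_arc[of ?A \<sigma> e]) auto
    show "wp insert_arc Q \<sigma>"
      if "adj tail n (insert e ?A) (arrs \<sigma> First) (arrs \<sigma> Succ) (arrs \<sigma> Pred)" "vars \<sigma> Arc = e + m"
        "vars \<sigma> Vert = tail (e + m)" "\<And>\<sigma>'. same {Prv, Nxt, Tmp} {First, Succ, Pred} \<sigma> \<sigma>' \<Longrightarrow>
          adj tail n (insert (e + m) (insert e ?A)) (arrs \<sigma>' First) (arrs \<sigma>' Succ) (arrs \<sigma>' Pred) \<Longrightarrow> Q \<sigma>'"
      for \<sigma> Q using that A e by (intro wp_insert_arc[of "insert e ?A" \<sigma> "e + m"]) auto
  qed (use l post A in auto)
qed

end

section \<open>The main loop\<close>

text \<open>A subproblem with \<open>N \<ge> 1\<close> solutions takes \<open>2 * N - 1\<close> iterations: \<open>N\<close> of them end in an output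
  and \<open>N - 1\<close> branch.\<close>

definition weight :: "'b set \<Rightarrow> nat" where
  "weight A = max 1 (2 * card A - 1)"

text \<open>Of all solutions \<open>A\<close>, the blocks \<open>bs\<close> are written and the
  families \<open>P\<close> are open after \<open>i\<close> iterations. The equation on
  cardinalities excludes repetitions; the weights bound the iterations to come.\<close>

definition covers :: "nat set set \<Rightarrow> nat \<Rightarrow> nat list list \<Rightarrow> nat set set list \<Rightarrow> bool" where
  "covers A i bs P \<longleftrightarrow> A = set (map set bs) \<union> \<Union>(set P) \<and>
     card A = length bs + sum_list (map card P) \<and> i + sum_list (map weight P) \<le> weight A"

text \<open>With both parts nonempty,
  \<open>2 * (c + d) - 1 = 1 + (2 * c - 1) + (2 * d - 1)\<close>; the unit left over pays for the
  branching iteration.\<close>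

lemma covers_split:
  assumes "covers A i bs (B # P)" "B = C \<union> D" "card B = card C + card D" "card C \<noteq> 0" "card D \<noteq> 0"
  shows "covers A (Suc i) bs (C # D # P)"
proof -
  have "weight B = Suc (weight C + weight D)" using assms(3-5) by (simp add: weight_def)
  with assms show ?thesis by (auto simp: covers_def)
qed

lemma covers_emit: "covers A i bs ({set b} # P) \<Longrightarrow> covers A (Suc i) (bs @ [b]) P"
  by (auto simp: covers_def weight_def)

text \<open>The lower bound 1 in \<open>weight\<close> pays for the iteration that discards an empty
  family.\<close>

lemma covers_drop: "covers A i bs ({} # P) \<Longrightarrow> covers A (Suc i) bs P"
  by (auto simp: covers_def weight_def)

lemma covers_bound: "covers A i bs P \<Longrightarrow> i \<le> weight A"
  unfolding covers_def by linarith

context enumeration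
begin

text \<open>An entry \<open>(e, gs)\<close> postpones the subproblem that chooses \<open>e\<close>
  after \<open>gs\<close>; the exclusions in force there are the edges of the entries below it.
  Older lists are prefixes of newer ones, so the machine can do with their lengths.\<close>

fun stack_ok :: "nat list \<Rightarrow> (nat \<times> nat list) list \<Rightarrow> bool" where
  "stack_ok fs [] \<longleftrightarrow> True"
| "stack_ok fs ((e, gs) # st) \<longleftrightarrow> (\<exists>zs. fs = gs @ zs) \<and> e \<notin> fst ` set st \<and>
     candidate (fst ` set st) (gs @ [e]) \<and> stack_ok gs st"

fun pending :: "(nat \<times> nat list) list \<Rightarrow> nat set set list" where
  "pending [] = []"
| "pending ((e, gs) # st) = sol (insert e (set gs)) (fst ` set st) # pending st"

lemma stack_ok_extend: "stack_ok fs st \<Longrightarrow> stack_ok (fs @ gs) st"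
  by (cases st rule: pending.cases) auto

lemma stack_ok_distinct: "stack_ok fs st \<Longrightarrow> distinct (map fst st) \<and> fst ` set st \<subseteq> {..<m}"
  by (induction st arbitrary: fs rule: pending.induct) (auto simp: candidate_def)

text \<open>The list has the top of the stack first, the arrays have it last; hence
  \<open>rev\<close>.\<close>

definition stacked :: "(nat \<times> nat list) list \<Rightarrow> ast \<Rightarrow> bool" where
  "stacked st \<sigma> \<longleftrightarrow> vars \<sigma> Depth = length st \<and> holds (arrs \<sigma> Excl) (map fst (rev st)) \<and>
     holds (arrs \<sigma> ExclLen) (map (\<lambda>p. length (snd p)) (rev st))"

definition main_inv :: "nat \<Rightarrow> ast \<Rightarrow> bool" where
  "main_inv i \<sigma> \<longleftrightarrow> (\<exists>fs st bs. stacked st \<sigma> \<and> stack_ok fs st \<and> outs \<sigma> = concat bs \<and>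
     (\<forall>b\<in>set bs. length b = k \<and> distinct b \<and> set b \<subseteq> {..<m}) \<and>
     (if vars \<sigma> Run = 0 then st = [] \<and> covers (sol I {}) i bs []
      else ready (fst ` set st) fs \<sigma> \<and>
        covers (sol I {}) i bs (sol (set fs) (fst ` set st) # pending st)))"

lemma main_invI:
  assumes "stacked st \<sigma>" "stack_ok fs st" "outs \<sigma> = concat bs"
    "\<forall>b\<in>set bs. length b = k \<and> distinct b \<and> set b \<subseteq> {..<m}" "vars \<sigma> Run \<noteq> 0"
    "ready (fst ` set st) fs \<sigma>" "covers (sol I {}) i bs (sol (set fs) (fst ` set st) # pending st)"
  shows "main_inv i \<sigma>"
  unfolding main_inv_def using assms by (intro exI[of _ fs] exI[of _ st] exI[of _ bs]) simp

lemma triple_emit: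
  assumes "vars \<sigma> SeenCnt = length ls" "holds (arrs \<sigma> Seen) ls" "length ls = k"
    and post: "\<And>\<sigma>'. same {Idx, Tmp} {} (\<sigma>\<lparr>outs := outs \<sigma> @ ls\<rparr>) \<sigma>' \<Longrightarrow> Q \<sigma>'"
  shows "triple (5 + (6 + k * 18)) emit \<sigma> Q"
proof -
  let ?c = "ALoad Tmp Seen (Var Idx) ;; AOut (Var Tmp) ;; AAsg Idx Add (Var Idx) One"
  let ?I = "\<lambda>i \<sigma>'. vars \<sigma>' Idx = i \<and> i \<le> k \<and> same {Idx, Tmp} {} (\<sigma>\<lparr>outs := outs \<sigma> @ take i ls\<rparr>) \<sigma>'"
  have "triple (6 + k * (6 + cost ?c)) (AWhile Less (Var Idx) (Var SeenCnt) ?c)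
    (\<sigma>\<lparr>vars := (vars \<sigma>)(Idx := 0)\<rparr>) Q"
  proof (rule triple_While[where I = ?I])
    show "?I 0 (\<sigma>\<lparr>vars := (vars \<sigma>)(Idx := 0)\<rparr>)" by (simp add: same_def)
  next
    fix i \<sigma>' assume i: "?I i \<sigma>'"
    then have f: "vars \<sigma>' SeenCnt = k" "arrs \<sigma>' Seen = arrs \<sigma> Seen" "outs \<sigma>' = outs \<sigma> @ take i ls"
      using assms by (auto simp: same_def)
    show "i \<le> k" using i by simp
    show "fits Less (ev \<sigma>' (Var Idx)) (ev \<sigma>' (Var SeenCnt))" by simp
    { assume "eval_binop Less (ev \<sigma>' (Var Idx)) (ev \<sigma>' (Var SeenCnt)) \<noteq> 0"
      then have ik: "i < k" using i f by simp
      have "take (Suc i) ls = take i ls @ [arrs \<sigma> Seen i]"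
        using ik assms by (simp add: take_Suc_conv_app_nth holds_def)
      then have "wp ?c (?I (Suc i)) \<sigma>'"
        using i f ik k_le_m W_big by (simp add: same_def)
      then show "triple (cost ?c) ?c \<sigma>' (?I (Suc i))" by (rule wp_imp_triple) }
    { assume "eval_binop Less (ev \<sigma>' (Var Idx)) (ev \<sigma>' (Var SeenCnt)) = 0"
      then have "i = k" using i f by simp
      with i assms(3) show "Q \<sigma>'" by (intro post) simp }
  qed
  then show ?thesis
    using triple_wp_Seq[of "AAsg Idx Add Zero Zero" "6 + k * 18" "AWhile Less (Var Idx) (Var SeenCnt) ?c" Q \<sigma>]
    by (simp add: emit_def)
qed

lemma stacked_top:
  assumes "stacked ((e, gs) # st) \<sigma>"
  shows "arrs \<sigma> Excl (length st) = e" "arrs \<sigma> ExclLen (length st) = length gs"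
    "vars \<sigma> Depth = Suc (length st)" "holds (arrs \<sigma> Excl) (map fst (rev st))"
    "holds (arrs \<sigma> ExclLen) (map (\<lambda>p. length (snd p)) (rev st))"
  using assms by (auto simp: stacked_def holds_def nth_append split: if_splits)

lemma stacked_push:
  assumes "stacked st \<sigma>"
  shows "stacked ((e, gs) # st) (\<sigma>\<lparr>vars := (vars \<sigma>)(Depth := Suc (length st)),
    arrs := (arrs \<sigma>)(Excl := (arrs \<sigma> Excl)(length st := e),
      ExclLen := (arrs \<sigma> ExclLen)(length st := length gs))\<rparr>)"
  using assms by (auto simp: stacked_def intro!: holds_snoc)

lemma stacked_same:
  "stacked st \<sigma> \<Longrightarrow> same Vs As \<sigma> \<sigma>' \<Longrightarrow> Depth \<notin> Vs \<Longrightarrow> Excl \<notin> As \<Longrightarrow> ExclLen \<notin> As \<Longrightarrow> stacked st \<sigma>'"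
  by (simp add: stacked_def same_def)

lemma wp_backtrack:
  assumes stacked: "stacked st \<sigma>" and ok: "stack_ok fs st" and out: "outs \<sigma> = concat bs"
    and bs: "\<forall>b\<in>set bs. length b = k \<and> distinct b \<and> set b \<subseteq> {..<m}"
    and run: "vars \<sigma> Run \<noteq> 0"
    and \<sigma>: "static \<sigma>" "linked \<sigma> (fst ` set st)" "arrs \<sigma> EMark = (\<lambda>_. 0)" "arrs \<sigma> VMark = (\<lambda>_. 0)"
      "holds (arrs \<sigma> Chosen) fs"
    and cov: "covers (sol I {}) i bs (pending st)"
  shows "wp backtrack (main_inv i) \<sigma>"
proof (cases st rule: pending.cases)
  case 1
  have "main_inv i (\<sigma>\<lparr>vars := (vars \<sigma>)(Run := 0)\<rparr>)"
    unfolding main_inv_def using stacked out bs cov 1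
    by (intro exI[of _ fs] exI[of _ "[]"] exI[of _ bs]) (simp add: stacked_def)
  with stacked 1 show ?thesis by (simp add: backtrack_def stacked_def)
next
  case (2 e gs st')
  note top = stacked_top[OF stacked[unfolded 2]]
  let ?X = "fst ` set st'"
  from ok 2 obtain zs where zs: "fs = gs @ zs" and e: "e \<notin> ?X" and cand: "candidate ?X (gs @ [e])"
    and ok': "stack_ok gs st'" by auto
  have em: "e < m" and gk: "length gs < k" using cand by (auto simp: candidate_def)
  have dist: "distinct (map fst st')" "?X \<subseteq> {..<m}" using stack_ok_distinct[OF ok'] by auto
  have lm: "length st' < m"
    using distinct_length_less[of "map fst st'" m e] dist em e by simp
  let ?\<sigma> = "\<sigma>\<lparr>vars := (vars \<sigma>)(Depth := length st', Edge := e, ChosenCnt := Suc (length gs)),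
    arrs := (arrs \<sigma>)(Chosen := (arrs \<sigma> Chosen)(length gs := e))\<rparr>"
  have "wp (both_arcs insert_arc) (main_inv i) ?\<sigma>"
  proof (rule wp_insert_edge[where X = ?X])
    show "static ?\<sigma>" using \<sigma>(1) by (simp add: static_def)
    show "vars ?\<sigma> Edge = e" "e < m" "e \<notin> ?X" using em e by simp_all
    show "linked ?\<sigma> (insert e ?X)" using \<sigma>(2) 2 by simp
    fix \<sigma>' assume s': "same {Arc, Vert, Prv, Nxt, Tmp} {First, Succ, Pred} ?\<sigma> \<sigma>'" "linked \<sigma>' ?X"
    \<comment> \<open>\<open>gs\<close> is a prefix of the current list and thus still stored; only
      the cell behind it is overwritten.\<close>
    have "holds ((arrs \<sigma> Chosen)(length gs := e)) (gs @ [e])"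
      using \<sigma>(5) zs by (intro holds_snoc) (auto intro: holds_append)
    then have "ready ?X (gs @ [e]) \<sigma>'"
      using \<sigma> s' cand by (simp add: ready_def static_def same_def)
    moreover have "stacked st' \<sigma>'"
      using top by (intro stacked_same[OF _ s'(1)]) (auto simp: stacked_def)
    ultimately show "main_inv i \<sigma>'"
      using s'(1) ok' out bs run cov 2
      by (intro main_invI[where st = st' and fs = "gs @ [e]" and bs = bs])
        (auto simp: same_def stack_ok_extend)
  qed
  with top lm gk k_le_m em W_big show ?thesis by (simp add: backtrack_def)
qed

text \<open>One exploration settles the current subproblem: either it splits into two solvable ones,
  or its at most one solution is written and the top of the stack takes over.\<close>

lemma triple_main_body:
  assumes inv: "main_inv i \<sigma>\<^sub>0" and run: "vars \<sigma>\<^sub>0 Run \<noteq> 0"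
  shows "triple (body_time k) main_body \<sigma>\<^sub>0 (main_inv (Suc i))"
proof -
  from inv run obtain fs\<^sub>0 st bs where stacked\<^sub>0: "stacked st \<sigma>\<^sub>0" and ok: "stack_ok fs\<^sub>0 st"
    and out: "outs \<sigma>\<^sub>0 = concat bs" and bs: "\<forall>b\<in>set bs. length b = k \<and> distinct b \<and> set b \<subseteq> {..<m}"
    and r: "ready (fst ` set st) fs\<^sub>0 \<sigma>\<^sub>0"
    and cov: "covers (sol I {}) i bs (sol (set fs\<^sub>0) (fst ` set st) # pending st)"
    unfolding main_inv_def by auto
  let ?X = "fst ` set st"
  let ?T = "cost branch + (6 + (5 + (6 + k * 18)) + cost backtrack)"
  have "triple (6 + ?T) (AIf Less (Var Size) (Var SeenCnt) branch
       (AIf Eq (Var SeenCnt) (Var Size) emit ASkip ;; backtrack)) \<sigma> (main_inv (Suc i))"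
    if ex: "explored ?X fs\<^sub>0 \<sigma>\<^sub>0 \<sigma>" for \<sigma>
  proof -
    from ex obtain fs ls qs h qi rest where s: "search ?X fs\<^sub>0 fs ls qs h qi rest"
      and fin: "finished fs ls qs h qi rest"
      and sm: "same {Ptr, QueuePos, QueueLen, ChosenCnt, SeenCnt, Held, Go, Arc, Edge, Vert, Tmp, Idx}
        {VMark, EMark, Queue, Seen, Chosen} \<sigma>\<^sub>0 \<sigma>"
      and marks: "arrs \<sigma> VMark = (\<lambda>_. 0)" "arrs \<sigma> EMark = (\<lambda>_. 0)"
      and ch: "vars \<sigma> ChosenCnt = length fs" "holds (arrs \<sigma> Chosen) fs"
      and seen: "vars \<sigma> SeenCnt = length ls" "holds (arrs \<sigma> Seen) ls"
      and held: "vars \<sigma> Held = (case h of None \<Rightarrow> 0 | Some e \<Rightarrow> Suc e)"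
      unfolding explored_def by blast
    note d = searchD[OF s]
    have st: "static \<sigma>" using r by (intro static_same[OF _ sm]) (auto simp: ready_def)
    have linked: "linked \<sigma> ?X" using r sm by (simp add: ready_def same_def)
    have stk: "stacked st \<sigma>" by (rule stacked_same[OF stacked\<^sub>0 sm]) auto
    have run': "vars \<sigma> Run \<noteq> 0" and out': "outs \<sigma> = concat bs" using run out sm by (auto simp: same_def)
    have ok': "stack_ok fs st" using d(9) ok stack_ok_extend by blast
    show ?thesis
    proof (rule triple_If)
      assume "eval_binop Less (ev \<sigma> (Var Size)) (ev \<sigma> (Var SeenCnt)) \<noteq> 0"
      then have "k < length ls" using st seen by (simp add: static_def split: if_splits)
      with fin obtain e where e: "h = Some e" "length ls = Suc k" "length fs < k"
        by (auto simp: finished_def)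
      note br = search_branch[OF s[unfolded e(1)] e(2,3)]
      have dist: "distinct (map fst st)" "?X \<subseteq> {..<m}" using stack_ok_distinct[OF ok'] by auto
      have lm: "length st < m" using distinct_length_less[of "map fst st" m e] dist br(3,4) by simp
      let ?\<sigma>1 = "\<sigma>\<lparr>vars := (vars \<sigma>)(Edge := e, Depth := Suc (length st)),
        arrs := (arrs \<sigma>)(Excl := (arrs \<sigma> Excl)(length st := e),
          ExclLen := (arrs \<sigma> ExclLen)(length st := length fs))\<rparr>"
      have "wp (both_arcs delete_arc) (main_inv (Suc i)) ?\<sigma>1"
      proof (rule wp_delete_edge[where X = ?X])
        show "static ?\<sigma>1" using st by (simp add: static_def)
        show "vars ?\<sigma>1 Edge = e" "e < m" "e \<notin> ?X" using br by simp_all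
        show "linked ?\<sigma>1 ?X" using linked by simp
        fix \<sigma>' assume s': "same {Arc, Vert, Prv, Nxt, Tmp} {First, Succ, Pred} ?\<sigma>1 \<sigma>'"
          "linked \<sigma>' (insert e ?X)"
        let ?st = "(e, fs) # st"
        have I: "I \<subseteq> set fs" using d(9,19) by auto
        have sub: "set fs \<subseteq> {..<m}" "set fs \<inter> insert e ?X = {}" using d(2,3,11) br(5) by auto
        have c1: "candidate (fst ` set ?st) fs"
          using sub d(10,12) e(3) I by (simp add: candidate_def)
        have c2: "candidate ?X (fs @ [e])"
          using sub d(10) e(3) I br by (auto simp: candidate_def)
        have "stacked ?st ?\<sigma>1"
          using stacked_push[OF stk, of e fs] by (simp add: stacked_def)
        then have stk': "stacked ?st \<sigma>'" by (rule stacked_same[OF _ s'(1)]) auto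
        have ready: "ready (fst ` set ?st) fs \<sigma>'"
          unfolding ready_def using c1 st marks ch s' by (simp add: same_def static_def)
        have eq: "sol (set fs\<^sub>0) ?X = sol (set fs) ?X" using d(20) by simp
        have "covers (sol I {}) (Suc i) bs
          (sol (set fs) (insert e ?X) # sol (insert e (set fs)) ?X # pending st)"
        proof (rule covers_split[OF cov])
          show "sol (set fs\<^sub>0) ?X = sol (set fs) (insert e ?X) \<union> sol (insert e (set fs)) ?X"
            unfolding eq by (rule sols_split[OF br(4)])
          show "card (sol (set fs\<^sub>0) ?X) =
            card (sol (set fs) (insert e ?X)) + card (sol (insert e (set fs)) ?X)"
            unfolding eq by (rule card_sols_split[OF br(4)])
        qed (use br in auto)
        then show "main_inv (Suc i) \<sigma>'"
          using stk' ok' ready bs out' run' c2 br(4) s'(1)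
          by (intro main_invI[where st = ?st and fs = fs and bs = bs]) (auto simp: same_def)
      qed
      then have "wp branch (main_inv (Suc i)) \<sigma>"
        using held e(1) stk ch lm W_big by (simp add: branch_def stacked_def)
      then show "triple ?T branch \<sigma> (main_inv (Suc i))"
        by (rule triple_weaken[OF wp_imp_triple]) auto
    next
      assume "eval_binop Less (ev \<sigma> (Var Size)) (ev \<sigma> (Var SeenCnt)) = 0"
      then have le: "length ls \<le> k" using st seen by (simp add: static_def split: if_splits)
      have sol: "sol (set fs\<^sub>0) ?X = (if length ls = k then {set ls} else {})"
      proof (cases "length fs = k")
        case True
        with search_full[OF s le] show ?thesis by simp
      next
        case False
        with fin le have "h = None" "qi = length qs" "rest = []" by (auto simp: finished_def)
        with search_exhausted[OF _ le] s show ?thesis by blast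
      qed
      have ch': "holds (arrs \<sigma> Chosen) fs" by (rule ch(2))
      have "triple (6 + (5 + (6 + k * 18)) + cost backtrack)
        (AIf Eq (Var SeenCnt) (Var Size) emit ASkip ;; backtrack) \<sigma> (main_inv (Suc i))"
      proof (rule triple_Seq, rule triple_If)
        assume "eval_binop Eq (ev \<sigma> (Var SeenCnt)) (ev \<sigma> (Var Size)) \<noteq> 0"
        then have k: "length ls = k" using st seen by (simp add: static_def split: if_splits)
        show "triple (5 + (6 + k * 18)) emit \<sigma> (\<lambda>\<sigma>'. triple (cost backtrack) backtrack \<sigma>' (main_inv (Suc i)))"
        proof (rule triple_emit[OF seen k], rule wp_imp_triple)
          fix \<sigma>' assume s': "same {Idx, Tmp} {} (\<sigma>\<lparr>outs := outs \<sigma> @ ls\<rparr>) \<sigma>'"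
          have "covers (sol I {}) (Suc i) (bs @ [ls]) (pending st)"
            using cov sol k by (intro covers_emit) simp
          moreover have "stacked st \<sigma>'"
            by (rule stacked_same[OF _ s']) (use stk in \<open>auto simp: stacked_def\<close>)
          ultimately show "wp backtrack (main_inv (Suc i)) \<sigma>'"
            using s' ok' out' bs k d(1,2) run' st linked marks ch'
            by (intro wp_backtrack[where st = st and fs = fs and bs = "bs @ [ls]"])
              (auto simp: same_def static_def)
        qed
      next
        assume "eval_binop Eq (ev \<sigma> (Var SeenCnt)) (ev \<sigma> (Var Size)) = 0"
        then have k: "length ls \<noteq> k" using st seen by (auto simp: static_def)
        have "covers (sol I {}) (Suc i) bs (pending st)"
          using cov sol k by (intro covers_drop) simp
        then have "wp backtrack (main_inv (Suc i)) \<sigma>"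
          using stk ok' out' bs run' st linked marks ch' by (intro wp_backtrack) auto
        then have "wp ASkip (\<lambda>\<sigma>'. triple (cost backtrack) backtrack \<sigma>' (main_inv (Suc i))) \<sigma>"
          by (simp add: wp_imp_triple)
        then show "triple (5 + (6 + k * 18)) ASkip \<sigma>
          (\<lambda>\<sigma>'. triple (cost backtrack) backtrack \<sigma>' (main_inv (Suc i)))"
          by (rule triple_weaken[OF wp_imp_triple]) auto
      qed simp
      then show "triple ?T (AIf Eq (Var SeenCnt) (Var Size) emit ASkip ;; backtrack) \<sigma> (main_inv (Suc i))"
        by (rule triple_weaken) auto
    qed simp
  qed
  then have "triple (explore_time k + (6 + ?T)) main_body \<sigma>\<^sub>0 (main_inv (Suc i))"
    unfolding main_body_def by (intro triple_Seq triple_weaken[OF triple_explore[OF r]]) auto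
  then show ?thesis by (simp add: body_time_def)
qed

lemma triple_main:
  assumes "ready {} fs \<sigma>" "set fs = I" "vars \<sigma> Depth = 0" "vars \<sigma> Run \<noteq> 0" "outs \<sigma> = []"
  shows "triple (6 + weight (sol I {}) * (6 + body_time k)) main \<sigma>
    (\<lambda>\<sigma>'. \<exists>bs. outs \<sigma>' = concat bs \<and> (\<forall>b\<in>set bs. length b = k \<and> distinct b \<and> set b \<subseteq> {..<m}) \<and>
       distinct (map set bs) \<and> set (map set bs) = sol I {})"
  unfolding main_def
proof (rule triple_While[where I = main_inv])
  show "main_inv 0 \<sigma>"
    by (rule main_invI[where st = "[]" and fs = fs and bs = "[]"])
      (use assms in \<open>auto simp: stacked_def holds_def covers_def\<close>)
next
  fix i \<sigma>' assume inv: "main_inv i \<sigma>'"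
  then show "i \<le> weight (sol I {})" unfolding main_inv_def by (auto split: if_splits dest: covers_bound)
  show "fits Less (ev \<sigma>' Zero) (ev \<sigma>' (Var Run))" by simp
  show "triple (body_time k) main_body \<sigma>' (main_inv (Suc i))"
    if "eval_binop Less (ev \<sigma>' Zero) (ev \<sigma>' (Var Run)) \<noteq> 0"
    using that by (intro triple_main_body[OF inv]) simp
  assume "eval_binop Less (ev \<sigma>' Zero) (ev \<sigma>' (Var Run)) = 0"
  with inv obtain bs where bs: "outs \<sigma>' = concat bs"
    "\<forall>b\<in>set bs. length b = k \<and> distinct b \<and> set b \<subseteq> {..<m}" "covers (sol I {}) i bs []"
    unfolding main_inv_def by auto
  then have "set (map set bs) = sol I {}" "card (sol I {}) = length bs"
    by (auto simp: covers_def)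
  \<comment> \<open>As many blocks were written as there are solutions, and every solution occurs,
    so none occurs twice.\<close>
  moreover from this have "distinct (map set bs)" by (intro card_distinct) simp
  ultimately show "\<exists>bs. outs \<sigma>' = concat bs \<and>
      (\<forall>b\<in>set bs. length b = k \<and> distinct b \<and> set b \<subseteq> {..<m}) \<and>
      distinct (map set bs) \<and> set (map set bs) = sol I {}" using bs by blast
qed

end

section \<open>Setup and running time\<close>

text \<open>Straight-line code as a function on states, so that the setup can be evaluated by
  simplification; \<open>step_ok\<close> rules out all other instructions.\<close>

fun step :: "com \<Rightarrow> state \<Rightarrow> state" where
  "step (Const r v) s = s\<lparr>regs := (regs s)(r := v)\<rparr>"
| "step (BinOp f r a b) s = s\<lparr>regs := (regs s)(r := eval_binop f (regs s a) (regs s b))\<rparr>"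
| "step (Load r a) s = s\<lparr>regs := (regs s)(r := mem s (regs s a))\<rparr>"
| "step _ s = s"

fun step_ok :: "nat \<Rightarrow> nat \<Rightarrow> com \<Rightarrow> state \<Rightarrow> bool" where
  "step_ok S W (Const r v) s \<longleftrightarrow> v \<le> W"
| "step_ok S W (BinOp f r a b) s \<longleftrightarrow> eval_binop f (regs s a) (regs s b) \<le> W"
| "step_ok S W (Load r a) s \<longleftrightarrow> regs s a < S \<and> mem s (regs s a) \<le> W"
| "step_ok S W _ s \<longleftrightarrow> False"

fun steps_ok :: "nat \<Rightarrow> nat \<Rightarrow> com list \<Rightarrow> state \<Rightarrow> bool" where
  "steps_ok S W [] s \<longleftrightarrow> True"
| "steps_ok S W (c # cs) s \<longleftrightarrow> step_ok S W c s \<and> steps_ok S W cs (step c s)"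

lemma exec_step: "step_ok S W c s \<Longrightarrow> exec S W c s 1 (step c s)"
  by (cases c) (auto intro: exec.intros[simplified])

lemma exec_steps:
  "steps_ok S W cs s \<Longrightarrow> exec S W (foldr Seq cs Skip) s (Suc (length cs)) (fold step cs s)"
proof (induction cs arbitrary: s)
  case Nil
  show ?case using exec.Skip[of S W s] by simp
next
  case (Cons c cs)
  from Cons.prems have "exec S W c s 1 (step c s)" using exec_step[of S W c s] by simp
  from exec.Seq[OF this Cons.IH] Cons.prems show ?case by simp
qed

text \<open>Constant time: only scalars and base addresses are computed, and no array is cleared
  because the memory behind the input is zero. Meanwhile registers 3 and 2 hold \<open>n\<close> and
  \<open>2 * m\<close>.\<close>

definition setup_code :: "com list" where
  "setup_code =
    [Const 0 0, Load 3 0, Const 0 1, Load (vreg EdgeCnt) 0, Const 0 2, Load (vreg Size) 0,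
     Const 0 3, Load (vreg ChosenCnt) 0, BinOp Add 2 (vreg EdgeCnt) (vreg EdgeCnt),
     Const (breg First) 4, BinOp Add (breg Head) (breg First) 3, BinOp Add (breg Succ) (breg Head) 2,
     BinOp Add (breg Pred) (breg Succ) 2, BinOp Add (breg Chosen) (breg Pred) 2,
     BinOp Add (breg VMark) (breg Chosen) (vreg EdgeCnt), BinOp Add (breg EMark) (breg VMark) 3,
     BinOp Add (breg Queue) (breg EMark) (vreg EdgeCnt), BinOp Add (breg Seen) (breg Queue) 3,
     BinOp Add (breg Excl) (breg Seen) (vreg EdgeCnt),
     BinOp Add (breg ExclLen) (breg Excl) (vreg EdgeCnt), Const (vreg Run) 1]"

text \<open>The two rejected cases have no solution. Rejecting them in constant time leaves
  \<open>card In \<le> k \<le> m\<close> for the main loop.\<close>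

definition guarded_main :: acom where
  "guarded_main = AIf Less (Var Size) (Var ChosenCnt) ASkip
     (AIf Less (Var EdgeCnt) (Var Size) ASkip main)"

definition prog :: com where
  "prog = Seq (foldr Seq setup_code Skip) (compile guarded_main)"

lemma (in machine) setup_exec:
  assumes M: "M 0 = n" "M 1 = m" "\<And>a. M a \<le> W"
  shows "\<exists>s. exec S W (foldr Seq setup_code Skip) (initial_state M) 22 s \<and> wf s \<and>
    vars (abstract s) EdgeCnt = m \<and> vars (abstract s) Size = M 2 \<and>
    vars (abstract s) ChosenCnt = M 3 \<and> vars (abstract s) Depth = 0 \<and> vars (abstract s) Run = 1 \<and>
    arrs (abstract s) = view n m M \<and> outs (abstract s) = []"
proof -
  let ?s = "fold step setup_code (initial_state M)"
  have W: "4 + 3 * n + 11 * m \<le> W" using layout words by simp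
  have k: "M 2 \<le> W" "M 3 \<le> W" using M(3) by auto
  have "steps_ok S W setup_code (initial_state M)"
    using layout W M k by (simp add: setup_code_def initial_state_def numeral_eq_Suc)
  then have "exec S W (foldr Seq setup_code Skip) (initial_state M) (Suc (length setup_code)) ?s"
    by (rule exec_steps)
  \<comment> \<open>21 instructions and the closing \<open>Skip\<close>.\<close>
  moreover have "Suc (length setup_code) = 22" by (simp add: setup_code_def)
  moreover have "regs ?s r \<le> W" for r
    using W M(1,2) k by (simp add: setup_code_def initial_state_def)
  moreover have "regs ?s (breg A) = base n m A" for A
    using M(1,2) by (cases A) (simp_all add: setup_code_def initial_state_def)
  moreover have "mem ?s = M" "out ?s = []"
    by (simp_all add: setup_code_def initial_state_def)
  moreover have "regs ?s (vreg EdgeCnt) = m" "regs ?s (vreg Size) = M 2"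
    "regs ?s (vreg ChosenCnt) = M 3" "regs ?s (vreg Depth) = 0" "regs ?s (vreg Run) = 1"
    using M(1,2) by (simp_all add: setup_code_def initial_state_def)
  ultimately show ?thesis using M(3) by (intro exI[of _ ?s]) (simp add: wf_def abstract_def)
qed

text \<open>Every link is null or a member of the list plus one; this keeps the input within the
  word size.\<close>

lemma ll_bounded:
  "ll sc pr pv pt as \<Longrightarrow> set as \<subseteq> {..<b} \<Longrightarrow> pv \<le> b \<Longrightarrow>
   pt \<le> b \<and> (\<forall>a\<in>set as. sc a \<le> b \<and> pr a \<le> b)"
proof (induction as arbitrary: pv pt)
  case (Cons a as)
  then have "sc a \<le> b \<and> (\<forall>a\<in>set as. sc a \<le> b \<and> pr a \<le> b)"
    using Cons.IH[of "Suc a" "sc a"] by auto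
  with Cons.prems show ?case by auto
qed simp

text \<open>\<open>body_time\<close> is affine in \<open>k\<close>, and its constant term is at most
  that term times \<open>k\<close>.\<close>

lemma body_time_le:
  assumes "1 \<le> k"
  shows "6 + body_time k \<le> (6 + body_time 1) * k"
  using assms
  by (simp add: body_time_def explore_time_def start_body_def scan_body_def clear_edge_def
      clear_vertex_def branch_def backtrack_def both_arcs_def delete_arc_def insert_arc_def
      next_vertex_def next_arc_def force_held_def visit_ends_def visit_def)

text \<open>The 40 is made up of 22 setup steps and 6 each for two guards and the main loop; it also
  exceeds what the memory layout needs. The factor 2 reflects at most \<open>2 * N\<close>
  iterations.\<close>

definition time_const :: nat where
  "time_const = 40 + 2 * (6 + body_time 1)"

lemma encoding_facts:
  assumes simple: "simple_graph G" and sub: "In \<subseteq> edges G" and enc: "encodes_instance G In k es M"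
    and n: "n = card (verts G)" and m: "m = card (edges G)"
  obtains "is" where "length es = m" "edges G = numbered_edge es ` {..<m}"
    "inj_on (numbered_edge es) {..<m}"
    "\<And>i. i < m \<Longrightarrow> fst (es ! i) < n \<and> snd (es ! i) < n \<and> fst (es ! i) \<noteq> snd (es ! i)"
    "M 0 = n" "M 1 = m" "M 2 = k" "M 3 = card In"
    "adj (arc_tail es) n {..<2 * m} (\<lambda>v. M (4 + v)) (\<lambda>a. M (4 + n + 2 * m + a))
       (\<lambda>a. M (4 + n + 4 * m + a))"
    "\<And>a. a < 2 * m \<Longrightarrow> M (4 + n + a) = arc_head es a"
    "distinct is" "length is = card In" "set is \<subseteq> {..<m}" "numbered_edge es ` set is = In"
    "\<And>j. j < length is \<Longrightarrow> M (4 + n + 6 * m + j) = is ! j"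
    "\<And>a. a \<ge> 4 + n + 6 * m + card In \<Longrightarrow> M a = 0"
proof -
  note enc' = enc[unfolded encodes_instance_def Let_def, folded n m]
  have inj: "inj_on (numbered_edge es) {..<length es}"
    and img: "numbered_edge es ` {..<length es} = edges G"
    using enc' by (auto simp: edge_numbering_def)
  have len: "length es = m" unfolding m img[symmetric] using card_image[OF inj] by simp
  have ends: "fst (es ! i) < n \<and> snd (es ! i) < n \<and> fst (es ! i) \<noteq> snd (es ! i)" if "i < m" for i
  proof -
    have "numbered_edge es i \<in> edges G" using that img len by blast
    then have "numbered_edge es i \<subseteq> {..<n}" "card (numbered_edge es i) = 2"
      using simple enc' by (auto simp: simple_graph_def)
    then show ?thesis by (auto simp: numbered_edge_def card_insert_if split: if_splits)
  qed
  have adj: "adj (arc_tail es) n {..<2 * m} (\<lambda>v. M (4 + v)) (\<lambda>a. M (4 + n + 2 * m + a))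
       (\<lambda>a. M (4 + n + 4 * m + a))"
    unfolding adj_def
  proof (intro allI impI)
    fix v assume "v < n"
    then obtain as where "distinct as" "set as = {a. a < 2 * m \<and> arc_tail es a = v}"
      "linked_list (M (4 + v)) (\<lambda>a. M (4 + n + 2 * m + a)) (\<lambda>a. M (4 + n + 4 * m + a)) as"
      using enc' by blast
    then show "\<exists>as. distinct as \<and> set as = {a \<in> {..<2 * m}. arc_tail es a = v} \<and>
      ll (\<lambda>a. M (4 + n + 2 * m + a)) (\<lambda>a. M (4 + n + 4 * m + a)) 0 (M (4 + v)) as"
      by (intro exI[of _ as]) (auto intro: linked_list_imp_ll)
  qed
  obtain "is" where "is": "length is = card In" "set is \<subseteq> {..<m}" "numbered_edge es ` set is = In"
    "\<forall>j<card In. M (4 + n + 6 * m + j) = is ! j" using enc' by blast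
  \<comment> \<open>The list has as many entries as \<open>In\<close> has edges and its image is all
    of \<open>In\<close>, so no entry is repeated.\<close>
  have "card In \<le> card (set is)" unfolding "is"(3)[symmetric] by (rule card_image_le) simp
  then have "distinct is" using "is"(1) card_length[of "is"] by (intro card_distinct) simp
  with len img inj ends adj "is" enc' show ?thesis
    by (intro that[of "is"]) auto
qed

theorem theorem8:
  shows "\<exists>(P :: com) (C :: nat). \<forall>(G :: nat graph) (In :: nat set set) (k :: nat) es M.
    simple_graph G \<and> In \<subseteq> edges G \<and> In \<noteq> {} \<and> connected_graph (edge_subgraph In) \<and>
    encodes_instance G In k es M \<longrightarrow>
    (let n = card (verts G); m = card (edges G); N = card (graphlets_containing G In k) in
     \<exists>t s. exec (C * (n + m)) (C * (n + m + k)) P (initial_state M) t s \<and>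
       enumerates es k (graphlets_containing G In k) (out s) \<and>
       t \<le> C * (n + m + k * N) \<and>
       (trimmed G In k \<longrightarrow> t \<le> C * (k * N + 1)))"
proof (intro exI[of _ prog] exI[of _ time_const] allI impI)
  fix G :: "nat graph" and In k es M
  assume *: "simple_graph G \<and> In \<subseteq> edges G \<and> In \<noteq> {} \<and> connected_graph (edge_subgraph In) \<and>
    encodes_instance G In k es M"
  define n where "n = card (verts G)"
  define m where "m = card (edges G)"
  define N where "N = card (graphlets_containing G In k)"
  define S where "S = time_const * (n + m)"
  define W where "W = time_const * (n + m + k)"
  from * obtain "is" where len: "length es = m" and img: "edges G = numbered_edge es ` {..<m}"
    and inj: "inj_on (numbered_edge es) {..<m}"
    and ends: "\<And>i. i < m \<Longrightarrow> fst (es ! i) < n \<and> snd (es ! i) < n \<and> fst (es ! i) \<noteq> snd (es ! i)"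
    and M: "M 0 = n" "M 1 = m" "M 2 = k" "M 3 = card In"
    and adj: "adj (arc_tail es) n {..<2 * m} (\<lambda>v. M (4 + v)) (\<lambda>a. M (4 + n + 2 * m + a))
       (\<lambda>a. M (4 + n + 4 * m + a))"
    and hd: "\<And>a. a < 2 * m \<Longrightarrow> M (4 + n + a) = arc_head es a"
    and "is": "distinct is" "length is = card In" "set is \<subseteq> {..<m}" "numbered_edge es ` set is = In"
    and In: "\<And>j. j < length is \<Longrightarrow> M (4 + n + 6 * m + j) = is ! j"
    and zero: "\<And>a. a \<ge> 4 + n + 6 * m + card In \<Longrightarrow> M a = 0"
    using encoding_facts[OF _ _ _ n_def m_def, of In k es M] by blast
  let ?E = "numbered_edge es" and ?I = "set is"
  let ?sols = "sols ?E m k ?I {}"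
  have two: "card (?E e) = 2" if "e < m" for e using ends[OF that] by (simp add: numbered_edge_def)
  have I_ne: "?I \<noteq> {}" using * "is"(4) by auto
  have conn: "conn ?E ?I"
    using * connected_graph_iff_conn[of ?I ?E] two "is"(3,4) by auto
  have graphlets: "graphlets_containing G In k = (\<lambda>S. edge_subgraph (?E ` S)) ` ?sols"
    "inj_on (\<lambda>S. edge_subgraph (?E ` S)) ?sols"
    using graphlets_containing_eq[OF inj img[symmetric] "is"(3), of k] two "is"(4) by auto
  have N: "N = card ?sols" unfolding N_def graphlets(1) using graphlets(2) by (rule card_image)
  have card_I: "card ?I = card In" using "is"(1,2) distinct_card by metis
  have In_le: "card In \<le> m" using card_mono[OF _ "is"(3)] card_I by simp
  have In_pos: "1 \<le> card In" using I_ne "is"(2) by (cases "is") auto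
  have C: "40 \<le> time_const" by (simp add: time_const_def)
  have C_mult: "40 * x \<le> time_const * x" for x using C by simp
  have C_pos: "40 \<le> time_const * x" if "1 \<le> x" for x using mult_le_mono[OF C that] by simp
  interpret machine n m S W
  proof
    have "40 * (n + m) \<le> S" unfolding S_def by (rule C_mult)
    \<comment> \<open>The four header cells are absorbed because a nonempty \<open>In\<close> gives
      \<open>1 \<le> m\<close>.\<close>
    then show "4 + 3 * n + 11 * m \<le> S" using In_pos In_le by simp
    show "S \<le> W" by (simp add: S_def W_def)
  qed
  have W: "40 * (n + m + k) \<le> W" unfolding W_def by (rule C_mult)
  have head_less: "arc_head es a < n" "arc_tail es a < n" if "a < 2 * m" for a
    using ends[of a] ends[of "a - m"] that by (auto simp: arc_head_def arc_tail_def len)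
  \<comment> \<open>\<open>wf\<close> asks for word-sized contents of the entire initial memory; the
    cases below follow the layout of the encoding.\<close>
  have M_le: "M a \<le> W" for a
  proof -
    have ptr: "M (4 + v) \<le> 2 * m" if v: "v < n" for v
    proof -
      obtain as where "set as = {a \<in> {..<2 * m}. arc_tail es a = v}"
        "ll (\<lambda>a. M (4 + n + 2 * m + a)) (\<lambda>a. M (4 + n + 4 * m + a)) 0 (M (4 + v)) as"
        using adj v unfolding adj_def by blast
      with ll_bounded[OF this(2), of "2 * m"] show ?thesis by auto
    qed
    have links: "M (4 + n + 2 * m + b) \<le> 2 * m \<and> M (4 + n + 4 * m + b) \<le> 2 * m" if b: "b < 2 * m" for b
    proof -
      obtain as where "set as = {a \<in> {..<2 * m}. arc_tail es a = arc_tail es b}"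
        "ll (\<lambda>a. M (4 + n + 2 * m + a)) (\<lambda>a. M (4 + n + 4 * m + a)) 0 (M (4 + arc_tail es b)) as"
        using adj head_less(2)[OF b] unfolding adj_def by blast
      with ll_bounded[OF this(2), of "2 * m"] b show ?thesis by auto
    qed
    have "is ! j < m" if "j < length is" for j using "is"(3) that nth_mem by blast
    then have inl: "M (4 + n + 6 * m + j) \<le> m" if "j < card In" for j
      using In[of j] that "is"(2) by (simp add: less_imp_le)
    consider "a < 4" | "4 \<le> a" "a < 4 + n" | "4 + n \<le> a" "a < 4 + n + 2 * m"
      | "4 + n + 2 * m \<le> a" "a < 4 + n + 4 * m" | "4 + n + 4 * m \<le> a" "a < 4 + n + 6 * m"
      | "4 + n + 6 * m \<le> a" "a < 4 + n + 6 * m + card In" | "4 + n + 6 * m + card In \<le> a"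
      by linarith
    then show ?thesis
    proof cases
      case 1
      then have "a = 0 \<or> a = 1 \<or> a = 2 \<or> a = 3" by auto
      then show ?thesis using M W In_le by auto
    next
      case 2
      then have "a - 4 < n" by linarith
      with 2 ptr[of "a - 4"] show ?thesis using W by simp
    next
      case 3
      then have "a - (4 + n) < 2 * m" by linarith
      with 3 hd[of "a - (4 + n)"] head_less(1)[of "a - (4 + n)"] show ?thesis using W by simp
    next
      case 4
      then have "a - (4 + n + 2 * m) < 2 * m" by linarith
      with 4 links[of "a - (4 + n + 2 * m)"] show ?thesis using W by simp
    next
      case 5
      then have "a - (4 + n + 4 * m) < 2 * m" by linarith
      with 5 links[of "a - (4 + n + 4 * m)"] show ?thesis using W by simp
    next
      case 6
      then have "a - (4 + n + 6 * m) < card In" by linarith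
      with 6 inl[of "a - (4 + n + 6 * m)"] show ?thesis using W In_le by simp
    next
      case 7
      then show ?thesis using zero by simp
    qed
  qed
  obtain s\<^sub>0 where s0: "exec S W (foldr Seq setup_code Skip) (initial_state M) 22 s\<^sub>0" "wf s\<^sub>0"
    and \<sigma>: "vars (abstract s\<^sub>0) EdgeCnt = m" "vars (abstract s\<^sub>0) Size = k"
    "vars (abstract s\<^sub>0) ChosenCnt = card In" "vars (abstract s\<^sub>0) Depth = 0"
    "vars (abstract s\<^sub>0) Run = 1" "arrs (abstract s\<^sub>0) = view n m M" "outs (abstract s\<^sub>0) = []"
    using setup_exec[OF M(1,2) M_le] M by auto
  let ?post = "\<lambda>\<sigma>'. \<exists>bs. outs \<sigma>' = concat bs \<and>
    (\<forall>b\<in>set bs. length b = k \<and> distinct b \<and> set b \<subseteq> {..<m}) \<and>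
    distinct (map set bs) \<and> set (map set bs) = ?sols"
  have result: "\<exists>t s. exec S W prog (initial_state M) t s \<and> t \<le> 22 + T \<and>
      enumerates es k (graphlets_containing G In k) (out s)"
    if tr: "triple T guarded_main (abstract s\<^sub>0) ?post" for T
  proof -
    from tr s0(2) obtain t s bs where t: "exec S W (compile guarded_main) s\<^sub>0 t s" "t \<le> T"
      and bs: "outs (abstract s) = concat bs"
      "\<forall>b\<in>set bs. length b = k \<and> distinct b \<and> set b \<subseteq> {..<m}" "distinct (map set bs)"
      "set (map set bs) = ?sols"
      unfolding triple_def by blast
    have map: "map (\<lambda>b. edge_subgraph (?E ` set b)) bs = map (\<lambda>S. edge_subgraph (?E ` S)) (map set bs)"
      by simp
    have "distinct (map (\<lambda>b. edge_subgraph (?E ` set b)) bs)"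
      unfolding map using bs(3,4) graphlets(2) by (subst distinct_map) simp
    moreover have "set (map (\<lambda>b. edge_subgraph (?E ` set b)) bs) = graphlets_containing G In k"
      unfolding map set_map[of _ "map set bs"] bs(4) graphlets(1) ..
    ultimately have "enumerates es k (graphlets_containing G In k) (out s)"
      unfolding enumerates_def using bs(1,2) len by (intro exI[of _ bs]) (simp add: abstract_def)
    moreover have "exec S W prog (initial_state M) (22 + t) s"
      unfolding prog_def by (rule exec.Seq[OF s0(1) t(1)])
    ultimately show ?thesis using t(2) by (intro exI[of _ "22 + t"] exI[of _ s]) simp
  qed
  have nm: "1 \<le> n + m" using In_pos In_le by simp
  have skip: "triple 1 ASkip (abstract s\<^sub>0) ?post" if "?sols = {}"
    using wp_imp_triple[of ASkip ?post "abstract s\<^sub>0"] that \<sigma>(7) by (simp add: exI[of _ "[]"])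
  consider "k < card In" | "card In \<le> k" "m < k" | "card In \<le> k" "k \<le> m" by linarith
  then have "\<exists>t s. exec S W prog (initial_state M) t s \<and>
       enumerates es k (graphlets_containing G In k) (out s) \<and>
       t \<le> time_const * (n + m + k * N) \<and> (trimmed G In k \<longrightarrow> t \<le> time_const * (k * N + 1))"
  proof cases
    case 1
    have "?sols = {}"
    proof (rule equals0I)
      fix T assume "T \<in> ?sols"
      then have "T \<subseteq> {..<m}" "?I \<subseteq> T" "card T = k" by (simp_all add: sols_def)
      then show False using card_mono[of T ?I] finite_subset[of T "{..<m}"] 1 card_I by simp
    qed
    from skip[OF this] have "triple (6 + 1) guarded_main (abstract s\<^sub>0) ?post"
      unfolding guarded_main_def using 1 \<sigma> by (intro triple_If) auto
    from result[OF this] obtain t s where "exec S W prog (initial_state M) t s" "t \<le> 29"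
      "enumerates es k (graphlets_containing G In k) (out s)" by auto
    \<comment> \<open>There is no solution here, so in the trimmed bound the constant time is
      charged to the summand 1.\<close>
    moreover have "40 \<le> time_const * (n + m + k * N)" "40 \<le> time_const * (k * N + 1)"
      using C_pos[of "n + m + k * N"] C_pos[of "k * N + 1"] nm by simp_all
    ultimately show ?thesis by (intro exI[of _ t] exI[of _ s]) simp
  next
    case 2
    have "?sols = {}"
    proof (rule equals0I)
      fix T assume "T \<in> ?sols"
      then have "T \<subseteq> {..<m}" "card T = k" by (simp_all add: sols_def)
      then show False using card_mono[of "{..<m}" T] 2 by simp
    qed
    from skip[OF this] have "triple (6 + (6 + 1)) guarded_main (abstract s\<^sub>0) ?post"
      unfolding guarded_main_def using 2 \<sigma> by (intro triple_If) auto
    from result[OF this] obtain t s where "exec S W prog (initial_state M) t s" "t \<le> 35"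
      "enumerates es k (graphlets_containing G In k) (out s)" by auto
    moreover have "40 \<le> time_const * (n + m + k * N)" "40 \<le> time_const * (k * N + 1)"
      using C_pos[of "n + m + k * N"] C_pos[of "k * N + 1"] nm by simp_all
    ultimately show ?thesis by (intro exI[of _ t] exI[of _ s]) simp
  next
    case 3
    interpret enumeration n m S W k es ?I
      by unfold_locales (use len ends "is"(3) I_ne conn 3 in auto)
    have k1: "1 \<le> k" using In_pos 3 by simp
    \<comment> \<open>From \<open>VMark\<close> on, the arrays lie behind the input since
      \<open>card In \<le> m\<close>, hence they start out as zero.\<close>
    have cells: "arrs (abstract s\<^sub>0) A i = 0"
      if "base n m A \<ge> 4 + n + 7 * m" for A i
      using that zero[of "base n m A + i"] In_le by (simp add: \<sigma>(6) view_def)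
    have linked: "linked (abstract s\<^sub>0) {}"
      unfolding adj_def
    proof (intro allI impI)
      fix v assume v: "v < n"
      then obtain as where as: "distinct as" "set as = {a \<in> {..<2 * m}. arc_tail es a = v}"
        "ll (\<lambda>a. M (4 + n + 2 * m + a)) (\<lambda>a. M (4 + n + 4 * m + a)) 0 (M (4 + v)) as"
        using adj unfolding adj_def by blast
      have "ll (arrs (abstract s\<^sub>0) Succ) (arrs (abstract s\<^sub>0) Pred) 0 (M (4 + v)) as =
        ll (\<lambda>a. M (4 + n + 2 * m + a)) (\<lambda>a. M (4 + n + 4 * m + a)) 0 (M (4 + v)) as"
        by (rule ll_cong) (use as(2) in \<open>auto simp: \<sigma>(6) view_def\<close>)
      moreover have "arrs (abstract s\<^sub>0) First v = M (4 + v)" using v by (simp add: \<sigma>(6) view_def)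
      ultimately show "\<exists>as. distinct as \<and> set as = {a \<in> arcs {} UNIV. tail a = v} \<and>
        ll (arrs (abstract s\<^sub>0) Succ) (arrs (abstract s\<^sub>0) Pred) 0 (arrs (abstract s\<^sub>0) First v) as"
        using as by (intro exI[of _ as]) (auto simp: arcs_def)
    qed
    have "ready {} is (abstract s\<^sub>0)"
      unfolding ready_def static_def candidate_def
    proof (intro conjI)
      show "\<forall>a<2 * m. arrs (abstract s\<^sub>0) Head a = head a" using hd by (simp add: \<sigma>(6) view_def)
      show "arrs (abstract s\<^sub>0) EMark = (\<lambda>_. 0)" "arrs (abstract s\<^sub>0) VMark = (\<lambda>_. 0)"
        using cells by (auto simp: fun_eq_iff)
      show "holds (arrs (abstract s\<^sub>0) Chosen) is"
        using In In_le "is"(2) by (auto simp: holds_def \<sigma>(6) view_def)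
    qed (use \<sigma> linked "is" conn 3 in auto)
    then have "triple (6 + weight ?sols * (6 + body_time k)) main (abstract s\<^sub>0) ?post"
      by (rule triple_main) (use \<sigma> in auto)
    then have "triple (6 + (6 + (6 + weight ?sols * (6 + body_time k)))) guarded_main (abstract s\<^sub>0) ?post"
      unfolding guarded_main_def using 3 \<sigma> by (intro triple_If) auto
    from result[OF this] obtain t s where t: "exec S W prog (initial_state M) t s"
      "t \<le> 40 + weight ?sols * (6 + body_time k)"
      "enumerates es k (graphlets_containing G In k) (out s)" by auto
    let ?c = "6 + body_time 1"
    have "weight ?sols * (6 + body_time k) \<le> weight ?sols * (?c * k)"
      using body_time_le[OF k1] by (rule mult_left_mono) simp
    with t(2) have t': "t \<le> 40 + weight ?sols * (?c * k)" by linarith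
    have pos: "t \<le> time_const * (k * N)" if "1 \<le> N"
    proof -
      have "weight ?sols \<le> 2 * N" using that by (simp add: weight_def N)
      then have "weight ?sols * (?c * k) \<le> 2 * N * (?c * k)" by (rule mult_right_mono) simp
      moreover have "1 \<le> k * N" using that k1 by simp
      \<comment> \<open>Both \<open>k\<close> and \<open>N\<close> are positive, so the constant 40
        can be charged to \<open>k * N\<close>.\<close>
      ultimately have "t \<le> 40 * (k * N) + 2 * N * (?c * k)" using t' by linarith
      then show ?thesis by (simp add: time_const_def algebra_simps)
    qed
    \<comment> \<open>All \<open>m \<ge> k\<close> edges form a connected set, in which
      \<open>In\<close> grows to a solution.\<close>
    have trim: "1 \<le> N" if "trimmed G In k"
    proof -
      have "conn E {..<m}"
        using that conn "is" img by (intro trimmed_imp_conn[of G _ ?I k]) auto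
      then obtain T where "?I \<subseteq> T" "T \<subseteq> {..<m}" "conn E T" "card T = k"
        using conn_extend[OF conn, of "{..<m}" k] "is"(3) I_ne card_I 3 by auto
      then have "T \<in> ?sols" by (simp add: sols_def)
      then show ?thesis unfolding N by (metis card_0_eq empty_iff finite_sols less_one not_le)
    qed
    have "t \<le> time_const * (n + m + k * N)"
    proof (cases "N = 0")
      case True
      \<comment> \<open>Without solutions there is a single iteration of cost linear in
        \<open>k\<close>, and \<open>k \<le> m\<close> charges it to the size of the graph.\<close>
      then have "weight ?sols = 1" by (simp add: weight_def N)
      with t' have "t \<le> 40 + ?c * k" by simp
      also have "\<dots> \<le> 40 * (n + m) + 2 * ?c * (n + m)"
        using nm 3(2) by (intro add_mono mult_mono) auto
      also have "\<dots> \<le> time_const * (n + m + k * N)" by (simp add: time_const_def algebra_simps)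
      finally show ?thesis .
    next
      case False
      with pos have "t \<le> time_const * (k * N)" by simp
      then show ?thesis by (simp add: algebra_simps)
    qed
    moreover have "trimmed G In k \<longrightarrow> t \<le> time_const * (k * N + 1)"
      using pos trim by (auto simp: algebra_simps intro: trans_le_add1)
    ultimately show ?thesis using t by blast
  qed
  then show "let n = card (verts G); m = card (edges G); N = card (graphlets_containing G In k) in
     \<exists>t s. exec (time_const * (n + m)) (time_const * (n + m + k)) prog (initial_state M) t s \<and>
       enumerates es k (graphlets_containing G In k) (out s) \<and>
       t \<le> time_const * (n + m + k * N) \<and>
       (trimmed G In k \<longrightarrow> t \<le> time_const * (k * N + 1))"
    unfolding Let_def S_def W_def n_def m_def N_def .
qed

end
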